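(* Let $p<q$ be positive integers with $\gcd(p,q)=1$, and let $\mathcal A'_0=\mathcal A'_1=\{0,p,q\}\subset\mathbb Z$. Let $\varphi$ be the real root of $x^q+x^{q-p}-1=0$ with $0\le\varphi\le1$, and let $\phi$ be the real root of $x^q-x^{q-p}-1=0$ with $\phi\ge1$. Then \[m(\mathrm{Res}_{\mathcal A'_0,\mathcal A'_1})=\frac{2}{\pi^2}\Big(-p\,P_3(\varphi^q)-q\,P_3(-\varphi^p)+p\,P_3(\phi^q)+q\,P_3(\phi^p)\Big).\]
   Context: $\mathrm{Res}_{\mathcal A'_0,\mathcal A'_1}$ denotes the sparse resultant of the generic univariate polynomials $F_0=x_{01}+x_{02}t^p+x_{03}t^q$ and $F_1=x_{11}+x_{12}t^p+x_{13}t^q$: the irreducible primitive integer polynomial (unique up to sign) in $x_{01},\ldots,x_{13}$ vanishing exactly on the closure of the set of coefficients for which $F_0,F_1$ have a common nonzero root. The Mahler measure of a polynomial $g$ in $k$ variables is $m(g)=\frac{1}{(2\pi i)^k}\int_{\mathbb T^k}\log|g|\frac{dy_1}{y_1}\cdots\frac{dy_k}{y_k}$ over the unit torus. $\mathrm{Li}_q(z)=\sum_{j\ge1}z^j/j^q$ (analytically continued to $\mathbb C\setminus(1,\infty)$), and $P_3(z)=\mathrm{Re}\big(\mathrm{Li}_3(z)-\log|z|\,\mathrm{Li}_2(z)+\tfrac13\log^2|z|\,\mathrm{Li}_1(z)\big)$ is Zagier's modified trilogarithm, extended continuously to $\mathbb P^1(\mathbb C)$. *)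

theory Defs
  imports
    "HOL-Analysis.Analysis"
    "HOL-Complex_Analysis.Complex_Analysis"
    "HOL-Library.Poly_Mapping"
    "HOL-Library.Numeral_Type"
    "HOL-Computational_Algebra.Computational_Algebra"
begin

text \<open>
  A polynomial over \<open>'a\<close> in variables indexed by \<open>'n\<close> is a finitely supported map from
  exponent vectors to coefficients; \<open>Poly_Mapping\<close> makes this type a commutative ring
  (convolution product).
\<close>

type_synonym ('n, 'a) mvpoly = "('n \<Rightarrow>\<^sub>0 nat) \<Rightarrow>\<^sub>0 'a"

definition mv_eval :: "('n::finite, complex) mvpoly \<Rightarrow> complex ^ 'n \<Rightarrow> complex" where
  "mv_eval g x =
     (\<Sum>m\<in>Poly_Mapping.keys g.
        Poly_Mapping.lookup g m * (\<Prod>i\<in>UNIV. (x $ i) ^ Poly_Mapping.lookup m i))"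

definition complexify :: "('n, int) mvpoly \<Rightarrow> ('n, complex) mvpoly" where
  "complexify g = Poly_Mapping.map of_int g"

definition primitive_mvpoly :: "('n, int) mvpoly \<Rightarrow> bool" where
  "primitive_mvpoly g \<longleftrightarrow> Gcd (Poly_Mapping.lookup g ` Poly_Mapping.keys g) = 1"

definition zariski_closure :: "(complex ^ 'n::finite) set \<Rightarrow> (complex ^ 'n) set" where
  "zariski_closure S =
     {x. \<forall>g :: ('n, complex) mvpoly. (\<forall>s\<in>S. mv_eval g s = 0) \<longrightarrow> mv_eval g x = 0}"

text \<open>
  The torus integral is written in the coordinates \<open>y\<^sub>j = exp(i \<theta>\<^sub>j)\<close>, in which
  \<open>dy\<^sub>j / y\<^sub>j = i d\<theta>\<^sub>j\<close>. For \<open>g \<noteq> 0\<close> the points with \<open>g = 0\<close>, where \<open>ln 0 = 0\<close> by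
  convention, form a null set.
\<close>

definition mahler_measure :: "('n::finite, complex) mvpoly \<Rightarrow> real" where
  "mahler_measure g =
     1 / (2 * pi) ^ CARD('n) *
     (LINT \<theta> : cbox 0 (\<chi> j. 2 * pi) | (lborel :: (real ^ 'n) measure).
        ln (norm (mv_eval g (\<chi> j. cis (\<theta> $ j)))))"

text \<open>
  The coefficients \<open>(x\<^sub>0\<^sub>1, x\<^sub>0\<^sub>2, x\<^sub>0\<^sub>3, x\<^sub>1\<^sub>1, x\<^sub>1\<^sub>2, x\<^sub>1\<^sub>3)\<close> of the two generic trinomials are the
  coordinates \<open>1, \<dots>, 6\<close> of a vector. Numerals of the six-element index type are taken
  modulo 6, so \<open>6 = 0\<close> and \<open>1, \<dots>, 6\<close> are its six elements.
\<close>

definition trinomial0 :: "nat \<Rightarrow> nat \<Rightarrow> complex ^ 6 \<Rightarrow> complex \<Rightarrow> complex" where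
  "trinomial0 p q x t = x $ 1 + x $ 2 * t ^ p + x $ 3 * t ^ q"

definition trinomial1 :: "nat \<Rightarrow> nat \<Rightarrow> complex ^ 6 \<Rightarrow> complex \<Rightarrow> complex" where
  "trinomial1 p q x t = x $ 4 + x $ 5 * t ^ p + x $ 6 * t ^ q"

text \<open>
  The sparse resultant of the supports \<open>{0, p, q}\<close>, \<open>{0, p, q}\<close> is determined up to sign only;
  the predicate holds for either choice. Irreducibility is over the integers.
\<close>

definition is_sparse_resultant :: "nat \<Rightarrow> nat \<Rightarrow> (6, int) mvpoly \<Rightarrow> bool" where
  "is_sparse_resultant p q R \<longleftrightarrow>
     irreducible R \<and> primitive_mvpoly R \<and>
     {x. mv_eval (complexify R) x = 0} =
       zariski_closure {x. \<exists>t. t \<noteq> 0 \<and> trinomial0 p q x t = 0 \<and> trinomial1 p q x t = 0}"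

text \<open>
  The holomorphic function on the plane slit along \<open>[1,\<infinity>)\<close> extending the power series is
  unique there by the identity theorem. The value at 1 is that of the series (meaningful for
  \<open>s \<ge> 2\<close>); the values on \<open>(1,\<infinity>)\<close> are unspecified.
\<close>

definition polylog_cut :: "complex set" where
  "polylog_cut = complex_of_real ` {1..}"

definition polylog :: "nat \<Rightarrow> complex \<Rightarrow> complex" where
  "polylog s = (SOME f. f holomorphic_on (- polylog_cut) \<and>
     (\<forall>z\<in>insert 1 (ball 0 1). f z = suminf (\<lambda>j. z ^ Suc j / of_nat (Suc j) ^ s)))"

text \<open>
  Zagier's modified trilogarithm: the defining formula off \<open>0\<close> and the cut, and the continuous
  extension of that formula elsewhere (the value at infinity is not represented).
\<close>

definition P3_formula :: "complex \<Rightarrow> real" where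
  "P3_formula z =
     Re (polylog 3 z - of_real (ln (norm z)) * polylog 2 z
         + 1 / 3 * of_real ((ln (norm z))\<^sup>2) * polylog 1 z)"

definition P3 :: "complex \<Rightarrow> real" where
  "P3 z = (let D = - insert 0 polylog_cut in
     if z \<in> D then P3_formula z else Lim (at z within D) P3_formula)"

end

theory Submission
  imports Defs "HOL-Probability.Infinite_Product_Measure" "HOL-Real_Asymp.Real_Asymp"
begin

text \<open>
  Two trinomials share a nonzero root iff \<open>(1, t\<^sup>p, t\<^sup>q)\<close> is proportional to the vector
  \<open>(A, B, C)\<close> of \<open>2 \<times> 2\<close> minors of the coefficient matrix, so the resultant is
  \<open>B\<^sup>q - A\<^bsup>q - p\<^esup> C\<^sup>p\<close> up to sign. Rotating the variables and applying Jensen's formula in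
  one of them leaves the average of the positive part of
  \<open>(q - p) ln |a\<^sub>3 - a\<^sub>2| + p ln |a\<^sub>2 - a\<^sub>1| - q ln |a\<^sub>1 - a\<^sub>3|\<close> over triples of points on the circle.
  In terms of the ratios \<open>X\<close>, \<open>Y\<close> of the side lengths of the inscribed triangle this is an integral of
  \<open>((q - p) ln X + p ln Y)\<^sup>+\<close> with respect to \<open>d ln X d ln Y\<close> over the region where the triangle
  inequalities hold for \<open>X, Y, 1\<close>. Integrating out \<open>Y\<close> leaves squares of logarithms whose primitives are
  values of \<open>P3\<close>, because the dilogarithms cancel from \<open>d P3\<close> on the real line; the ends of the
  integration range are \<open>\<phi>\<^sup>p\<close> and \<open>\<Phi>\<^sup>p\<close>.
\<close>

section \<open>Polylogarithms on the slit plane\<close>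

text \<open>\<open>is_sparse_resultant\<close> describes \<open>R\<close> only by irreducibility,
  primitivity and a zero set, so the explicit polynomial is reached through divisibility: it divides
  \<open>R\<close> over the integers because \<open>R\<close> vanishes wherever the trinomials share
  a nonzero root. It is not a unit, hence the cofactor is one, and a unit has absolute value 1 at
  every complex point, which is all that a Mahler measure sees. On the analytic side the obstacle is
  the logarithmic singularity on the zero set. The logarithm of the resultant enters as the
  nonnegative function \<open>M - ln\<close>, where \<open>M = (q + 1) ln 2\<close> bounds that
  logarithm on the torus. Integrals in \<open>ennreal\<close> can then be reordered freely, and
  finiteness comes out at the end. \<open>polylog\<close> is chosen by \<open>SOME\<close>, so
  nothing is known about it until a continuation has been constructed. Moreover
  \<open>\<Phi> ^ p\<close> and \<open>\<Phi> ^ q\<close> lie on the cut, where \<open>P3\<close> is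
  a limit; the symmetry under inversion evaluates it.\<close>

lemma polylog_cut_iff: "z \<in> polylog_cut \<longleftrightarrow> Im z = 0 \<and> 1 \<le> Re z"
proof
  assume "Im z = 0 \<and> 1 \<le> Re z"
  then have "z = complex_of_real (Re z)" "Re z \<in> {1..}" by (auto simp: complex_eq_iff)
  then show "z \<in> polylog_cut" unfolding polylog_cut_def by blast
qed (auto simp: polylog_cut_def)

lemma open_polylog_domain: "open (- polylog_cut)"
  unfolding polylog_cut_def by (simp add: closed_slot_right open_Compl)

lemma starlike_polylog_domain: "starlike (- polylog_cut)"
  unfolding polylog_cut_def by (rule starlike_slotted_complex_plane_right)

lemma connected_polylog_domain: "connected (- polylog_cut)"
  by (rule starlike_imp_connected[OF starlike_polylog_domain])

lemma ball_subset_polylog_domain: "ball 0 1 \<subseteq> - polylog_cut"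
  by (auto simp: polylog_cut_iff) (meson abs_Re_le_cmod abs_ge_self not_less order_trans)

text \<open>The series in \<open>polylog\<close> starts with the first power. Reindexing it from 0
  with constant term 0 gives the shape in which power series are differentiated term by
  term.\<close>

definition polylog_coeff :: "nat \<Rightarrow> nat \<Rightarrow> complex" where
  "polylog_coeff s n = (if n = 0 then 0 else 1 / of_nat n ^ s)"

definition polylog_ser :: "nat \<Rightarrow> complex \<Rightarrow> complex" where
  "polylog_ser s z = suminf (\<lambda>n. polylog_coeff s n * z ^ n)"

lemma polylog_ser_summable:
  assumes "norm z < 1" shows "summable (\<lambda>n. polylog_coeff s n * z ^ n)"
proof (rule summable_comparison_test')
  show "summable (\<lambda>n. norm z ^ n)" using assms by (intro summable_geometric) auto
  show "norm (polylog_coeff s n * z ^ n) \<le> norm z ^ n" if "n \<ge> 0" for n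
  proof (cases "n = 0")
    case False
    then have "1 \<le> real n ^ s" by (simp add: one_le_power)
    then have "norm (polylog_coeff s n) \<le> 1"
      using False by (simp add: polylog_coeff_def norm_divide norm_power divide_le_eq)
    then show ?thesis by (simp add: norm_mult norm_power mult_left_le_one_le)
  qed (simp add: polylog_coeff_def)
qed

lemma polylog_ser_altdef:
  assumes "norm z < 1"
  shows "suminf (\<lambda>j. z ^ Suc j / of_nat (Suc j) ^ s) = polylog_ser s z"
  using suminf_split_head[OF polylog_ser_summable[OF assms, of s]]
  by (simp add: polylog_ser_def polylog_coeff_def del: of_nat_Suc)

text \<open>Differentiation turns \<open>1 / n ^ Suc s\<close> into \<open>1 / n ^ s\<close> and
  shifts the index by one. The equation is multiplied by \<open>z\<close> so that it also covers the
  point 0.\<close>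

lemma polylog_ser_deriv:
  assumes "norm z < 1"
  shows "\<exists>D. (polylog_ser (Suc s) has_field_derivative D) (at z) \<and> z * D = polylog_ser s z"
proof (intro exI conjI)
  show "(polylog_ser (Suc s) has_field_derivative
      (suminf (\<lambda>n. diffs (polylog_coeff (Suc s)) n * z ^ n))) (at z)"
    unfolding polylog_ser_def[abs_def]
    by (rule termdiffs_strong'[OF polylog_ser_summable assms])
  have d: "diffs (polylog_coeff (Suc s)) n = polylog_coeff s (Suc n)" for n
    by (simp add: diffs_def polylog_coeff_def del: of_nat_Suc)
  have "summable (\<lambda>n. polylog_coeff s (Suc n) * z ^ n)"
    unfolding d[symmetric]
    by (rule termdiff_converges[of _ 1]) (use assms polylog_ser_summable in auto)
  from suminf_mult[OF this, of z]
  show "z * (suminf (\<lambda>n. diffs (polylog_coeff (Suc s)) n * z ^ n)) = polylog_ser s z"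
    using suminf_split_head[OF polylog_ser_summable[OF assms, of s]]
    unfolding d polylog_ser_def by (simp add: polylog_coeff_def mult_ac)
qed

lemma polylog_ser_0: "polylog_ser s 0 = 0"
  unfolding polylog_ser_def by (subst powser_zero) (simp add: polylog_coeff_def)

lemma polylog_ser_zero_order:
  assumes "norm z < 1" shows "polylog_ser 0 z = z / (1 - z)"
proof -
  have "(\<lambda>j. z ^ Suc j / of_nat (Suc j) ^ 0) sums (z * (1 / (1 - z)))"
    using sums_mult[OF geometric_sums[OF assms], of z] by simp
  then show ?thesis using polylog_ser_altdef[OF assms, of 0] by (simp add: sums_iff)
qed

text \<open>Induction on the order: the next polylogarithm is a primitive of the previous one
  divided by \<open>z\<close>. The singularity at 0 is removable because the previous function
  vanishes there, and primitives exist because the slit plane is starlike.\<close>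

lemma polylog_continuation_exists:
  "\<exists>f. f holomorphic_on (- polylog_cut) \<and> (\<forall>z\<in>ball 0 1. f z = polylog_ser s z)"
proof (induction s)
  case 0
  have "1 \<in> polylog_cut" by (simp add: polylog_cut_iff)
  then have "(\<lambda>z. z / (1 - z)) holomorphic_on (- polylog_cut)"
    by (auto intro!: holomorphic_intros)
  then show ?case using polylog_ser_zero_order by (intro exI[of _ "\<lambda>z. z / (1 - z)"]) auto
next
  case (Suc s)
  then obtain f where f: "f holomorphic_on (- polylog_cut)"
    "\<And>z. norm z < 1 \<Longrightarrow> f z = polylog_ser s z" by auto
  define g where "g = (\<lambda>z. if z = 0 then deriv f 0 else f z / z)"
  have g: "g holomorphic_on (- polylog_cut)"
    by (rule pole_theorem_open_0[OF f(1) open_polylog_domain, where a = 0])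
      (auto simp: g_def f(2) polylog_ser_0)
  obtain G where G: "\<And>z. z \<in> - polylog_cut \<Longrightarrow> (G has_field_derivative g z) (at z)"
  proof -
    have "\<exists>G. \<forall>x\<in>- polylog_cut. (G has_field_derivative g x) (at x)"
      by (rule holomorphic_starlike_primitive[OF holomorphic_on_imp_continuous_on[OF g]
            starlike_polylog_domain open_polylog_domain finite.emptyI])
        (use holomorphic_on_imp_differentiable_at[OF g open_polylog_domain] in auto)
    then show ?thesis using that by blast
  qed
  \<comment> \<open>The derivatives of \<open>G\<close> and of the series are compared off 0 only,
    where the factor \<open>z\<close> can be divided out; continuity at 0 closes the gap.\<close>
  have eq: "G z - polylog_ser (Suc s) z = G 0" if z: "norm z < 1" for z
  proof -
    obtain c where c: "\<And>x. x \<in> ball 0 1 \<Longrightarrow> G x - polylog_ser (Suc s) x = c"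
    proof (rule DERIV_zero_connected_constant[of "ball 0 1 :: complex set" "{0}"
          "\<lambda>x. G x - polylog_ser (Suc s) x"])
      show "continuous_on (ball 0 1) (\<lambda>x. G x - polylog_ser (Suc s) x)"
      proof (intro continuous_at_imp_continuous_on ballI)
        fix x :: complex assume x: "x \<in> ball 0 1"
        then have "x \<in> - polylog_cut" using ball_subset_polylog_domain by blast
        then show "isCont (\<lambda>x. G x - polylog_ser (Suc s) x) x"
          using G[of x] polylog_ser_deriv[of x s] x DERIV_isCont
          by (intro continuous_intros) fastforce+
      qed
      show "\<forall>x\<in>ball 0 1 - {0}. ((\<lambda>x. G x - polylog_ser (Suc s) x) has_field_derivative 0) (at x)"
      proof
        fix x :: complex assume x: "x \<in> ball 0 1 - {0}"
        then have xD: "x \<in> - polylog_cut" using ball_subset_polylog_domain by blast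
        obtain D where D: "(polylog_ser (Suc s) has_field_derivative D) (at x)"
          "x * D = polylog_ser s x" using polylog_ser_deriv[of x s] x by auto
        have "D = g x" using D(2) x f(2)[of x] by (auto simp: g_def field_simps)
        then show "((\<lambda>x. G x - polylog_ser (Suc s) x) has_field_derivative 0) (at x)"
          using DERIV_diff[OF G[OF xD] D(1)] by simp
      qed
    qed auto
    show ?thesis using c[of z] c[of 0] z by (simp add: polylog_ser_0)
  qed
  show ?case
  proof (intro exI[of _ "\<lambda>z. G z - G 0"] conjI ballI)
    show "(\<lambda>z. G z - G 0) holomorphic_on - polylog_cut"
      using G open_polylog_domain by (intro holomorphic_intros) (auto simp: holomorphic_on_open)
    fix z :: complex assume "z \<in> ball 0 1"
    then show "G z - G 0 = polylog_ser (Suc s) z" using eq[of z] by (simp add: diff_eq_eq add.commute)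
  qed
qed

lemma polylog_props:
  "polylog s holomorphic_on (- polylog_cut)"
  "norm z < 1 \<Longrightarrow> polylog s z = polylog_ser s z"
proof -
  let ?Q = "\<lambda>f. f holomorphic_on (- polylog_cut) \<and>
     (\<forall>z\<in>insert 1 (ball 0 1). f z = (suminf (\<lambda>j. z ^ Suc j / of_nat (Suc j) ^ s)))"
  obtain f where f: "f holomorphic_on (- polylog_cut)" "\<forall>z\<in>ball 0 1. f z = polylog_ser s z"
    using polylog_continuation_exists by blast
  \<comment> \<open>The choice in \<open>polylog\<close> also prescribes the value at 1. This point
    lies on the cut, so overwriting the value there does not affect holomorphy.\<close>
  define h where "h = f(1 := (suminf (\<lambda>j. 1 ^ Suc j / of_nat (Suc j) ^ s)))"
  have "1 \<in> polylog_cut" by (simp add: polylog_cut_iff)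
  then have "h holomorphic_on (- polylog_cut)"
    by (intro holomorphic_transform[OF f(1)]) (auto simp: h_def)
  moreover have "h z = (suminf (\<lambda>j. z ^ Suc j / of_nat (Suc j) ^ s))" if "z \<in> insert 1 (ball 0 1)" for z
    using that f(2) polylog_ser_altdef[of z s] by (cases "z = 1") (auto simp: h_def)
  ultimately have "?Q h" by blast
  then have Q: "?Q (polylog s)" unfolding polylog_def by (rule someI[where P = ?Q])
  then show "polylog s holomorphic_on (- polylog_cut)" by blast
  show "polylog s z = polylog_ser s z" if "norm z < 1"
    using Q that polylog_ser_altdef[OF that, of s] by auto
qed

lemma polylog_0: "polylog s 0 = 0"
  by (simp add: polylog_props polylog_ser_0)

lemma polylog_domain_eqI:
  assumes "f holomorphic_on (- polylog_cut)" "g holomorphic_on (- polylog_cut)"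
    and "\<And>z. norm z < 1 \<Longrightarrow> f z = g z" and "z \<notin> polylog_cut"
  shows "f z = g z"
  by (rule analytic_continuation_open[of "ball 0 1" "- polylog_cut" f g])
    (use assms open_polylog_domain connected_polylog_domain ball_subset_polylog_domain in auto)

text \<open>The differential equation is known on the unit disc from the series; the identity
  theorem carries it to the whole slit plane.\<close>

lemma polylog_has_field_derivative:
  assumes "z \<notin> polylog_cut" "z \<noteq> 0"
  shows "(polylog (Suc s) has_field_derivative polylog s z / z) (at z)"
proof -
  have "z * deriv (polylog (Suc s)) z = polylog s z"
  proof (rule polylog_domain_eqI[where f = "\<lambda>z. z * deriv (polylog (Suc s)) z"])
    show "(\<lambda>z. z * deriv (polylog (Suc s)) z) holomorphic_on - polylog_cut"
      by (intro holomorphic_intros holomorphic_deriv polylog_props open_polylog_domain)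
    fix z :: complex assume z: "norm z < 1"
    obtain D where D: "(polylog_ser (Suc s) has_field_derivative D) (at z)"
        "z * D = polylog_ser s z" using polylog_ser_deriv[OF z] by blast
    have "(polylog (Suc s) has_field_derivative D) (at z)"
      by (rule has_field_derivative_transform_within_open[OF D(1) open_ball[of 0 1]])
        (simp_all add: z polylog_props(2))
    then show "z * deriv (polylog (Suc s)) z = polylog s z"
      using D(2) polylog_props(2)[OF z] by (simp add: DERIV_imp_deriv)
  qed (rule polylog_props(1) assms(1))+
  moreover have "(polylog (Suc s) has_field_derivative deriv (polylog (Suc s)) z) (at z)"
    using polylog_props(1) open_polylog_domain assms
    by (intro holomorphic_derivI) auto
  ultimately show ?thesis using assms(2) by (metis nonzero_mult_div_cancel_left)
qed

lemma polylog_1: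
  assumes "z \<notin> polylog_cut"
  shows "polylog (Suc 0) z = - Ln (1 - z)"
proof (rule polylog_domain_eqI[OF polylog_props(1) _ _ assms])
  show "(\<lambda>z. - Ln (1 - z)) holomorphic_on - polylog_cut"
    by (intro holomorphic_intros) (auto simp: polylog_cut_iff complex_nonpos_Reals_iff)
  show "polylog (Suc 0) z = - Ln (1 - z)" if "norm z < 1" for z
  proof -
    have "(\<lambda>n. - (z ^ n) / of_nat n) sums ln (1 - z)"
      using Ln_series'[of "- z"] that by simp
    from sums_minus[OF this] have "(\<lambda>n. polylog_coeff 1 n * z ^ n) sums (- ln (1 - z))"
      by (auto simp: polylog_coeff_def elim!: back_subst[of "\<lambda>f. f sums _"])
    then show ?thesis
      by (simp add: polylog_props(2)[OF that] polylog_ser_def sums_iff)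
  qed
qed

text \<open>Schwarz reflection: the series has real coefficients, so conjugating both argument and
  value gives another continuation of the same series.\<close>

lemma polylog_cnj:
  assumes "z \<notin> polylog_cut"
  shows "polylog s (cnj z) = cnj (polylog s z)"
proof -
  have "cnj ` (- polylog_cut) = - polylog_cut"
    by (auto simp: polylog_cut_iff image_cnj_conv_vimage_cnj)
  then have "(cnj \<circ> polylog s \<circ> cnj) holomorphic_on (- polylog_cut)"
    by (intro holomorphic_on_compose_cnj_cnj) (auto simp: polylog_props open_polylog_domain)
  then have "(cnj \<circ> polylog s \<circ> cnj) z = polylog s z"
  proof (rule polylog_domain_eqI[OF _ polylog_props(1) _ assms])
    fix z :: complex assume z: "norm z < 1"
    have "cnj (polylog_ser s (cnj z)) = polylog_ser s z"
    proof -
      have "(\<lambda>n. polylog_coeff s n * cnj z ^ n) sums polylog_ser s (cnj z)"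
        unfolding polylog_ser_def using z by (intro summable_sums polylog_ser_summable) simp
      then have "(\<lambda>n. cnj (polylog_coeff s n * cnj z ^ n)) sums cnj (polylog_ser s (cnj z))"
        by (simp only: sums_cnj)
      also have "(\<lambda>n. cnj (polylog_coeff s n * cnj z ^ n)) = (\<lambda>n. polylog_coeff s n * z ^ n)"
        by (auto simp: polylog_coeff_def)
      finally show ?thesis by (simp add: polylog_ser_def sums_iff)
    qed
    then show "(cnj \<circ> polylog s \<circ> cnj) z = polylog s z" using z polylog_props(2) by simp
  qed
  then have "cnj (polylog s (cnj z)) = polylog s z" by simp
  then show ?thesis by (metis complex_cnj_cnj)
qed

lemma polylog_real:
  assumes "x < 1" shows "Im (polylog s (of_real x)) = 0"
  using polylog_cnj[of "of_real x" s] assms by (simp add: polylog_cut_iff complex_eq_iff)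

section \<open>Zagier's trilogarithm on the real line\<close>

text \<open>The plane slit along the nonnegative reals is the domain of the inversion formulas: it
  is stable under reciprocals, avoids the cut, and carries a holomorphic branch of the logarithm of
  \<open>- z\<close>.\<close>

lemma off_nonneg_ray:
  assumes "z \<in> - \<real>\<^sub>\<ge>\<^sub>0"
  shows "z \<noteq> 0" "z \<notin> polylog_cut" "1 / z \<notin> polylog_cut" "- z \<notin> \<real>\<^sub>\<le>\<^sub>0"
proof -
  show "z \<noteq> 0" "z \<notin> polylog_cut" "- z \<notin> \<real>\<^sub>\<le>\<^sub>0"
    using assms by (auto simp: complex_nonneg_Reals_iff polylog_cut_iff complex_nonpos_Reals_iff)
  show "1 / z \<notin> polylog_cut"
  proof
    assume "1 / z \<in> polylog_cut"
    then obtain r :: real where r: "1 \<le> r" "1 / z = of_real r" by (auto simp: polylog_cut_def)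
    then have "z = of_real (1 / r)" using \<open>z \<noteq> 0\<close> by (auto simp: field_simps)
    with r assms show False by (auto simp: complex_nonneg_Reals_iff)
  qed
qed

lemma open_off_nonneg_ray: "open (- \<real>\<^sub>\<ge>\<^sub>0 :: complex set)"
  by (simp add: open_Compl)

lemma connected_off_nonneg_ray: "connected (- \<real>\<^sub>\<ge>\<^sub>0 :: complex set)"
proof -
  have "(\<real>\<^sub>\<ge>\<^sub>0 :: complex set) = of_real ` {0..}" by (auto simp: nonneg_Reals_def)
  then show ?thesis
    using starlike_imp_connected[OF starlike_slotted_complex_plane_right[of 0]] by simp
qed

lemma polylog_reciprocal_has_field_derivative:
  assumes "z \<in> - \<real>\<^sub>\<ge>\<^sub>0"
  shows "((\<lambda>w. polylog (Suc s) (1 / w)) has_field_derivative - polylog s (1 / z) / z) (at z)"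
proof -
  note z = off_nonneg_ray[OF assms]
  have "((\<lambda>w. 1 / w) has_field_derivative - (1 / z ^ 2)) (at z)"
    using z(1) by (auto intro!: derivative_eq_intros simp: power2_eq_square)
  from DERIV_chain2[OF polylog_has_field_derivative[of "1 / z" s] this] z show ?thesis
    by (simp add: power2_eq_square)
qed

lemma Ln_uminus_has_field_derivative:
  assumes "z \<in> - \<real>\<^sub>\<ge>\<^sub>0"
  shows "((\<lambda>w. Ln (- w)) has_field_derivative 1 / z) (at z)"
  using off_nonneg_ray[OF assms] by (auto intro!: derivative_eq_intros simp: divide_inverse)

text \<open>The base point \<open>- 1\<close> is its own reciprocal and satisfies
  \<open>Ln (- z) = 0\<close>, so the constants of the inversion formulas can be read off
  there.\<close>

lemma eq_on_off_nonneg_ray: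
  fixes f :: "complex \<Rightarrow> complex"
  assumes "\<And>z. z \<in> - \<real>\<^sub>\<ge>\<^sub>0 \<Longrightarrow> (f has_field_derivative 0) (at z)" "z \<in> - \<real>\<^sub>\<ge>\<^sub>0"
  shows "f z = f (- 1)"
proof -
  have "f constant_on (- \<real>\<^sub>\<ge>\<^sub>0)"
    by (rule has_field_derivative_0_imp_constant_on)
      (use assms open_off_nonneg_ray connected_off_nonneg_ray in auto)
  moreover have "- 1 \<in> - \<real>\<^sub>\<ge>\<^sub>0" by (auto simp: complex_nonneg_Reals_iff)
  ultimately show ?thesis using assms(2) unfolding constant_on_def by metis
qed

text \<open>This and the next two lemmas climb one order at a time: the derivative of each
  combination is the preceding combination divided by \<open>z\<close>, hence zero.\<close>

lemma polylog_1_inversion: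
  assumes "z \<in> - \<real>\<^sub>\<ge>\<^sub>0"
  shows "polylog (Suc 0) z - polylog (Suc 0) (1 / z) = - Ln (- z)"
proof -
  define f where "f = (\<lambda>z. polylog (Suc 0) z - polylog (Suc 0) (1 / z) + Ln (- z))"
  have "f z = f (- 1)"
  proof (rule eq_on_off_nonneg_ray[OF _ assms])
    fix z :: complex assume z: "z \<in> - \<real>\<^sub>\<ge>\<^sub>0"
    note z' = off_nonneg_ray[OF z]
    have "polylog 0 w = w / (1 - w)" if "w \<notin> polylog_cut" for w
    proof (rule polylog_domain_eqI[OF polylog_props(1) _ _ that])
      show "(\<lambda>z. z / (1 - z)) holomorphic_on - polylog_cut"
        by (auto intro!: holomorphic_intros simp: polylog_cut_iff)
    qed (simp add: polylog_props polylog_ser_zero_order)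
    note p0 = this
    have ne: "z \<noteq> 1" using z'(2) by (auto simp: polylog_cut_iff)
    have "polylog 0 z / z - (- polylog 0 (1 / z) / z) + 1 / z = 0"
    proof -
      have "polylog 0 (1 / z) = 1 / (z - 1)"
        using z'(1) ne by (simp add: p0[OF z'(3)] divide_simps)
      moreover have "polylog 0 z / z = 1 / (1 - z)" using z'(1) by (simp add: p0[OF z'(2)])
      moreover have "1 / (1 - z) + 1 / (z - 1) / z + 1 / z = 0"
        using z'(1) ne by (simp add: divide_simps) (simp add: algebra_simps)
      ultimately show ?thesis by simp
    qed
    then show "(f has_field_derivative 0) (at z)" unfolding f_def
      using DERIV_add[OF DERIV_diff[OF polylog_has_field_derivative[OF z'(2,1)]
            polylog_reciprocal_has_field_derivative[OF z]] Ln_uminus_has_field_derivative[OF z],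
          of 0 0] by simp
  qed
  then show ?thesis by (simp add: f_def algebra_simps eq_neg_iff_add_eq_0)
qed

text \<open>The constant is minus pi squared over 6. It is kept as
  \<open>2 * polylog 2 (- 1)\<close>, of which only the reality is used later.\<close>

lemma polylog_2_inversion:
  assumes "z \<in> - \<real>\<^sub>\<ge>\<^sub>0"
  shows "polylog 2 z + polylog 2 (1 / z) = 2 * polylog 2 (- 1) - Ln (- z) ^ 2 / 2"
proof -
  define f where "f = (\<lambda>z. polylog (Suc (Suc 0)) z + polylog (Suc (Suc 0)) (1 / z) + Ln (- z) ^ 2 / 2)"
  have "f z = f (- 1)"
  proof (rule eq_on_off_nonneg_ray[OF _ assms])
    fix z :: complex assume z: "z \<in> - \<real>\<^sub>\<ge>\<^sub>0"
    note z' = off_nonneg_ray[OF z]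
    have "polylog (Suc 0) z / z + (- polylog (Suc 0) (1 / z) / z) + Ln (- z) * (1 / z)
        = (polylog (Suc 0) z - polylog (Suc 0) (1 / z) + Ln (- z)) / z"
      by (simp add: add_divide_distrib diff_divide_distrib)
    then have "polylog (Suc 0) z / z + (- polylog (Suc 0) (1 / z) / z) + Ln (- z) * (1 / z) = 0"
      using polylog_1_inversion[OF z] by simp
    moreover have "((\<lambda>z. Ln (- z) ^ 2 / 2) has_field_derivative Ln (- z) * (1 / z)) (at z)"
      by (rule DERIV_cong[OF DERIV_cdivide[OF DERIV_power[OF Ln_uminus_has_field_derivative[OF z],
              of 2], of 2]]) simp
    ultimately show "(f has_field_derivative 0) (at z)" unfolding f_def
      using DERIV_add[OF DERIV_add[OF polylog_has_field_derivative[OF z'(2,1)]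
            polylog_reciprocal_has_field_derivative[OF z]],
          of "\<lambda>z. Ln (- z) ^ 2 / 2" "Ln (- z) * (1 / z)" "Suc 0" "Suc 0"] by simp
  qed
  then show ?thesis by (simp add: f_def numeral_2_eq_2 algebra_simps)
qed

lemma polylog_3_inversion:
  assumes "z \<in> - \<real>\<^sub>\<ge>\<^sub>0"
  shows "polylog 3 z - polylog 3 (1 / z) = 2 * polylog 2 (- 1) * Ln (- z) - Ln (- z) ^ 3 / 6"
proof -
  define c where "c = 2 * polylog (Suc (Suc 0)) (- 1)"
  define f where "f = (\<lambda>z. polylog (Suc (Suc (Suc 0))) z - polylog (Suc (Suc (Suc 0))) (1 / z)
     + (Ln (- z) ^ 3 / 6 - c * Ln (- z)))"
  have "f z = f (- 1)"
  proof (rule eq_on_off_nonneg_ray[OF _ assms])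
    fix z :: complex assume z: "z \<in> - \<real>\<^sub>\<ge>\<^sub>0"
    note z' = off_nonneg_ray[OF z]
    have "polylog (Suc (Suc 0)) z / z - (- polylog (Suc (Suc 0)) (1 / z) / z)
        + (Ln (- z) ^ 2 / 2 - c) * (1 / z)
      = (polylog 2 z + polylog 2 (1 / z) + Ln (- z) ^ 2 / 2 - c) / z"
      by (simp add: numeral_2_eq_2 add_divide_distrib diff_divide_distrib)
    also have "\<dots> = 0"
      using polylog_2_inversion[OF z] by (simp add: c_def numeral_2_eq_2)
    finally have "polylog (Suc (Suc 0)) z / z - (- polylog (Suc (Suc 0)) (1 / z) / z)
        + (Ln (- z) ^ 2 / 2 - c) * (1 / z) = 0" .
    moreover have "((\<lambda>z. Ln (- z) ^ 3 / 6 - c * Ln (- z)) has_field_derivative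
        (Ln (- z) ^ 2 / 2 - c) * (1 / z)) (at z)"
      by (rule DERIV_cong[OF DERIV_diff[OF
              DERIV_cdivide[OF DERIV_power[OF Ln_uminus_has_field_derivative[OF z], of 3], of 6]
              DERIV_cmult[OF Ln_uminus_has_field_derivative[OF z], of c]]])
        (simp add: left_diff_distrib diff_divide_distrib)
    ultimately show "(f has_field_derivative 0) (at z)" unfolding f_def
      using DERIV_add[OF DERIV_diff[OF polylog_has_field_derivative[OF z'(2,1)]
            polylog_reciprocal_has_field_derivative[OF z]],
          of "\<lambda>z. Ln (- z) ^ 3 / 6 - c * Ln (- z)" "(Ln (- z) ^ 2 / 2 - c) * (1 / z)"
            "Suc (Suc 0)" "Suc (Suc 0)"] by simp
  qed
  then show ?thesis by (simp add: f_def c_def numeral_2_eq_2 numeral_3_eq_3 algebra_simps)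
qed

text \<open>With \<open>Ln (- z) = l + i \<theta>\<close>, the constant contributes its multiple of
  \<open>Re (Ln (- z)) - l = 0\<close>. The cubic terms in \<open>l\<close> and
  \<open>\<theta>\<close> cancel thanks to the coefficient \<open>1 / 3\<close> in Zagier's
  formula.\<close>

lemma P3_formula_inversion:
  assumes "z \<in> - \<real>\<^sub>\<ge>\<^sub>0"
  shows "P3_formula (1 / z) = P3_formula z"
proof -
  note z = off_nonneg_ray[OF assms]
  define l where "l = ln (norm z)"
  define \<theta> where "\<theta> = Im (Ln (- z))"
  have L: "Ln (- z) = Complex l \<theta>"
    using z(1) by (simp add: complex_eq_iff l_def \<theta>_def)
  have l': "ln (norm (1 / z)) = - l" using z(1) by (simp add: norm_divide l_def ln_div)
  have im: "Im (polylog 2 (- 1)) = 0" using polylog_real[of "- 1" 2] by simp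
  have 1: "polylog (Suc 0) z = polylog (Suc 0) (1 / z) - Complex l \<theta>"
    using polylog_1_inversion[OF assms] L by (simp add: algebra_simps)
  have 2: "polylog 2 z = 2 * polylog 2 (- 1) - Complex l \<theta> ^ 2 / 2 - polylog 2 (1 / z)"
    using polylog_2_inversion[OF assms] L by (simp add: algebra_simps)
  have 3: "polylog 3 z = polylog 3 (1 / z) + 2 * polylog 2 (- 1) * Complex l \<theta> - Complex l \<theta> ^ 3 / 6"
    using polylog_3_inversion[OF assms] L by (simp add: algebra_simps)
  show ?thesis
    unfolding P3_formula_def l' l_def[symmetric] One_nat_def 1 2 3
    by (simp add: im power2_eq_square power3_eq_cube field_simps)
qed

section \<open>Restriction of \<open>P3\<close> to the real axis\<close>

definition P3r :: "real \<Rightarrow> real" where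
  "P3r x = P3_formula (of_real x)"

lemma P3_of_real_less_1:
  assumes "x < 1" "x \<noteq> 0" shows "P3 (of_real x) = P3r x"
  using assms by (simp add: P3_def P3r_def polylog_cut_iff)

lemma isCont_P3_formula:
  assumes "z \<notin> polylog_cut" "z \<noteq> 0" shows "isCont P3_formula z"
proof -
  have c: "isCont (polylog s) z" for s
    using holomorphic_on_imp_continuous_on[OF polylog_props(1)[of s]] open_polylog_domain assms(1)
    by (auto simp: continuous_on_eq_continuous_at)
  show ?thesis unfolding P3_formula_def[abs_def] isCont_def
    by (intro tendsto_intros c[unfolded isCont_def]) (use assms in auto)
qed

text \<open>Across the cut \<open>(1,\<infinity>)\<close> the continuous extension is read off from the inversion
  symmetry, because reciprocals of nearby points lie close to a point of \<open>(0,1)\<close>.\<close>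

lemma P3_of_real_greater_1:
  assumes "1 < x" shows "P3 (of_real x) = P3r (1 / x)"
proof -
  define D where "D = - insert 0 polylog_cut"
  have xD: "of_real x \<notin> D" using assms by (auto simp: D_def polylog_cut_iff)
  have xi: "complex_of_real (1 / x) \<notin> polylog_cut" "complex_of_real (1 / x) \<noteq> 0"
    using assms by (auto simp: polylog_cut_iff simp flip: of_real_divide)
  have "((\<lambda>z. P3_formula (1 / z)) \<longlongrightarrow> P3_formula (1 / of_real x)) (at (of_real x) within D)"
  proof (rule isCont_tendsto_compose[where g = P3_formula])
    show "isCont P3_formula (1 / of_real x)" using isCont_P3_formula[OF xi] by simp
    show "((\<lambda>z. 1 / z) \<longlongrightarrow> 1 / complex_of_real x) (at (of_real x) within D)"
      using assms by (intro tendsto_intros) auto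
  qed
  moreover have "eventually (\<lambda>z. P3_formula (1 / z) = P3_formula z) (at (of_real x) within D)"
  proof -
    \<comment> \<open>A point of \<open>D\<close> with real part above 1 is not real, so the
      inversion formula applies to it.\<close>
    have "eventually (\<lambda>z. z \<in> {z. 1 < Re z}) (at (complex_of_real x) within D)"
      by (rule eventually_at_topological[THEN iffD2])
        (use assms in \<open>auto intro!: exI[of _ "{z. 1 < Re z}"] open_halfspace_Re_gt\<close>)
    moreover have "eventually (\<lambda>z. z \<in> D) (at (complex_of_real x) within D)"
      by (auto simp: eventually_at_filter)
    ultimately show ?thesis
    proof eventually_elim
      case (elim z)
      then have "z \<in> - \<real>\<^sub>\<ge>\<^sub>0" by (auto simp: D_def complex_nonneg_Reals_iff polylog_cut_iff)
      then show ?case by (rule P3_formula_inversion)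
    qed
  qed
  ultimately have lim: "(P3_formula \<longlongrightarrow> P3_formula (1 / of_real x)) (at (of_real x) within D)"
    by (rule Lim_transform_eventually)
  \<comment> \<open>\<open>Lim\<close> picks out the limit only along a nontrivial filter: nonreal
    points of \<open>D\<close> accumulate at \<open>x\<close>.\<close>
  have "at (complex_of_real x) within D \<noteq> bot"
  proof -
    have "complex_of_real x islimpt D" unfolding islimpt_approachable
    proof (intro allI impI)
      fix e :: real assume e: "e > 0"
      show "\<exists>x'\<in>D. x' \<noteq> complex_of_real x \<and> dist x' (complex_of_real x) < e"
        using e assms by (intro bexI[of _ "Complex x (e / 2)"])
          (auto simp: D_def polylog_cut_iff complex_eq_iff dist_norm cmod_def)
    qed
    then show ?thesis by (simp add: trivial_limit_within)
  qed
  then have "Lim (at (of_real x) within D) P3_formula = P3_formula (1 / of_real x)"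
    using lim by (intro tendsto_Lim)
  then show ?thesis using xD by (simp add: P3_def P3r_def D_def Let_def)
qed

lemma P3r_inversion:
  assumes "x < 0" shows "P3r (1 / x) = P3r x"
  using P3_formula_inversion[of "of_real x"] assms by (simp add: P3r_def complex_nonneg_Reals_iff)

lemma ln_abs_has_real_derivative:
  assumes "x \<noteq> 0" shows "((\<lambda>y. ln \<bar>y\<bar>) has_real_derivative 1 / x) (at x)"
proof (cases "x > 0")
  case True
  have "eventually (\<lambda>y. y \<in> {0<..}) (nhds x)"
    using True by (intro eventually_nhds_in_open) auto
  then have "eventually (\<lambda>y. ln y = ln \<bar>y\<bar>) (nhds x)" by eventually_elim auto
  moreover have "(ln has_real_derivative 1 / x) (at x)" using True by (rule DERIV_ln_divide)
  ultimately show ?thesis by (subst (asm) DERIV_cong_ev[OF refl _ refl]) auto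
next
  case False
  then have "x < 0" using assms by simp
  have "eventually (\<lambda>y. y \<in> {..<0}) (nhds x)"
    using \<open>x < 0\<close> by (intro eventually_nhds_in_open) auto
  then have "eventually (\<lambda>y. ln (- y) = ln \<bar>y\<bar>) (nhds x)" by eventually_elim auto
  moreover have "((\<lambda>y. ln (- y)) has_real_derivative 1 / x) (at x)"
    using \<open>x < 0\<close> by (auto intro!: derivative_eq_intros simp: field_simps)
  ultimately show ?thesis by (subst (asm) DERIV_cong_ev[OF refl _ refl]) auto
qed

text \<open>The derivative \<open>Li_2 / x\<close> of the trilogarithm cancels against the part of
  the product rule for \<open>- ln |x| * Li_2\<close> in which the logarithm is differentiated; only
  logarithms remain.\<close>

lemma P3r_has_real_derivative:
  assumes "x < 1" "x \<noteq> 0"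
  shows "(P3r has_real_derivative
    ln \<bar>x\<bar> / 3 * (ln (1 - x) / x + ln \<bar>x\<bar> / (1 - x))) (at x)"
proof -
  define L where "L = (\<lambda>s x. Re (polylog s (complex_of_real x)))"
  have L1: "L (Suc 0) y = - ln (1 - y)" if "y < 1" for y
  proof -
    have "Ln (1 - complex_of_real y) = of_real (ln (1 - y))"
      using that by (metis Ln_of_real diff_gt_0_iff_gt of_real_1 of_real_diff)
    then show ?thesis
      using that by (simp add: L_def polylog_1 polylog_cut_iff)
  qed
  have dL: "(L (Suc s) has_real_derivative L s x / x) (at x)" for s
  proof -
    have "(polylog (Suc s) has_field_derivative polylog s (of_real x) / of_real x) (at (of_real x))"
      using assms by (intro polylog_has_field_derivative) (auto simp: polylog_cut_iff)
    from has_vector_derivative_real_field[OF this]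
    have "((\<lambda>x. polylog (Suc s) (complex_of_real x)) has_vector_derivative
        polylog s (of_real x) / of_real x) (at x)" .
    from has_field_derivative_Re[OF this] show ?thesis
      unfolding L_def by (simp add: Re_divide_of_real)
  qed
  have "((\<lambda>x. L (Suc (Suc (Suc 0))) x - ln \<bar>x\<bar> * L (Suc (Suc 0)) x - ln \<bar>x\<bar> ^ 2 / 3 * ln (1 - x))
    has_real_derivative ln \<bar>x\<bar> / 3 * (ln (1 - x) / x + ln \<bar>x\<bar> / (1 - x))) (at x)"
  proof -
    have d1: "((\<lambda>x. ln (1 - x)) has_real_derivative - 1 / (1 - x)) (at x)"
      using assms by (auto intro!: derivative_eq_intros)
    note dl = ln_abs_has_real_derivative[OF assms(2)]
    show ?thesis
      by (rule DERIV_cong[OF DERIV_diff[OF DERIV_diff[OF dL DERIV_mult[OF dl dL]]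
              DERIV_mult[OF DERIV_cdivide[OF DERIV_power[OF dl, of 2], of 3] d1]]])
        (use assms in \<open>simp add: L1 divide_simps\<close>, algebra)
  qed
  moreover have "eventually (\<lambda>y. L (Suc (Suc (Suc 0))) y - ln \<bar>y\<bar> * L (Suc (Suc 0)) y
      - ln \<bar>y\<bar> ^ 2 / 3 * ln (1 - y) = P3r y) (nhds x)"
  proof -
    have "eventually (\<lambda>y. y \<in> {..<1}) (nhds x)"
      using assms by (intro eventually_nhds_in_open) auto
    then show ?thesis
    proof eventually_elim
      case (elim y)
      then show ?case using L1[of y]
        by (simp add: P3r_def P3_formula_def L_def numeral_2_eq_2 numeral_3_eq_3)
    qed
  qed
  ultimately show ?thesis by (subst (asm) DERIV_cong_ev[OF refl _ refl]) auto
qed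

section \<open>A one-dimensional integral of squared logarithms\<close>

text \<open>The product of \<open>ln |x|\<close> and \<open>Li_2 x\<close> is indeterminate at 0. It
  is rewritten as \<open>x ln |x|\<close> times \<open>Li_2 x / x\<close>, whose second factor tends
  to the derivative of \<open>Li_2\<close> at 0.\<close>

lemma P3r_tendsto_0: "(P3r \<longlongrightarrow> 0) (at 0)"
proof -
  have dom: "0 \<notin> polylog_cut" by (simp add: polylog_cut_iff)
  obtain D where D: "(polylog 2 has_field_derivative D) (at 0)"
    using holomorphic_derivI[OF polylog_props(1) open_polylog_domain] dom by blast
  have "((\<lambda>z. polylog 2 z / z) \<longlongrightarrow> D) (at 0)"
    using D by (simp add: has_field_derivative_iff polylog_0)
  moreover have "filterlim complex_of_real (at 0) (at 0)"
    by (auto simp: filterlim_at eventually_at_filter intro!: tendsto_eq_intros)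
  ultimately have "((\<lambda>x. polylog 2 (complex_of_real x) / of_real x) \<longlongrightarrow> D) (at 0)"
    by (rule filterlim_compose)
  from tendsto_Re[OF this]
  have L2: "((\<lambda>x. Re (polylog 2 (complex_of_real x)) / x) \<longlongrightarrow> Re D) (at 0)"
    by (simp add: Re_divide_of_real)
  have "isCont (polylog 3) (complex_of_real 0)"
    using holomorphic_on_imp_continuous_on[OF polylog_props(1)[of 3]] open_polylog_domain dom
    by (simp add: continuous_on_eq_continuous_at)
  then have "((\<lambda>x. polylog 3 (complex_of_real x)) \<longlongrightarrow> polylog 3 (complex_of_real 0)) (at 0)"
    by (rule isCont_tendsto_compose) (intro tendsto_intros)
  from tendsto_Re[OF this]
  have L3: "((\<lambda>x. Re (polylog 3 (complex_of_real x))) \<longlongrightarrow> 0) (at 0)"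
    by (simp add: polylog_0)
  have l: "((\<lambda>x::real. x * ln \<bar>x\<bar>) \<longlongrightarrow> 0) (at 0)"
    "((\<lambda>x::real. ln \<bar>x\<bar> ^ 2 / 3 * ln (1 - x)) \<longlongrightarrow> 0) (at 0)"
    unfolding filterlim_at_split by (safe; real_asymp)+
  have "((\<lambda>x. Re (polylog 3 (complex_of_real x))
      - (x * ln \<bar>x\<bar>) * (Re (polylog 2 (complex_of_real x)) / x)
      - ln \<bar>x\<bar> ^ 2 / 3 * ln (1 - x)) \<longlongrightarrow> 0 - 0 * Re D - 0) (at 0)"
    by (intro tendsto_diff tendsto_mult L2 L3 l)
  moreover have "eventually (\<lambda>x. Re (polylog 3 (complex_of_real x))
      - (x * ln \<bar>x\<bar>) * (Re (polylog 2 (complex_of_real x)) / x)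
      - ln \<bar>x\<bar> ^ 2 / 3 * ln (1 - x) = P3r x) (at 0)"
  proof -
    have "eventually (\<lambda>x. x \<in> {..<1} - {0}) (at (0::real))"
      by (intro eventually_at_in_open) auto
    then show ?thesis
    proof eventually_elim
      case (elim x)
      then have x: "x < 1" "x \<noteq> 0" by auto
      have "Ln (1 - complex_of_real x) = of_real (ln (1 - x))"
        using x by (metis Ln_of_real diff_gt_0_iff_gt of_real_1 of_real_diff)
      then have "polylog 1 (complex_of_real x) = - of_real (ln (1 - x))"
        using polylog_1[of "of_real x"] x by (simp add: polylog_cut_iff)
      then show ?case using x by (simp add: P3r_def P3_formula_def)
    qed
  qed
  ultimately show ?thesis using Lim_transform_eventually by fastforce
qed

text \<open>Compares two arguments that both tend to 1, a point of the cut, without evaluating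
  anything at 1 itself. Near 1 the factor \<open>ln z\<close> is at most \<open>2 * (1 - z)\<close>
  in size and compensates the growth of \<open>ln (1 - z)\<close> and of \<open>1 / (1 - z)\<close>.
  The estimates give 8/3 for the derivative, rounded up to 4.\<close>

lemma P3r_Lipschitz:
  assumes "1 / 2 \<le> u" "u \<le> v" "v < 1"
  shows "\<bar>P3r v - P3r u\<bar> \<le> 4 * (v - u)"
proof (cases "u = v")
  case False
  then have "u < v" using assms by simp
  have der: "(P3r has_real_derivative
    ln \<bar>x\<bar> / 3 * (ln (1 - x) / x + ln \<bar>x\<bar> / (1 - x))) (at x)" if "u \<le> x" "x \<le> v" for x
    using that assms by (intro P3r_has_real_derivative) auto
  obtain z where z: "u < z" "z < v"
    "P3r v - P3r u = (v - u) * (ln \<bar>z\<bar> / 3 * (ln (1 - z) / z + ln \<bar>z\<bar> / (1 - z)))"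
    using MVT2[OF \<open>u < v\<close> der] by blast
  have z1: "0 < 1 - z" "1 / 2 < z" "z < 1" using z assms by auto
  have lz: "\<bar>ln z\<bar> \<le> 2 * (1 - z)"
  proof -
    have "ln (1 / z) \<le> 1 / z - 1" using z1 by (intro ln_le_minus_one) auto
    also have "1 / z - 1 = (1 - z) / z" using z1 by (simp add: field_simps)
    also have "\<dots> \<le> 2 * (1 - z)"
      using z1 mult_left_mono[of 1 "2 * z" "1 - z"] by (simp add: divide_le_eq mult_ac)
    finally show ?thesis using z1 by (simp add: ln_div)
  qed
  have l1: "\<bar>ln (1 - z)\<bar> * (1 - z) \<le> 1"
  proof -
    have "ln (1 / (1 - z)) \<le> 1 / (1 - z) - 1" using z1 by (intro ln_le_minus_one) auto
    then have "\<bar>ln (1 - z)\<bar> \<le> 1 / (1 - z)" using z1 by (simp add: ln_div)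
    then show ?thesis using z1 by (simp add: field_simps)
  qed
  have "\<bar>ln z / 3 * (ln (1 - z) / z + ln z / (1 - z))\<bar>
      \<le> \<bar>ln z\<bar> / 3 * (\<bar>ln (1 - z)\<bar> / z + \<bar>ln z\<bar> / (1 - z))"
    using z1 abs_triangle_ineq[of "ln (1 - z) / z" "ln z / (1 - z)"]
    by (auto simp: abs_mult intro!: mult_left_mono)
  also have "\<dots> \<le> 2 * (1 - z) / 3 * (2 * \<bar>ln (1 - z)\<bar> + 2)"
  proof (intro mult_mono add_mono)
    have "\<bar>ln (1 - z)\<bar> * 1 \<le> \<bar>ln (1 - z)\<bar> * (2 * z)" using z1 by (intro mult_left_mono) auto
    then show "\<bar>ln (1 - z)\<bar> / z \<le> 2 * \<bar>ln (1 - z)\<bar>" using z1 by (simp add: field_simps)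
    show "\<bar>ln z\<bar> / (1 - z) \<le> 2" using lz z1 by (simp only: divide_le_eq) simp
    show "0 \<le> \<bar>ln (1 - z)\<bar> / z + \<bar>ln z\<bar> / (1 - z)"
      using z1 by (intro add_nonneg_nonneg divide_nonneg_pos abs_ge_zero) auto
    show "\<bar>ln z\<bar> / 3 \<le> 2 * (1 - z) / 3" using lz by simp
    show "0 \<le> 2 * (1 - z) / 3" using z1 by simp
  qed
  also have "\<dots> = 4 / 3 * (\<bar>ln (1 - z)\<bar> * (1 - z) + (1 - z))" by (simp add: field_simps)
  also have "\<dots> \<le> 4 / 3 * (1 + 1)" using l1 z1 by (intro mult_left_mono add_mono) auto
  finally have "\<bar>ln z / 3 * (ln (1 - z) / z + ln z / (1 - z))\<bar> \<le> 4" by simp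
  then have "(v - u) * \<bar>ln z / 3 * (ln (1 - z) / z + ln z / (1 - z))\<bar> \<le> (v - u) * 4"
    using \<open>u < v\<close> by (intro mult_left_mono) auto
  moreover have "\<bar>P3r v - P3r u\<bar> = (v - u) * \<bar>ln z / 3 * (ln (1 - z) / z + ln z / (1 - z))\<bar>"
  proof -
    have "\<bar>z\<bar> = z" "\<bar>v - u\<bar> = v - u" using z1 \<open>u < v\<close> by auto
    then show ?thesis unfolding z(3) abs_mult[of "v - u"] by simp
  qed
  ultimately show ?thesis by (simp add: mult.commute)
qed simp

section \<open>Primitives of the squared logarithms\<close>

context
  fixes a p :: real
  assumes a: "0 < a" and p: "0 < p"
begin

text \<open>In the coordinates \<open>x = ln X\<close>, \<open>y = ln (1 + X)\<close> one has \<open>3 d P3(-X) = x (y dx - x dy)\<close>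
  and \<open>3 d P3(X / (1 + X)) = (x - y) (x dy - y dx)\<close>, so that a suitable combination cancels the
  dilogarithmic part; likewise for \<open>y = ln (X - 1)\<close>.\<close>

definition "upper_primitive X = ln X * (a * ln X + p * ln (1 + X)) ^ 2 / (6 * p)
  + (a + p) * P3r (- X) + p * P3r (X / (1 + X))"

definition "lower_primitive X = ln X * (a * ln X + p * ln (X - 1)) ^ 2 / (6 * p)
  + (a + p) * P3r (1 / X) + p * P3r (1 - 1 / X)"

text \<open>Here \<open>x\<close> stands for \<open>ln X\<close>, and \<open>y\<close> for
  \<open>ln Z\<close> with \<open>Z = 1 + X\<close> or \<open>Z = X - 1\<close>. The identity is
  algebraic in \<open>x\<close> and \<open>y\<close>, so one computation serves both
  primitives.\<close>

lemma primitive_identity: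
  fixes x y X Z :: real
  assumes "X \<noteq> 0" "Z \<noteq> 0"
  shows "(1 / X * (a * x + p * y) ^ 2 + x * (2 * (a * x + p * y) * (a / X + p / Z))) / (6 * p)
      + (a + p) * (x / 3 * (y / X - x / Z)) + p * ((x - y) / 3 * (x / Z - y / X))
      = (a * x + p * y) ^ 2 / (2 * p * X)"
  using assms p by (simp add: divide_simps) algebra

lemma upper_primitive_deriv:
  assumes X: "0 < X"
  shows "(upper_primitive has_real_derivative (a * ln X + p * ln (1 + X)) ^ 2 / (2 * p * X)) (at X)"
proof -
  have d1: "((\<lambda>X. P3r (- X)) has_real_derivative ln X / 3 * (ln (1 + X) / X - ln X / (1 + X))) (at X)"
    by (rule DERIV_cong[OF DERIV_chain2[OF P3r_has_real_derivative DERIV_minus[OF DERIV_ident]]])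
      (use X in \<open>auto simp: algebra_simps\<close>)
  have u: "((\<lambda>X. X / (1 + X)) has_real_derivative 1 / (1 + X) ^ 2) (at X)"
    using X by (auto intro!: derivative_eq_intros simp: power2_eq_square field_simps)
  have l: "ln \<bar>X / (1 + X)\<bar> = ln X - ln (1 + X)" "ln (1 - X / (1 + X)) = - ln (1 + X)"
  proof -
    have "1 - X / (1 + X) = 1 / (1 + X)" using X by (simp add: field_simps)
    then show "ln (1 - X / (1 + X)) = - ln (1 + X)" using X by (simp add: ln_div)
  qed (use X in \<open>simp add: ln_div\<close>)
  have d2: "((\<lambda>X. P3r (X / (1 + X))) has_real_derivative
      (ln X - ln (1 + X)) / 3 * (ln X / (1 + X) - ln (1 + X) / X)) (at X)"
  proof (rule DERIV_cong[OF DERIV_chain2[OF P3r_has_real_derivative u]])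
    define x where "x = ln X"
    define y where "y = ln (1 + X)"
    have i: "1 - X / (1 + X) = 1 / (1 + X)" using X by (simp add: field_simps)
    have "(x - y) / 3 * ((- y) / (X / (1 + X)) + (x - y) / (1 / (1 + X))) * (1 / (1 + X)\<^sup>2)
       = (x - y) / 3 * (x / (1 + X) - y / X)"
    proof -
      have "X \<noteq> 0" "1 + X \<noteq> 0" using X by auto
      then show ?thesis by (simp add: divide_simps) algebra
    qed
    then show "ln \<bar>X / (1 + X)\<bar> / 3 * (ln (1 - X / (1 + X)) / (X / (1 + X)) +
        ln \<bar>X / (1 + X)\<bar> / (1 - X / (1 + X))) * (1 / (1 + X)\<^sup>2)
       = (ln X - ln (1 + X)) / 3 * (ln X / (1 + X) - ln (1 + X) / X)"
      unfolding l by (simp only: x_def y_def i)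
  qed (use X in auto)
  have dl: "(ln has_real_derivative 1 / X) (at X)" using X by (intro DERIV_ln_divide) auto
  have d0: "((\<lambda>X. ln (1 + X)) has_real_derivative 1 / (1 + X)) (at X)"
    using X by (auto intro!: derivative_eq_intros)
  have d3: "((\<lambda>X. ln X * (a * ln X + p * ln (1 + X)) ^ 2 / (6 * p)) has_real_derivative
     (1 / X * (a * ln X + p * ln (1 + X)) ^ 2
       + ln X * (2 * (a * ln X + p * ln (1 + X)) * (a / X + p / (1 + X)))) / (6 * p)) (at X)"
    by (rule DERIV_cong[OF DERIV_cdivide[OF DERIV_mult[OF dl
            DERIV_power[OF DERIV_add[OF DERIV_cmult[OF dl, of a] DERIV_cmult[OF d0, of p]], of 2]]]])
      (simp add: mult_ac)
  show ?thesis unfolding upper_primitive_def[abs_def]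
    by (rule DERIV_cong[OF DERIV_add[OF DERIV_add[OF d3 DERIV_cmult[OF d1]] DERIV_cmult[OF d2]]])
      (rule primitive_identity, use X in auto)
qed

lemma lower_primitive_deriv:
  assumes X: "1 < X"
  shows "(lower_primitive has_real_derivative (a * ln X + p * ln (X - 1)) ^ 2 / (2 * p * X)) (at X)"
proof -
  have i: "1 - 1 / X = (X - 1) / X" "1 - (1 - 1 / X) = 1 / X" using X by (auto simp: field_simps)
  have l: "ln \<bar>1 / X\<bar> = - ln X" "ln (1 - 1 / X) = ln (X - 1) - ln X"
    "ln \<bar>1 - 1 / X\<bar> = ln (X - 1) - ln X"
    using X by (auto simp: i ln_div)
  have nz: "X \<noteq> 0" "X - 1 \<noteq> 0" using X by auto
  have u1: "((\<lambda>X. 1 / X) has_real_derivative - 1 / X ^ 2) (at X)"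
    using X by (auto intro!: derivative_eq_intros simp: power2_eq_square)
  have u2: "((\<lambda>X. 1 - 1 / X) has_real_derivative 1 / X ^ 2) (at X)"
    using X by (auto intro!: derivative_eq_intros simp: power2_eq_square)
  have d1: "((\<lambda>X. P3r (1 / X)) has_real_derivative
      ln X / 3 * (ln (X - 1) / X - ln X / (X - 1))) (at X)"
  proof (rule DERIV_cong[OF DERIV_chain2[OF P3r_has_real_derivative u1]])
    have "- x / 3 * ((y - x) / (1 / X) + - x / ((X - 1) / X)) * (- 1 / X\<^sup>2)
      = x / 3 * (y / X - x / (X - 1))" for x y
      using nz by (simp add: divide_simps) algebra
    then show "ln \<bar>1 / X\<bar> / 3 * (ln (1 - 1 / X) / (1 / X) + ln \<bar>1 / X\<bar> / (1 - 1 / X)) * (- 1 / X\<^sup>2)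
      = ln X / 3 * (ln (X - 1) / X - ln X / (X - 1))"
      unfolding l by (simp only: i)
  qed (use X in auto)
  have d2: "((\<lambda>X. P3r (1 - 1 / X)) has_real_derivative
      (ln X - ln (X - 1)) / 3 * (ln X / (X - 1) - ln (X - 1) / X)) (at X)"
  proof (rule DERIV_cong[OF DERIV_chain2[OF P3r_has_real_derivative u2]])
    have e: "(y - x) / 3 * (- x / (1 - 1 / X) + (y - x) / (1 - (1 - 1 / X))) * (1 / X\<^sup>2)
      = (x - y) / 3 * (x / (X - 1) - y / X)" for x y
      unfolding i(2) unfolding i(1) using nz by (simp add: divide_simps) algebra
    have l4: "ln (1 - (1 - 1 / X)) = - ln X" using X by (simp add: ln_div)
    show "ln \<bar>1 - 1 / X\<bar> / 3 * (ln (1 - (1 - 1 / X)) / (1 - 1 / X)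
        + ln \<bar>1 - 1 / X\<bar> / (1 - (1 - 1 / X))) * (1 / X\<^sup>2)
      = (ln X - ln (X - 1)) / 3 * (ln X / (X - 1) - ln (X - 1) / X)"
      unfolding l l4 by (rule e)
  qed (use X in auto)
  have dl: "(ln has_real_derivative 1 / X) (at X)" using X by (intro DERIV_ln_divide) auto
  have d0: "((\<lambda>X. ln (X - 1)) has_real_derivative 1 / (X - 1)) (at X)"
    using X by (auto intro!: derivative_eq_intros)
  have d3: "((\<lambda>X. ln X * (a * ln X + p * ln (X - 1)) ^ 2 / (6 * p)) has_real_derivative
     (1 / X * (a * ln X + p * ln (X - 1)) ^ 2
       + ln X * (2 * (a * ln X + p * ln (X - 1)) * (a / X + p / (X - 1)))) / (6 * p)) (at X)"
    by (rule DERIV_cong[OF DERIV_cdivide[OF DERIV_mult[OF dl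
            DERIV_power[OF DERIV_add[OF DERIV_cmult[OF dl, of a] DERIV_cmult[OF d0, of p]], of 2]]]])
      (simp add: mult_ac)
  show ?thesis unfolding lower_primitive_def[abs_def]
    by (rule DERIV_cong[OF DERIV_add[OF DERIV_add[OF d3 DERIV_cmult[OF d1]] DERIV_cmult[OF d2]]])
      (rule primitive_identity, use X in auto)
qed

text \<open>Each primitive is unbounded at infinity, so the tail integral needs their difference.
  \<open>P3r (- X)\<close> is moved to a neighbourhood of 0 by inversion, and the Lipschitz bound
  handles the two values whose arguments tend to 1.\<close>

lemma primitive_difference_tendsto_0:
  "((\<lambda>X. upper_primitive X - lower_primitive X) \<longlongrightarrow> 0) at_top"
proof -
  have l: "((\<lambda>X. ln X * (a * ln X + p * ln (1 + X)) ^ 2 / (6 * p)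
      - ln X * (a * ln X + p * ln (X - 1)) ^ 2 / (6 * p)) \<longlongrightarrow> 0) at_top"
    using a p by real_asymp
  have 1: "((\<lambda>X. P3r (1 / X)) \<longlongrightarrow> 0) at_top"
    by (rule filterlim_compose[OF P3r_tendsto_0]) real_asymp
  have "((\<lambda>X. P3r (- 1 / X)) \<longlongrightarrow> 0) at_top"
    by (rule filterlim_compose[OF P3r_tendsto_0]) real_asymp
  moreover have "eventually (\<lambda>X. P3r (- 1 / X) = P3r (- X)) at_top"
    using eventually_gt_at_top[of 0]
  proof eventually_elim
    case (elim X)
    then show ?case using P3r_inversion[of "- X"] by simp
  qed
  ultimately have 2: "((\<lambda>X. P3r (- X)) \<longlongrightarrow> 0) at_top"
    by (rule Lim_transform_eventually)
  have 3: "((\<lambda>X. P3r (X / (1 + X)) - P3r (1 - 1 / X)) \<longlongrightarrow> 0) at_top"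
  proof (rule Lim_null_comparison)
    show "((\<lambda>X::real. 4 * (X / (1 + X) - (1 - 1 / X))) \<longlongrightarrow> 0) at_top" by real_asymp
    show "\<forall>\<^sub>F X in at_top. norm (P3r (X / (1 + X)) - P3r (1 - 1 / X))
        \<le> 4 * (X / (1 + X) - (1 - 1 / X))"
      using eventually_gt_at_top[of 2]
    proof eventually_elim
      case (elim X)
      then show ?case unfolding real_norm_def
        by (intro P3r_Lipschitz) (auto simp: field_simps)
    qed
  qed
  have "((\<lambda>X. (ln X * (a * ln X + p * ln (1 + X)) ^ 2 / (6 * p)
      - ln X * (a * ln X + p * ln (X - 1)) ^ 2 / (6 * p))
      + (a + p) * P3r (- X) - (a + p) * P3r (1 / X)
      + p * (P3r (X / (1 + X)) - P3r (1 - 1 / X))) \<longlongrightarrow> 0 + (a + p) * 0 - (a + p) * 0 + p * 0) at_top"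
    by (intro tendsto_add tendsto_diff tendsto_mult tendsto_const l 1 2 3)
  then show ?thesis
    unfolding upper_primitive_def lower_primitive_def by (simp add: algebra_simps)
qed

text \<open>The two expressions inside the positive parts become positive at \<open>X0\<close> and
  at \<open>X1\<close>. So the integrand is zero before \<open>X0\<close>, the first square alone up
  to \<open>X1\<close>, and the difference of both squares beyond; the two primitives integrate
  these pieces.\<close>

lemma nn_integral_profile:
  assumes X0: "0 < X0" "X0 < 1" "a * ln X0 + p * ln (1 + X0) = 0"
    and X1: "1 < X1" "a * ln X1 + p * ln (X1 - 1) = 0"
  shows "(\<integral>\<^sup>+X. ennreal (((max 0 (a * ln X + p * ln (1 + X))) ^ 2
        - (max 0 (a * ln X + p * ln \<bar>X - 1\<bar>)) ^ 2) / (2 * p * X)) * indicator {0<..} X \<partial>lborel)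
    = ennreal ((a + p) * P3r (1 / X1) + p * P3r (1 - 1 / X1) - (a + p) * P3r (- X0)
        - p * P3r (X0 / (1 + X0)))"
    (is "(\<integral>\<^sup>+X. ennreal (?g X) * indicator {0<..} X \<partial>lborel) = ennreal ?K")
    and "0 \<le> (a + p) * P3r (1 / X1) + p * P3r (1 - 1 / X1) - (a + p) * P3r (- X0)
        - p * P3r (X0 / (1 + X0))"
proof -
  define u where "u = (\<lambda>X. a * ln X + p * ln (1 + X))"
  define v where "v = (\<lambda>X. a * ln X + p * ln (X - 1))"
  have u_mono: "u X \<le> u Y" if "0 < X" "X \<le> Y" for X Y
    using that a p unfolding u_def by (intro add_mono mult_left_mono) auto
  have v_mono: "v X \<le> v Y" if "1 < X" "X \<le> Y" for X Y
    using that a p unfolding v_def by (intro add_mono mult_left_mono) auto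
  have u0: "u X0 = 0" and v1: "v X1 = 0" using X0 X1 by (simp_all add: u_def v_def)
  have vu: "v X \<le> u X" if "1 < X" for X
    using that a p unfolding u_def v_def by (intro add_mono mult_left_mono) auto
  define g1 where "g1 = (\<lambda>X. u X ^ 2 / (2 * p * X))"
  define g2 where "g2 = (\<lambda>X. u X ^ 2 / (2 * p * X) - v X ^ 2 / (2 * p * X))"
  have meas: "g1 \<in> borel_measurable borel" "g2 \<in> borel_measurable borel"
    unfolding g1_def g2_def u_def v_def by measurable
  \<comment> \<open>The point \<open>X1\<close> belongs to both intervals and would be counted
    twice.\<close>
  have G: "?g X * indicator {0<..} X = g1 X * indicator {X0..X1} X + g2 X * indicator {X1..} X"
    if ne: "X \<noteq> X1" for X
  proof -
    consider "X \<le> 0" | "0 < X" "X < X0" | "X0 \<le> X" "X \<le> 1" | "1 < X" "X < X1" | "X1 < X"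
      using ne X0(1,2) X1(1) by linarith
    then show ?thesis
    proof cases
      case 2
      then have "u X \<le> 0" using u_mono[of X X0] u0 by simp
      moreover have "a * ln X + p * ln \<bar>X - 1\<bar> \<le> 0" using 2 a p X0
        by (intro add_nonpos_nonpos mult_nonneg_nonpos) auto
      ultimately show ?thesis using 2 X1 X0 by (simp add: u_def)
    next
      case 3
      then have "0 \<le> u X" using u_mono[of X0 X] u0 X0 by simp
      moreover have "a * ln X + p * ln \<bar>X - 1\<bar> \<le> 0"
      \<comment> \<open>At \<open>X = 1\<close> both logarithms are 0, the second by the convention
        \<open>ln 0 = 0\<close>.\<close>
      proof (cases "X = 1")
        case False
        then show ?thesis using 3 a p X0
          by (intro add_nonpos_nonpos mult_nonneg_nonpos) auto
      qed simp
      ultimately show ?thesis using 3 X1 X0 by (simp add: u_def g1_def)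
    next
      case 4
      then have "0 \<le> u X" using u_mono[of X0 X] u0 X0 by simp
      moreover have "v X \<le> 0" using v_mono[of X X1] v1 4 by simp
      ultimately show ?thesis using 4 X1 X0 by (simp add: u_def v_def g1_def)
    next
      case 5
      then have "0 \<le> u X" using u_mono[of X0 X] u0 X0 X1 by simp
      moreover have "0 \<le> v X" using v_mono[of X1 X] v1 5 X1 by simp
      ultimately show ?thesis using 5 X1 X0 by (simp add: u_def v_def g2_def diff_divide_distrib)
    qed (use X0 X1 in auto)
  qed
  have g1_nonneg: "0 \<le> g1 X" if "0 < X" for X using that p by (simp add: g1_def)
  have g2_nonneg: "0 \<le> g2 X" if "X1 \<le> X" for X
  proof -
    have "0 \<le> v X" using v_mono[of X1 X] v1 that X1 by simp
    then have "v X ^ 2 \<le> u X ^ 2" using vu[of X] that X1 by (intro power_mono) auto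
    then have "v X ^ 2 / (2 * p * X) \<le> u X ^ 2 / (2 * p * X)"
      using that X1 p by (intro divide_right_mono) auto
    then show ?thesis by (simp add: g2_def)
  qed
  have upper_le: "upper_primitive X0 \<le> upper_primitive X1"
    by (rule DERIV_nonneg_imp_nondecreasing)
      (use X0 X1 p in \<open>auto intro!: exI upper_primitive_deriv\<close>)
  \<comment> \<open>The difference of the primitives increases to its limit 0, so it is nonpositive.
    This sign allows the two \<open>ennreal\<close> values to be added as reals below.\<close>
  have lower_ge: "upper_primitive X1 - lower_primitive X1 \<le> 0"
  proof (rule tendsto_lowerbound[OF primitive_difference_tendsto_0])
    show "\<forall>\<^sub>F X in at_top. upper_primitive X1 - lower_primitive X1
        \<le> upper_primitive X - lower_primitive X"
      using eventually_gt_at_top[of X1]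
    proof eventually_elim
      case (elim X)
      show ?case
      proof (rule DERIV_nonneg_imp_nondecreasing[of X1 X "\<lambda>X. upper_primitive X - lower_primitive X"])
        fix x assume "X1 \<le> x" "x \<le> X"
        then show "\<exists>y. ((\<lambda>X. upper_primitive X - lower_primitive X) has_real_derivative y) (at x) \<and> 0 \<le> y"
          using X1 g2_nonneg[of x]
          by (intro exI[of _ "g2 x"])
            (auto simp: g2_def u_def v_def intro!: DERIV_diff upper_primitive_deriv lower_primitive_deriv)
      qed (use elim in simp)
    qed
  qed simp
  \<comment> \<open>\<open>upper_primitive X1\<close> cancels, and the elementary terms at the two
    remaining ends vanish because \<open>u X0 = 0\<close> and \<open>v X1 = 0\<close>.\<close>
  have K: "(upper_primitive X1 - upper_primitive X0) + (0 - (upper_primitive X1 - lower_primitive X1)) = ?K"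
    using X0 X1 by (simp add: upper_primitive_def lower_primitive_def)
  have "(\<integral>\<^sup>+X. ennreal (?g X) * indicator {0<..} X \<partial>lborel) =
      (\<integral>\<^sup>+X. ennreal (g1 X) * indicator {X0..X1} X + ennreal (g2 X) * indicator {X1..} X \<partial>lborel)"
  proof (rule nn_integral_cong_AE)
    show "AE X in lborel. ennreal (?g X) * indicator {0<..} X
        = ennreal (g1 X) * indicator {X0..X1} X + ennreal (g2 X) * indicator {X1..} X"
      using AE_lborel_singleton[of X1]
    proof eventually_elim
      case (elim X)
      have i: "ennreal r * indicator A X = ennreal (r * indicator A X)" for r and A :: "real set"
        by (auto simp: indicator_def)
      have "0 \<le> g1 X * indicator {X0..X1} X" "0 \<le> g2 X * indicator {X1..} X"
        using g1_nonneg[of X] g2_nonneg[of X] X0 by (auto simp: indicator_def)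
      then show ?case unfolding i using G[OF elim] by (simp add: ennreal_plus)
    qed
  qed
  also have "\<dots> = (\<integral>\<^sup>+X. ennreal (g1 X) * indicator {X0..X1} X \<partial>lborel)
      + (\<integral>\<^sup>+X. ennreal (g2 X) * indicator {X1..} X \<partial>lborel)"
    using meas by (intro nn_integral_add) auto
  also have "(\<integral>\<^sup>+X. ennreal (g1 X) * indicator {X0..X1} X \<partial>lborel)
      = ennreal (upper_primitive X1 - upper_primitive X0)"
    by (rule nn_integral_FTC_Icc[OF meas(1)])
      (use X0 X1 upper_primitive_deriv g1_nonneg in \<open>auto simp: g1_def u_def\<close>)
  also have "(\<integral>\<^sup>+X. ennreal (g2 X) * indicator {X1..} X \<partial>lborel)
      = ennreal (0 - (upper_primitive X1 - lower_primitive X1))"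
    by (rule nn_integral_FTC_atLeast[OF meas(2) _ g2_nonneg primitive_difference_tendsto_0])
      (use X1 in \<open>auto simp: g2_def u_def v_def intro!: DERIV_diff upper_primitive_deriv lower_primitive_deriv\<close>)
  also have "ennreal (upper_primitive X1 - upper_primitive X0)
      + ennreal (0 - (upper_primitive X1 - lower_primitive X1))
      = ennreal ((upper_primitive X1 - upper_primitive X0)
        + (0 - (upper_primitive X1 - lower_primitive X1)))"
    by (rule ennreal_plus[symmetric]) (use upper_le lower_ge in auto)
  also have "(upper_primitive X1 - upper_primitive X0) + (0 - (upper_primitive X1 - lower_primitive X1))
      = ?K"
    by (rule K)
  finally show "(\<integral>\<^sup>+X. ennreal (?g X) * indicator {0<..} X \<partial>lborel) = ennreal ?K" .
  show "0 \<le> ?K" unfolding K[symmetric] using upper_le lower_ge by simp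
qed

end

section \<open>Integer polynomials in several variables\<close>

definition monom_eval :: "('n::finite \<Rightarrow> 'b::comm_ring_1) \<Rightarrow> ('n \<Rightarrow>\<^sub>0 nat) \<Rightarrow> 'b" where
  "monom_eval v m = (\<Prod>i\<in>UNIV. v i ^ Poly_Mapping.lookup m i)"

text \<open>The values may lie in any commutative ring: integers, complex numbers, univariate
  polynomials, or the polynomial ring itself, where evaluation is substitution.\<close>

definition int_eval :: "('n::finite \<Rightarrow> 'b::comm_ring_1) \<Rightarrow> ('n, int) mvpoly \<Rightarrow> 'b" where
  "int_eval v g = (\<Sum>m\<in>Poly_Mapping.keys g. of_int (Poly_Mapping.lookup g m) * monom_eval v m)"

definition var :: "'n \<Rightarrow> ('n, int) mvpoly" where
  "var i = Poly_Mapping.single (Poly_Mapping.single i 1) 1"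

lemma monom_eval_0 [simp]: "monom_eval v 0 = 1"
  by (simp add: monom_eval_def)

lemma monom_eval_add: "monom_eval v (m + n) = monom_eval v m * monom_eval v n"
  by (simp add: monom_eval_def lookup_add power_add prod.distrib)

lemma monom_eval_single: "monom_eval v (Poly_Mapping.single i k) = v i ^ k"
proof -
  have "monom_eval v (Poly_Mapping.single i k) = (\<Prod>j\<in>UNIV. if j = i then v i ^ k else 1)"
    unfolding monom_eval_def by (intro prod.cong) (auto simp: lookup_single)
  then show ?thesis by simp
qed

lemma int_eval_superset:
  assumes "finite S" "Poly_Mapping.keys g \<subseteq> S"
  shows "int_eval v g = (\<Sum>m\<in>S. of_int (Poly_Mapping.lookup g m) * monom_eval v m)"
  unfolding int_eval_def using assms
  by (intro sum.mono_neutral_left) (auto simp: in_keys_iff)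

lemma int_eval_0 [simp]: "int_eval v 0 = 0"
  by (simp add: int_eval_def)

lemma int_eval_single: "int_eval v (Poly_Mapping.single m c) = of_int c * monom_eval v m"
  by (subst int_eval_superset[of "{m}"]) auto

lemma int_eval_add: "int_eval v (f + g) = int_eval v f + int_eval v g"
proof -
  let ?S = "Poly_Mapping.keys f \<union> Poly_Mapping.keys g"
  have "int_eval v h = (\<Sum>m\<in>?S. of_int (Poly_Mapping.lookup h m) * monom_eval v m)"
    if "h \<in> {f, g, f + g}" for h
    using that keys_add[of f g] by (intro int_eval_superset) auto
  then show ?thesis by (simp add: lookup_add algebra_simps sum.distrib)
qed

lemma mvpoly_eq_sum_single:
  "g = (\<Sum>m\<in>Poly_Mapping.keys g. Poly_Mapping.single m (Poly_Mapping.lookup g m))"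
  by (rule poly_mapping_eqI)
    (auto simp: lookup_sum lookup_single when_def in_keys_iff sum.delta)

lemma mvpoly_induct [case_names single add]:
  fixes g :: "('n, int) mvpoly"
  assumes "\<And>m c. P (Poly_Mapping.single m c)" "\<And>f g. P f \<Longrightarrow> P g \<Longrightarrow> P (f + g)"
  shows "P g"
proof -
  have "P (\<Sum>m\<in>S. Poly_Mapping.single m (Poly_Mapping.lookup g m))" if "finite S" for S
    using that
  proof (induction S)
    case empty
    show ?case using assms(1)[of 0 0] by simp
  qed (use assms in simp)
  then show ?thesis by (subst mvpoly_eq_sum_single) simp
qed

lemma int_eval_mult: "int_eval v (f * g) = int_eval v f * int_eval v g"
proof (induction f rule: mvpoly_induct)
  case (single m c)
  show ?case
  proof (induction g rule: mvpoly_induct)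
    case (single n d)
    show ?case by (simp add: mult_single int_eval_single monom_eval_add mult_ac)
  qed (simp add: distrib_left int_eval_add)
qed (simp add: distrib_right int_eval_add)

text \<open>Homomorphisms as a predicate on functions: evaluations and coefficientwise maps are
  instances, and \<open>int_eval\<close> commutes with all of them.\<close>

locale ring_map =
  fixes h :: "'a::comm_ring_1 \<Rightarrow> 'b::comm_ring_1"
  assumes add: "h (x + y) = h x + h y"
    and mult: "h (x * y) = h x * h y"
    and one: "h 1 = 1"
begin

lemma zero: "h 0 = 0"
  using add[of 0 0] by simp

lemma uminus: "h (- x) = - h x"
  using add[of x "- x"] by (simp add: zero eq_neg_iff_add_eq_0 add.commute)

lemma diff: "h (x - y) = h x - h y"
  using add[of x "- y"] by (simp add: uminus)

lemma power: "h (x ^ n) = h x ^ n"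
  by (induction n) (auto simp: one mult)

lemma of_nat: "h (of_nat n) = of_nat n"
  by (induction n) (auto simp: zero one add)

lemma of_int: "h (of_int n) = of_int n"
  by (cases n) (auto simp: of_nat uminus one add simp del: of_nat_Suc)

lemma sum: "h (sum f I) = (\<Sum>i\<in>I. h (f i))"
  by (induction I rule: infinite_finite_induct) (auto simp: zero add)

lemma prod: "h (prod f I) = (\<Prod>i\<in>I. h (f i))"
  by (induction I rule: infinite_finite_induct) (auto simp: one mult)

lemma int_eval: "h (int_eval v g) = int_eval (\<lambda>i. h (v i)) g"
  by (simp add: int_eval_def monom_eval_def sum mult of_int prod power)

lemma map_poly: "ring_map (map_poly h)"
proof
  show "map_poly h (x + y) = map_poly h x + map_poly h y" for x y
    by (rule poly_eqI) (simp add: coeff_map_poly zero add)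
  show "map_poly h (x * y) = map_poly h x * map_poly h y" for x y
    by (rule poly_eqI) (simp add: coeff_map_poly zero coeff_mult sum mult)
  show "map_poly h 1 = 1" by (simp add: map_poly_1' one)
qed

end

lemma ring_map_int_eval: "ring_map (int_eval v)"
  by standard (simp_all add: int_eval_add int_eval_mult int_eval_single flip: single_one)

lemma ring_map_poly: "ring_map (\<lambda>f. poly f s)"
  by standard auto

lemma int_eval_var [simp]: "int_eval v (var i) = v i"
  by (simp add: var_def int_eval_single monom_eval_single)

lemma monom_eval_var: "monom_eval var m = Poly_Mapping.single m (1 :: int)"
proof -
  have pow: "(var i :: ('n, int) mvpoly) ^ k = Poly_Mapping.single (Poly_Mapping.single i k) 1" for i :: 'n and k
    by (induction k) (auto simp: var_def mult_single single_add[symmetric] simp flip: single_one)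
  have "(\<Prod>i\<in>I. var i ^ Poly_Mapping.lookup m i)
      = Poly_Mapping.single (\<Sum>i\<in>I. Poly_Mapping.single i (Poly_Mapping.lookup m i)) (1 :: int)"
    if "finite I" for I
    using that by induction (auto simp: pow mult_single)
  moreover have "(\<Sum>i\<in>UNIV. Poly_Mapping.single i (Poly_Mapping.lookup m i)) = m"
    by (rule poly_mapping_eqI) (auto simp: lookup_sum lookup_single when_def sum.delta)
  ultimately show ?thesis by (simp add: monom_eval_def)
qed

lemma int_eval_id: "int_eval var g = g"
proof -
  have "int_eval var g = (\<Sum>m\<in>Poly_Mapping.keys g. Poly_Mapping.single m (Poly_Mapping.lookup g m))"
    unfolding int_eval_def
    by (intro sum.cong refl) (simp add: monom_eval_var mult_single flip: single_of_int)
  then show ?thesis by (simp flip: mvpoly_eq_sum_single)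
qed

lemma mv_eval_complexify: "mv_eval (complexify g) x = int_eval (\<lambda>i. x $ i) g"
proof -
  have l: "Poly_Mapping.lookup (complexify g) m = of_int (Poly_Mapping.lookup g m)" for m
    unfolding complexify_def by (simp add: Poly_Mapping.map.rep_eq when_def)
  then have "Poly_Mapping.keys (complexify g) = Poly_Mapping.keys g"
    by (auto simp: in_keys_iff)
  then show ?thesis by (simp add: mv_eval_def int_eval_def l monom_eval_def)
qed

lemma poly_int_eval_upd:
  "poly (int_eval (\<lambda>j. if j = i then [:0, 1:] else [:w j:]) g) s = int_eval (w(i := s)) g"
  by (subst ring_map.int_eval[OF ring_map_poly]) (auto intro!: arg_cong2[where f = int_eval])

text \<open>Freeing one coordinate gives a univariate polynomial, which vanishes once it has
  infinitely many roots. This removes genericity assumptions one variable at a time.\<close>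

lemma int_eval_eq_0_if_infinite:
  fixes w :: "'n::finite \<Rightarrow> complex"
  assumes "infinite {s. int_eval (w(i := s)) g = 0}"
  shows "int_eval w g = 0"
proof -
  define f where "f = int_eval (\<lambda>j. if j = i then [:0, 1:] else [:w j:]) g"
  have "infinite {s. poly f s = 0}" using assms by (simp add: f_def poly_int_eval_upd)
  then have "f = 0" using poly_roots_finite by blast
  then show ?thesis using poly_int_eval_upd[of i w g "w i"] by (simp add: f_def)
qed

lemma base_expansion_unique:
  fixes f g :: "nat \<Rightarrow> nat"
  assumes "(\<Sum>i<n. f i * D ^ i) = (\<Sum>i<n. g i * D ^ i)" "\<And>i. f i < D" "\<And>i. g i < D" "i < n"
  shows "f i = g i"
  using assms
proof (induction n arbitrary: f g i)
  case (Suc n)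
  have *: "(\<Sum>i<Suc n. h i * D ^ i) = h 0 + D * (\<Sum>i<n. h (Suc i) * D ^ i)" for h :: "nat \<Rightarrow> nat"
    by (subst sum.lessThan_Suc_shift) (simp add: sum_distrib_left mult_ac)
  have eq: "f 0 + D * (\<Sum>i<n. f (Suc i) * D ^ i) = g 0 + D * (\<Sum>i<n. g (Suc i) * D ^ i)"
    using Suc.prems(1) unfolding * .
  have "f 0 = g 0"
    using arg_cong[OF eq, of "\<lambda>x. x mod D"] Suc.prems(2,3) by simp
  moreover have "D > 0" using Suc.prems(2)[of 0] by simp
  ultimately have "(\<Sum>i<n. f (Suc i) * D ^ i) = (\<Sum>i<n. g (Suc i) * D ^ i)" using eq by simp
  with Suc.IH[of "\<lambda>i. f (Suc i)" "\<lambda>i. g (Suc i)"] Suc.prems \<open>f 0 = g 0\<close>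
  show ?case by (cases i) auto
qed simp

text \<open>Kronecker's substitution of \<open>z\<close> to the powers of a large base for the variables keeps
  the monomials apart.\<close>

lemma int_eval_inject:
  fixes g :: "('n::finite, int) mvpoly"
  assumes "\<And>w :: 'n \<Rightarrow> complex. int_eval w g = 0"
  shows "g = 0"
proof -
  obtain idx :: "'n \<Rightarrow> nat" where idx: "bij_betw idx UNIV {..<CARD('n)}"
    using ex_bij_betw_finite_nat[of "UNIV :: 'n set"] by (auto simp: atLeast0LessThan)
  \<comment> \<open>Larger than every exponent that occurs, so the exponents of a monomial are
    digits in base \<open>D\<close>.\<close>
  define D where "D = Suc (\<Sum>m\<in>Poly_Mapping.keys g. \<Sum>i\<in>UNIV. Poly_Mapping.lookup m i)"
  have D: "Poly_Mapping.lookup m i < D" if "m \<in> Poly_Mapping.keys g" for m i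
  proof -
    have "Poly_Mapping.lookup m i \<le> (\<Sum>i\<in>UNIV. Poly_Mapping.lookup m i)"
      by (rule member_le_sum) auto
    also have "\<dots> \<le> (\<Sum>m\<in>Poly_Mapping.keys g. \<Sum>i\<in>UNIV. Poly_Mapping.lookup m i)"
      by (rule member_le_sum[OF that]) auto
    finally show ?thesis by (simp add: D_def)
  qed
  define e where "e = (\<lambda>m::'n \<Rightarrow>\<^sub>0 nat. \<Sum>i\<in>UNIV. Poly_Mapping.lookup m i * D ^ idx i)"
  have inj: "inj_on e (Poly_Mapping.keys g)"
  proof (rule inj_onI)
    fix m m' assume m: "m \<in> Poly_Mapping.keys g" "m' \<in> Poly_Mapping.keys g" "e m = e m'"
    define f where "f = (\<lambda>m k. Poly_Mapping.lookup m (inv_into UNIV idx k) :: nat)"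
    have f: "f m (idx i) = Poly_Mapping.lookup m i" for m i
      using idx by (simp add: f_def bij_betw_def)
    have "e m = (\<Sum>k<CARD('n). f m k * D ^ k)" for m
      unfolding e_def by (subst sum.reindex_bij_betw[OF idx, symmetric]) (simp add: f)
    with m have "f m k = f m' k" if "k < CARD('n)" for k
      using base_expansion_unique[of "f m" D "CARD('n)" "f m'" k] D that by (simp add: f_def)
    then have "Poly_Mapping.lookup m i = Poly_Mapping.lookup m' i" for i
      using idx f by (metis UNIV_I bij_betwE lessThan_iff)
    then show "m = m'" by (rule poly_mapping_eqI)
  qed
  define F :: "complex poly" where
    "F = (\<Sum>m\<in>Poly_Mapping.keys g. monom (of_int (Poly_Mapping.lookup g m)) (e m))"
  have "poly F z = int_eval (\<lambda>i. z ^ (D ^ idx i)) g" for z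
    by (simp add: F_def int_eval_def monom_eval_def poly_sum poly_monom e_def power_sum
        mult.commute flip: power_mult)
  then have "F = 0" using assms by (simp add: poly_eq_poly_eq_iff[symmetric] fun_eq_iff)
  have "Poly_Mapping.lookup g m = 0" if m: "m \<in> Poly_Mapping.keys g" for m
  proof -
    have "coeff F (e m) = (\<Sum>m'\<in>Poly_Mapping.keys g.
        if m' = m then of_int (Poly_Mapping.lookup g m) else 0)"
      unfolding F_def coeff_sum using inj m
      by (intro sum.cong) (auto simp: inj_on_def)
    then show ?thesis using \<open>F = 0\<close> m by simp
  qed
  then show ?thesis by (intro poly_mapping_eqI) (metis in_keys_iff lookup_zero)
qed

text \<open>Restricted to the line through 0 and \<open>w\<close>, a unit becomes a unit among
  complex polynomials, hence constant. Its value at \<open>w\<close> equals its value at 0, an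
  integer dividing 1.\<close>

lemma int_unit_eval_norm:
  fixes g :: "('n::finite, int) mvpoly" and w :: "'n \<Rightarrow> complex"
  assumes "g dvd 1" shows "norm (int_eval w g) = 1"
proof -
  obtain h where h: "1 = g * h" using assms by (elim dvdE)
  interpret E: ring_map "int_eval v" for v :: "'n \<Rightarrow> 'x::comm_ring_1" by (rule ring_map_int_eval)
  define G where "G = int_eval (\<lambda>i. [:0, w i:]) g"
  define H where "H = int_eval (\<lambda>i. [:0, w i:]) h"
  have "G * H = 1" unfolding G_def H_def E.mult[symmetric] h[symmetric] by (rule E.one)
  then have "degree (G * H) = 0" "G \<noteq> 0" "H \<noteq> 0" by auto
  then have "degree G = 0" by (simp add: degree_mult_eq)
  then have "poly G 1 = poly G 0" by (elim degree_eq_zeroE) simp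
  moreover have "poly G s = int_eval (\<lambda>i. s * w i) g" for s
    unfolding G_def by (subst ring_map.int_eval[OF ring_map_poly]) simp
  ultimately have "int_eval w g = int_eval (\<lambda>i. 0) g" by simp
  also have "(\<lambda>i::'n. 0 :: complex) = (\<lambda>i. of_int 0)" by simp
  also have "int_eval (\<lambda>i::'n. of_int 0) g = (of_int (int_eval (\<lambda>i. 0) g) :: complex)"
  proof -
    have "ring_map (of_int :: int \<Rightarrow> complex)" by standard auto
    from ring_map.int_eval[OF this, of "\<lambda>i. 0" g] show ?thesis by simp
  qed
  finally have 1: "int_eval w g = of_int (int_eval (\<lambda>i. 0) g)" .
  have "int_eval (\<lambda>i. 0 :: int) g * int_eval (\<lambda>i. 0) h = 1"
    unfolding E.mult[symmetric] h[symmetric] by (rule E.one)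
  then have "\<bar>int_eval (\<lambda>i. 0 :: int) g\<bar> = 1" by (metis abs_mult abs_1 abs_zmult_eq_1)
  then show ?thesis unfolding 1 by (metis norm_of_int of_int_1 of_int_abs)
qed

section \<open>The resultant of two trinomials\<close>

text \<open>The expression of the minors from the overview over an arbitrary ring, so that it can be
  evaluated at numbers, at the generic variables and along a line.\<close>

definition trinomial_resultant :: "nat \<Rightarrow> nat \<Rightarrow> (6 \<Rightarrow> 'a::comm_ring_1) \<Rightarrow> 'a" where
  "trinomial_resultant p q v = (v 3 * v 4 - v 1 * v 6) ^ q
     - (v 2 * v 6 - v 3 * v 5) ^ (q - p) * (v 1 * v 5 - v 2 * v 4) ^ p"

lemma UNIV_6: "(UNIV :: 6 set) = {1, 2, 3, 4, 5, 6}"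
proof -
  have "card {1, 2, 3, 4, 5, 6 :: 6} = 6" by simp
  then show ?thesis by (intro card_subset_eq[symmetric]) auto
qed

lemma (in ring_map) trinomial_resultant:
  "h (trinomial_resultant p q v) = trinomial_resultant p q (\<lambda>i. h (v i))"
  by (simp add: trinomial_resultant_def diff mult power)

text \<open>A common root \<open>t\<close> gives \<open>B = t ^ p * A\<close> and
  \<open>C = t ^ q * A\<close>, so both terms become \<open>t ^ (p * q) * A ^ q\<close>.\<close>

lemma trinomial_resultant_common_root:
  assumes "p \<le> q" "v 1 + v 2 * t ^ p + v 3 * t ^ q = 0" "v 4 + v 5 * t ^ p + v 6 * t ^ q = 0"
  shows "trinomial_resultant p q v = (0 :: complex)"
proof -
  have v: "v 1 = - (v 2 * t ^ p + v 3 * t ^ q)" "v 4 = - (v 5 * t ^ p + v 6 * t ^ q)"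
    using assms by (auto simp: add_eq_0_iff algebra_simps)
  define D where "D = v 2 * v 6 - v 3 * v 5"
  have BC: "v 3 * v 4 - v 1 * v 6 = t ^ p * D" "v 1 * v 5 - v 2 * v 4 = t ^ q * D"
    unfolding v D_def by (simp_all add: algebra_simps)
  have D: "D ^ q = D ^ (q - p) * D ^ p"
    using assms(1) by (simp flip: power_add)
  have t: "(t ^ p) ^ q = (t ^ q) ^ p" by (simp add: mult.commute flip: power_mult)
  show ?thesis
    unfolding trinomial_resultant_def BC D_def[symmetric] power_mult_distrib t D
    by (simp only: mult_ac diff_self)
qed

text \<open>A multiple root forces \<open>c4\<close> to be minus the value of
  \<open>c5 * t ^ p + c6 * t ^ q\<close> at one of its critical points, and there are finitely many
  of these.\<close>

lemma card_roots_trinomial: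
  fixes c5 c6 :: complex
  assumes "0 < p" "p < q" "c6 \<noteq> 0"
  shows "\<exists>F. finite F \<and> (\<forall>c4. c4 \<notin> F \<longrightarrow>
    card {t. c4 + c5 * t ^ p + c6 * t ^ q = 0} = q \<and> finite {t. c4 + c5 * t ^ p + c6 * t ^ q = 0})"
proof -
  define G where "G = monom c5 p + monom c6 q"
  have deg: "degree ([:c:] + G) = q" for c
  proof -
    have "degree (monom c5 p) < degree (monom c6 q)"
      using assms degree_monom_le[of c5 p] by (simp add: degree_monom_eq)
    then have "degree G = q" using assms by (simp add: G_def degree_add_eq_right degree_monom_eq)
    moreover have "degree [:c:] = 0" by simp
    ultimately show ?thesis using assms by (subst degree_add_eq_right) auto
  qed
  from deg[of 0] have "pderiv G \<noteq> 0" using assms by (simp add: pderiv_eq_0_iff)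
  define F where "F = (\<lambda>t. - poly G t) ` {t. poly (pderiv G) t = 0}"
  have "finite F" unfolding F_def using \<open>pderiv G \<noteq> 0\<close> by (intro finite_imageI poly_roots_finite)
  moreover have "card {t. c4 + c5 * t ^ p + c6 * t ^ q = 0} = q \<and>
      finite {t. c4 + c5 * t ^ p + c6 * t ^ q = 0}" if "c4 \<notin> F" for c4
  proof -
    define f where "f = [:c4:] + G"
    have f: "poly f t = c4 + c5 * t ^ p + c6 * t ^ q" for t
      by (simp add: f_def G_def poly_monom algebra_simps)
    have "rsquarefree f"
      unfolding rsquarefree_roots
    proof (intro allI notI)
      fix t assume t: "poly f t = 0 \<and> poly (pderiv f) t = 0"
      then have "poly (pderiv G) t = 0" "c4 = - poly G t"
        by (auto simp: f_def pderiv_add pderiv_pCons eq_neg_iff_add_eq_0)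
      then show False using that by (auto simp: F_def)
    qed
    then have *: "smult (lead_coeff f) (\<Prod>z|poly f z = 0. [:- z, 1:]) = f"
      by (rule complex_poly_decompose_rsquarefree)
    have "f \<noteq> 0" using deg[of c4] assms by (auto simp: f_def)
    then have fin: "finite {z. poly f z = 0}" by (rule poly_roots_finite)
    have "q = degree f" using deg by (simp add: f_def)
    also have "\<dots> = degree (\<Prod>z|poly f z = 0. [:- z, 1:])"
      using \<open>f \<noteq> 0\<close> by (subst *[symmetric]) simp
    also have "\<dots> = card {z. poly f z = 0}"
      by (subst degree_prod_sum_eq) auto
    finally show ?thesis using fin by (simp add: f)
  qed
  ultimately show ?thesis by blast
qed

text \<open>The ratio \<open>s / t\<close> has both its \<open>p\<close>-th and its
  \<open>q\<close>-th power equal to 1, so Bezout makes it 1.\<close>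

lemma coprime_powers_eq:
  fixes s t :: complex
  assumes "coprime p q" "s ^ p = t ^ p" "s ^ q = t ^ q" "t \<noteq> 0"
  shows "s = t"
proof -
  define z where "z = s / t"
  have z: "z ^ p = 1" "z ^ q = 1" using assms by (auto simp: z_def power_divide)
  obtain a b where ab: "int p * a + int q * b = 1"
    using assms(1) bezout_int[of "int p" "int q"] by (auto simp: coprime_iff_gcd_eq_1 mult.commute)
  have "z \<noteq> 0"
  proof
    assume "z = 0"
    then have "p = 0" "q = 0" using z by (auto simp: power_0_left split: if_splits)
    then show False using assms(1) by simp
  qed
  then have "z = z powi (int p * a + int q * b)" using ab by simp
  also have "\<dots> = (z powi int p) powi a * (z powi int q) powi b"
    using \<open>z \<noteq> 0\<close> by (simp add: power_int_add power_int_mult)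
  also have "\<dots> = 1" using z by simp
  finally show ?thesis using assms by (simp add: z_def)
qed

text \<open>The map sends \<open>t\<close> to the constant coefficient of the first trinomial for
  which \<open>t\<close> is a root of it. If two roots of the second trinomial have different
  \<open>p\<close>-th powers, a collision fixes \<open>c2\<close>; if these powers agree, the second
  trinomial makes the \<open>q\<close>-th powers agree as well.\<close>

lemma distinct_abscissae:
  fixes c3 :: complex
  assumes "finite T" "coprime p q" "0 \<notin> T" "c6 \<noteq> 0"
    and "\<And>t. t \<in> T \<Longrightarrow> c4 + c5 * t ^ p + c6 * t ^ q = 0"
  shows "\<exists>F. finite F \<and> (\<forall>c2. c2 \<notin> F \<longrightarrow> inj_on (\<lambda>t. - (c2 * t ^ p + c3 * t ^ q)) T)"
proof -
  define F where "F = (\<lambda>(s, t). - (c3 * (s ^ q - t ^ q)) / (s ^ p - t ^ p)) ` (T \<times> T)"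
  have "inj_on (\<lambda>t. - (c2 * t ^ p + c3 * t ^ q)) T" if "c2 \<notin> F" for c2
  proof (rule inj_onI)
    fix s t assume st: "s \<in> T" "t \<in> T" "- (c2 * s ^ p + c3 * s ^ q) = - (c2 * t ^ p + c3 * t ^ q)"
    then have eq: "c2 * (s ^ p - t ^ p) = - (c3 * (s ^ q - t ^ q))" by (simp add: algebra_simps)
    have "s ^ p = t ^ p"
    proof (rule ccontr)
      assume "s ^ p \<noteq> t ^ p"
      then have "c2 = - (c3 * (s ^ q - t ^ q)) / (s ^ p - t ^ p)" using eq by (simp add: field_simps)
      then have "c2 \<in> F" unfolding F_def using st by (intro image_eqI[of _ _ "(s, t)"]) auto
      with that show False by simp
    qed
    moreover from this have "s ^ q = t ^ q"
      using assms(5)[OF st(1)] assms(5)[OF st(2)] assms(4) by (metis add_left_cancel mult_left_cancel)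
    ultimately show "s = t" using coprime_powers_eq[OF assms(2)] st assms(3) by blast
  qed
  moreover have "finite F" unfolding F_def using assms(1) by simp
  ultimately show ?thesis by blast
qed

lemma infinite_if_cofinite:
  fixes F :: "complex set"
  assumes "finite F" "\<And>s. s \<notin> F \<Longrightarrow> P s" shows "infinite {s. P s}"
proof
  assume "finite {s. P s}"
  then have "finite (F \<union> {s. P s})" using assms(1) by simp
  moreover have "F \<union> {s. P s} = UNIV" using assms(2) by auto
  ultimately show False using infinite_UNIV_char_0 by metis
qed

text \<open>The generic point with the variable of index 1 turned into the indeterminate of a
  univariate polynomial. Division in that single variable becomes available, and evaluation at
  \<open>var 1\<close> leads back.\<close>

definition line_var :: "6 \<Rightarrow> (6, int) mvpoly poly" where
  "line_var j = (if j = 1 then [:0, 1:] else [:var j:])"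

text \<open>The minor \<open>A\<close> does not contain the first variable, while \<open>B\<close>
  and \<open>C\<close> are at most linear in it. As \<open>p < q\<close>, the term
  \<open>B ^ q\<close> decides the leading coefficient.\<close>

lemma degree_trinomial_resultant_line:
  assumes "0 < p" "p < q"
  shows "degree (trinomial_resultant p q line_var) = q"
    "lead_coeff (trinomial_resultant p q line_var) = (- var 6) ^ q"
proof -
  have var_nz: "var j \<noteq> 0" for j :: 6 by (simp add: var_def)
  let ?B = "line_var 3 * line_var 4 - line_var 1 * line_var 6"
  let ?A = "line_var 2 * line_var 6 - line_var 3 * line_var 5"
  let ?C = "line_var 1 * line_var 5 - line_var 2 * line_var 4"
  have B: "?B = [:var 3 * var 4, - var 6:]" by (simp add: line_var_def)
  have A: "?A = [:var 2 * var 6 - var 3 * var 5:]" by (simp add: line_var_def)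
  have C: "?C = [:- (var 2 * var 4), var 5:]" by (simp add: line_var_def)
  have dB: "degree (?B ^ q) = q" "lead_coeff (?B ^ q) = (- var 6) ^ q"
  proof -
    have "lead_coeff ?B = - var 6" using var_nz[of 6] unfolding B by simp
    then show "lead_coeff (?B ^ q) = (- var 6) ^ q" by (simp only: lead_coeff_power)
    show "degree (?B ^ q) = q" using var_nz[of 6] unfolding B by (simp add: degree_power_eq)
  qed
  have "degree (?A ^ (q - p) * ?C ^ p) \<le> 0 + p"
  proof (rule order_trans[OF degree_mult_le add_mono])
    have "degree (?A ^ (q - p)) \<le> degree ?A * (q - p)" by (rule degree_power_le)
    then show "degree (?A ^ (q - p)) \<le> 0" unfolding A by simp
    have "degree (?C ^ p) \<le> degree ?C * p" by (rule degree_power_le)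
    also have "\<dots> \<le> 1 * p" unfolding C by (intro mult_right_mono) auto
    finally show "degree (?C ^ p) \<le> p" by simp
  qed
  then have lt: "degree (- (?A ^ (q - p) * ?C ^ p)) < degree (?B ^ q)" using assms dB by simp
  have eq: "trinomial_resultant p q line_var = - (?A ^ (q - p) * ?C ^ p) + ?B ^ q"
    by (simp add: trinomial_resultant_def)
  show "degree (trinomial_resultant p q line_var) = q"
    unfolding eq degree_add_eq_right[OF lt] by (rule dB)
  show "lead_coeff (trinomial_resultant p q line_var) = (- var 6) ^ q"
    unfolding eq lead_coeff_add_le[OF lt] by (rule dB)
qed

text \<open>The remainder of a pseudo-division by the resultant has degree less than \<open>q\<close> in the first
  variable, but for generic values of the others it vanishes at the \<open>q\<close> values which make the
  two trinomials share a root.\<close>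

lemma pseudo_remainder_eq_0:
  fixes R :: "(6, int) mvpoly"
  assumes pq: "0 < p" "p < q" "coprime p q"
    and van: "\<And>x t. t \<noteq> 0 \<Longrightarrow> trinomial0 p q x t = 0 \<Longrightarrow> trinomial1 p q x t = 0 \<Longrightarrow>
      int_eval (\<lambda>i. x $ i) R = 0"
    and div: "smult c (int_eval line_var R) = trinomial_resultant p q line_var * Q + r"
    and deg: "degree r < q"
  shows "r = 0"
proof (rule poly_eqI)
  fix n
  have gen: "int_eval w (coeff r n) = 0"
    if c6: "w 6 \<noteq> 0" and c4: "w 4 \<noteq> 0"
      and T: "T = {t. w 4 + w 5 * t ^ p + w 6 * t ^ q = 0}" "card T = q" "finite T"
      and inj: "inj_on (\<lambda>t. - (w 2 * t ^ p + w 3 * t ^ q)) T"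
    for w :: "6 \<Rightarrow> complex" and T
  proof -
    interpret E: ring_map "int_eval w" by (rule ring_map_int_eval)
    interpret M: ring_map "map_poly (int_eval w)" by (rule E.map_poly)
    have lv: "map_poly (int_eval w) (line_var j) = (if j = 1 then [:0, 1:] else [:w j:])" for j
      by (simp add: line_var_def map_poly_pCons E.zero E.one)
    define r' where "r' = map_poly (int_eval w) r"
    have "smult (int_eval w c) (map_poly (int_eval w) (int_eval line_var R))
        = map_poly (int_eval w) (trinomial_resultant p q line_var) * map_poly (int_eval w) Q + r'"
      using arg_cong[OF div, of "map_poly (int_eval w)"]
      by (simp add: M.add M.mult r'_def map_poly_smult E.zero E.mult)
    then have "poly (smult (int_eval w c) (map_poly (int_eval w) (int_eval line_var R))) s
        = poly (map_poly (int_eval w) (trinomial_resultant p q line_var) * map_poly (int_eval w) Q + r') s" for s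
      by simp
    then have ev: "int_eval w c * int_eval (w(1 := s)) R
        = trinomial_resultant p q (w(1 := s)) * poly (map_poly (int_eval w) Q) s + poly r' s" for s
    proof -
      have "poly (map_poly (int_eval w) (int_eval line_var R)) s = int_eval (w(1 := s)) R"
        unfolding M.int_eval lv by (rule poly_int_eval_upd)
      moreover have "poly (map_poly (int_eval w) (trinomial_resultant p q line_var)) s
          = trinomial_resultant p q (w(1 := s))"
        unfolding M.trinomial_resultant lv ring_map.trinomial_resultant[OF ring_map_poly]
        by (rule arg_cong[where f = "trinomial_resultant p q"]) auto
      ultimately show ?thesis using \<open>\<And>s. poly (smult _ _) s = _\<close>[of s] by simp
    qed
    have root: "poly r' (- (w 2 * t ^ p + w 3 * t ^ q)) = 0" if "t \<in> T" for t
    proof -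
      define s where "s = - (w 2 * t ^ p + w 3 * t ^ q)"
      have t: "w 4 + w 5 * t ^ p + w 6 * t ^ q = 0" using that T by simp
      \<comment> \<open>The vanishing of \<open>R\<close> is assumed at nonzero common roots only;
        this is why \<open>w 4 \<noteq> 0\<close> is among the genericity conditions.\<close>
      have "t \<noteq> 0" using t c4 pq by (auto simp: power_0_left)
      then have "int_eval (\<lambda>i. (\<chi> i. (w(1 := s)) i) $ i) R = 0"
        by (rule van) (use t in \<open>simp_all add: trinomial0_def trinomial1_def s_def\<close>)
      then have "int_eval (w(1 := s)) R = 0" by (simp only: vec_lambda_beta)
      moreover have "trinomial_resultant p q (w(1 := s)) = 0"
        by (rule trinomial_resultant_common_root[of p q _ t])
          (use t pq in \<open>simp_all add: s_def\<close>)
      ultimately show ?thesis using ev[of s] by (simp add: s_def)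
    qed
    have "r' = 0"
    proof (rule ccontr)
      assume nz: "r' \<noteq> 0"
      have "q = card ((\<lambda>t. - (w 2 * t ^ p + w 3 * t ^ q)) ` T)" using T inj by (simp add: card_image)
      also have "\<dots> \<le> card {z. poly r' z = 0}"
        using root nz by (intro card_mono poly_roots_finite) auto
      also have "\<dots> \<le> degree r'" using nz by (rule card_poly_roots_bound)
      also have "\<dots> \<le> degree r" unfolding r'_def
        by (rule degree_le) (simp add: coeff_map_poly E.zero coeff_eq_0)
      finally show False using deg by simp
    qed
    then show ?thesis using coeff_map_poly[of "int_eval w" r n] by (simp add: r'_def E.zero)
  qed
  \<comment> \<open>The conditions are removed from the inside out: \<open>w 2\<close> avoids a
    finite set depending on \<open>w 4\<close>, then \<open>w 4\<close> one depending on
    \<open>w 6\<close>, and finally \<open>w 6\<close> avoids 0.\<close>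
  have "int_eval w (coeff r n) = 0" for w :: "6 \<Rightarrow> complex"
  proof -
    have 1: "int_eval w (coeff r n) = 0" if c6: "w 6 \<noteq> 0" for w :: "6 \<Rightarrow> complex"
    proof -
      obtain F where F: "finite F" "\<And>c4. c4 \<notin> F \<Longrightarrow>
          card {t. c4 + w 5 * t ^ p + w 6 * t ^ q = 0} = q \<and>
          finite {t. c4 + w 5 * t ^ p + w 6 * t ^ q = 0}"
        using card_roots_trinomial[OF pq(1,2) c6, of "w 5"] by blast
      have van4: "int_eval (w(4 := c4)) (coeff r n) = 0" if "c4 \<notin> insert 0 F" for c4
      proof -
        define T where "T = {t. c4 + w 5 * t ^ p + w 6 * t ^ q = 0}"
        have "0 \<notin> T" using that pq by (simp add: T_def power_0_left)
        moreover have "finite T" using F(2)[of c4] that by (simp add: T_def)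
        ultimately have "\<exists>F. finite F \<and> (\<forall>c2. c2 \<notin> F \<longrightarrow> inj_on (\<lambda>t. - (c2 * t ^ p + w 3 * t ^ q)) T)"
          using pq(3) c6 by (intro distinct_abscissae[of T p q "w 6" c4 "w 5"]) (auto simp: T_def)
        then obtain F' where F': "finite F'"
            "\<And>c2. c2 \<notin> F' \<Longrightarrow> inj_on (\<lambda>t. - (c2 * t ^ p + w 3 * t ^ q)) T" by blast
        have "int_eval (w(4 := c4, 2 := c2)) (coeff r n) = 0" if "c2 \<notin> F'" for c2
          by (rule gen[of _ T]) (use F(2)[of c4] F'(2)[OF that] c6 \<open>c4 \<notin> insert 0 F\<close>
              in \<open>simp_all add: T_def\<close>)
        from infinite_if_cofinite[OF F'(1) this] show ?thesis
          by (rule int_eval_eq_0_if_infinite)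
      qed
      have "finite (insert 0 F)" using F(1) by (rule finite.insertI)
      then have "infinite {c4. int_eval (w(4 := c4)) (coeff r n) = 0}"
        using van4 by (rule infinite_if_cofinite)
      then show ?thesis by (rule int_eval_eq_0_if_infinite)
    qed
    have "infinite {c6. int_eval (w(6 := c6)) (coeff r n) = 0}"
      by (rule infinite_if_cofinite[of "{0}"]) (auto intro: 1)
    then show ?thesis by (rule int_eval_eq_0_if_infinite)
  qed
  then show "coeff r n = coeff 0 n" by (simp add: int_eval_inject)
qed

text \<open>Identifies the kernel of setting one variable to 0 with the multiples of that variable.
  As the polynomial ring has no zero divisors, the variable can be used as a prime.\<close>

lemma var_dvd_diff_set_0:
  "var i dvd g - int_eval (\<lambda>j. if j = i then 0 else var j) g"
proof (induction g rule: mvpoly_induct)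
  case (single m c)
  have m: "Poly_Mapping.single m c = of_int c * monom_eval var m"
    by (simp add: monom_eval_var mult_single flip: single_of_int)
  show ?case
  proof (cases "Poly_Mapping.lookup m i = 0")
    case True
    then have e: "monom_eval (\<lambda>j. if j = i then 0 else var j) m = monom_eval var m"
      unfolding monom_eval_def by (intro prod.cong) auto
    have "int_eval (\<lambda>j. if j = i then 0 else var j) (Poly_Mapping.single m c)
        = Poly_Mapping.single m c"
      unfolding int_eval_single e by (rule m[symmetric])
    then show ?thesis by simp
  next
    case False
    have "monom_eval (\<lambda>j. if j = i then 0 else var j) m = 0"
      unfolding monom_eval_def using False by (intro prod_zero bexI[of _ i]) (auto simp: power_0_left)
    moreover have "var i dvd monom_eval var m"
      unfolding monom_eval_def using False
      by (intro dvd_trans[OF dvd_power dvd_prodI[where f = "\<lambda>i. var i ^ Poly_Mapping.lookup m i"]]) auto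
    ultimately have "int_eval (\<lambda>j. if j = i then 0 else var j) (Poly_Mapping.single m c) = 0"
      "var i dvd Poly_Mapping.single m c"
      by (simp add: int_eval_single, simp add: m)
    then show ?thesis by simp
  qed
next
  case (add f g)
  show ?case unfolding int_eval_add add_diff_add by (intro dvd_add add)
qed

text \<open>Modulo \<open>var 6\<close> the product of the resultant and the cofactor vanishes while
  the resultant does not, so the cofactor is a multiple of \<open>var 6\<close>, which can then be
  cancelled.\<close>

lemma trinomial_resultant_dvd_cancel:
  fixes S :: "(6, int) mvpoly"
  assumes "0 < p" "p < q" "trinomial_resultant p q var dvd var 6 * S"
  shows "trinomial_resultant p q var dvd S"
proof -
  define \<sigma> where "\<sigma> = (int_eval (\<lambda>j::6. if j = 6 then 0 else var j) :: (6, int) mvpoly \<Rightarrow> (6, int) mvpoly)"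
  interpret \<sigma>: ring_map \<sigma> unfolding \<sigma>_def by (rule ring_map_int_eval)
  obtain Q where Q: "var 6 * S = trinomial_resultant p q var * Q" using assms(3) by (elim dvdE)
  have v6: "(var 6 :: (6, int) mvpoly) \<noteq> 0"
    by (simp add: var_def)
  have "\<sigma> (trinomial_resultant p q var) \<noteq> 0"
  proof
    \<comment> \<open>At this point \<open>B = 1\<close> and \<open>A = C = 0\<close>, so the
      resultant is 1 even after \<open>var 6\<close> is set to 0.\<close>
    define w :: "6 \<Rightarrow> int" where "w = (\<lambda>j. if j = 3 \<or> j = 4 then 1 else 0)"
    assume "\<sigma> (trinomial_resultant p q var) = 0"
    then have "int_eval w (\<sigma> (trinomial_resultant p q var)) = 0" by simp
    then have "trinomial_resultant p q (\<lambda>j. if j = 6 then 0 else w j) = 0"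
      unfolding \<sigma>_def ring_map.int_eval[OF ring_map_int_eval]
        ring_map.trinomial_resultant[OF ring_map_int_eval]
      by (simp add: if_distrib cong: if_cong)
    then show False using assms by (simp add: trinomial_resultant_def w_def power_0_left)
  qed
  moreover have "\<sigma> (trinomial_resultant p q var) * \<sigma> Q = 0"
    using arg_cong[OF Q, of \<sigma>] by (simp add: \<sigma>.mult) (simp add: \<sigma>_def)
  ultimately have "\<sigma> Q = 0" by simp
  then have "var 6 dvd Q" using var_dvd_diff_set_0[of 6 Q] by (simp add: \<sigma>_def)
  then obtain Q' where "Q = var 6 * Q'" by (elim dvdE)
  then have "var 6 * S = var 6 * (trinomial_resultant p q var * Q')" using Q by (simp add: mult_ac)
  then show ?thesis using v6 by simp
qed

text \<open>Pseudo-division multiplies \<open>R\<close> by a power of the leading coefficient, up to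
  sign a power of \<open>var 6\<close>. The remainder is zero, and the factors \<open>var 6\<close>
  are cancelled one by one.\<close>

lemma trinomial_resultant_dvd:
  fixes R :: "(6, int) mvpoly"
  assumes pq: "0 < p" "p < q" "coprime p q"
    and van: "\<And>x t. t \<noteq> 0 \<Longrightarrow> trinomial0 p q x t = 0 \<Longrightarrow> trinomial1 p q x t = 0 \<Longrightarrow>
      int_eval (\<lambda>i. x $ i) R = 0"
  shows "trinomial_resultant p q var dvd R"
proof -
  define P where "P = trinomial_resultant p q line_var"
  have P: "degree P = q" "lead_coeff P = (- var 6) ^ q"
    using degree_trinomial_resultant_line[OF pq(1,2)] by (simp_all add: P_def)
  then have "P \<noteq> 0" using pq by auto
  obtain Q r where qr: "pseudo_divmod (int_eval line_var R) P = (Q, r)" by fastforce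
  define k where "k = Suc (degree (int_eval line_var R)) - degree P"
  have div: "smult (((- var 6) ^ q) ^ k) (int_eval line_var R) = P * Q + r"
    using pseudo_divmod(1)[OF \<open>P \<noteq> 0\<close> qr] P by (simp add: k_def)
  have "r = 0"
  proof (rule pseudo_remainder_eq_0[OF pq van div[unfolded P_def]])
    show "degree r < q" using pseudo_divmod(2)[OF \<open>P \<noteq> 0\<close> qr] P(1) pq by auto
  qed
  interpret E: ring_map "\<lambda>f. poly f (var 1 :: (6, int) mvpoly)" by (rule ring_map_poly)
  have lv: "poly (line_var j) (var 1) = var j" for j by (simp add: line_var_def)
  have "((- var 6) ^ q) ^ k * R = trinomial_resultant p q var * poly Q (var 1)"
    using arg_cong[OF div, of "\<lambda>f. poly f (var 1)"] \<open>r = 0\<close>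
    by (simp add: P_def E.int_eval E.trinomial_resultant lv int_eval_id)
  moreover have "((- var 6 :: (6, int) mvpoly) ^ q) ^ k = (- 1) ^ (q * k) * var 6 ^ (q * k)"
    by (metis power_minus power_mult)
  ultimately have "(- 1) ^ (q * k) * (var 6 ^ (q * k) * R)
      = trinomial_resultant p q var * poly Q (var 1)"
    by (simp only: mult.assoc)
  then have "trinomial_resultant p q var dvd (- 1) ^ (q * k) * (var 6 ^ (q * k) * R)"
    by (rule dvdI)
  then have "trinomial_resultant p q var dvd var 6 ^ (q * k) * R"
    by (cases "even (q * k)") auto
  moreover have "trinomial_resultant p q var dvd R" if "trinomial_resultant p q var dvd var 6 ^ n * R" for n
    using that
    by (induction n) (auto intro: trinomial_resultant_dvd_cancel[OF pq(1,2)] simp: mult.assoc)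
  ultimately show ?thesis by blast
qed

lemma norm_sparse_resultant:
  assumes pq: "0 < p" "p < q" "coprime p q" and R: "is_sparse_resultant p q R"
  shows "norm (mv_eval (complexify R) x) = norm (trinomial_resultant p q (\<lambda>i. x $ i))"
proof -
  have "trinomial_resultant p q var dvd R"
  proof (rule trinomial_resultant_dvd[OF pq])
    fix x t assume xt: "t \<noteq> 0" "trinomial0 p q x t = 0" "trinomial1 p q x t = 0"
    then have "x \<in> zariski_closure {x. \<exists>t. t \<noteq> 0 \<and> trinomial0 p q x t = 0 \<and> trinomial1 p q x t = 0}"
      by (auto simp: zariski_closure_def)
    then have "mv_eval (complexify R) x = 0" using R by (auto simp: is_sparse_resultant_def)
    then show "int_eval (\<lambda>i. x $ i) R = 0" by (simp add: mv_eval_complexify)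
  qed
  then obtain G where G: "R = trinomial_resultant p q var * G" by (elim dvdE)
  have ev: "int_eval v (trinomial_resultant p q var) = trinomial_resultant p q v"
    for v :: "6 \<Rightarrow> complex"
    by (simp add: ring_map.trinomial_resultant[OF ring_map_int_eval])
  have "\<not> trinomial_resultant p q var dvd (1 :: (6, int) mvpoly)"
  proof
    assume "trinomial_resultant p q var dvd (1 :: (6, int) mvpoly)"
    \<comment> \<open>At the origin the resultant is 0, whereas a unit would have absolute value
      1.\<close>
    from int_unit_eval_norm[OF this, of "\<lambda>_. 0"] show False
      using pq unfolding ev by (simp add: trinomial_resultant_def power_0_left)
  qed
  then have "G dvd 1" using R G irreducibleD unfolding is_sparse_resultant_def by blast
  from int_unit_eval_norm[OF this, of "\<lambda>i. x $ i"] show ?thesis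
    by (simp add: mv_eval_complexify G int_eval_mult norm_mult ev)
qed

section \<open>Jensen's formula on the unit circle\<close>

text \<open>Rotation-invariant probability measure of the unit circle, placed on the complex numbers
  so that a rotation is a multiplication.\<close>

definition circle :: "complex measure" where
  "circle = distr (density lborel (\<lambda>t. ennreal (1 / (2 * pi)) * indicator {0..<2 * pi} t)) borel cis"

lemma measurable_cis [measurable]: "cis \<in> borel_measurable borel"
  by (intro borel_measurable_continuous_onI continuous_intros)

lemma sets_circle [simp, measurable_cong]: "sets circle = sets borel"
  by (simp add: circle_def)

lemma space_circle [simp]: "space circle = UNIV"
  by (simp add: circle_def)

lemma nn_integral_circle:
  assumes [measurable]: "F \<in> borel_measurable borel"
  shows "(\<integral>\<^sup>+z. F z \<partial>circle)
    = ennreal (1 / (2 * pi)) * (\<integral>\<^sup>+t. F (cis t) * indicator {0..<2 * pi} t \<partial>lborel)"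
proof -
  have "(\<integral>\<^sup>+z. F z \<partial>circle)
      = (\<integral>\<^sup>+t. ennreal (1 / (2 * pi)) * (F (cis t) * indicator {0..<2 * pi} t) \<partial>lborel)"
    unfolding circle_def
    by (subst nn_integral_distr, simp, simp)
      (subst nn_integral_density, simp, simp, simp add: mult_ac)
  also have "\<dots> = ennreal (1 / (2 * pi)) * (\<integral>\<^sup>+t. F (cis t) * indicator {0..<2 * pi} t \<partial>lborel)"
    by (rule nn_integral_cmult) simp
  finally show ?thesis .
qed

interpretation circle: prob_space circle
proof
  have "emeasure circle (space circle) = (\<integral>\<^sup>+z. 1 \<partial>circle)" by simp
  also have "\<dots> = ennreal (1 / (2 * pi)) * ennreal (2 * pi)"
    by (subst nn_integral_circle) auto
  also have "\<dots> = ennreal (1 / (2 * pi) * (2 * pi))" by (rule ennreal_mult[symmetric]) auto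
  finally show "emeasure circle (space circle) = 1" by simp
qed

lemma AE_circle_norm: "AE z in circle. norm z = 1"
  unfolding circle_def by (subst AE_distr_iff) auto

lemma AE_circle_neq: "AE z in circle. z \<noteq> c"
proof -
  have "(\<integral>\<^sup>+z. indicator {c} z \<partial>circle)
      = ennreal (1 / (2 * pi)) * (\<integral>\<^sup>+t. indicator {c} (cis t) * indicator {0..<2 * pi} t \<partial>lborel)"
    by (rule nn_integral_circle) simp
  also have "(\<integral>\<^sup>+t. indicator {c} (cis t) * indicator {0..<2 * pi} t \<partial>lborel)
      = (\<integral>\<^sup>+(t::real). 0 \<partial>lborel)"
  proof (rule nn_integral_cong_AE)
    show "AE t in lborel. indicator {c} (cis t) * indicator {0..<2 * pi} t = (0::ennreal)"
      using AE_lborel_singleton[of "Arg2pi c"]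
    proof eventually_elim
      case (elim t)
      have "t = Arg2pi c" if "cis t = c" "0 \<le> t" "t < 2 * pi"
        using that by (intro Arg2pi_unique[of 1 t c, symmetric]) (auto simp: cis_conv_exp)
      with elim show ?case by (auto simp: indicator_def)
    qed
  qed
  finally have "emeasure circle {c} = 0" by simp
  then show ?thesis by (intro AE_I[of _ _ "{c}"]) auto
qed

lemma AE_circle_notin_finite:
  assumes "finite S" shows "AE z in circle. z \<notin> S"
proof -
  have "AE z in circle. \<forall>c\<in>S. z \<noteq> c"
    using assms AE_circle_neq by (intro AE_finite_allI) auto
  then show ?thesis by eventually_elim auto
qed

section \<open>Rotation and half angles\<close>

lemma nn_integral_lborel_shift:
  fixes G :: "real \<Rightarrow> ennreal"
  assumes [measurable]: "G \<in> borel_measurable borel"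
  shows "(\<integral>\<^sup>+t. G (t + s) \<partial>lborel) = (\<integral>\<^sup>+t. G t \<partial>lborel)"
  using nn_integral_real_affine[of G 1 s] by (simp add: add.commute)

lemma nn_integral_circle_rotate:
  assumes [measurable]: "F \<in> borel_measurable borel" and c: "norm c = 1"
  shows "(\<integral>\<^sup>+z. F (c * z) \<partial>circle) = (\<integral>\<^sup>+z. F z \<partial>circle)"
proof -
  define s where "s = Arg2pi c"
  have s: "0 \<le> s" "s < 2 * pi" "c = cis s"
    using Arg2pi[of c] Arg2pi_eq[of c] c by (auto simp: s_def cis_conv_exp)
  define G where "G = (\<lambda>t. F (cis t))"
  have [measurable]: "G \<in> borel_measurable borel" unfolding G_def by measurable
  have per: "G (t + 2 * pi) = G t" for t by (simp add: G_def cis_mult[symmetric])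
  have "(\<integral>\<^sup>+t. F (c * cis t) * indicator {0..<2 * pi} t \<partial>lborel)
      = (\<integral>\<^sup>+t. G (t + s) * indicator {s..<2 * pi + s} (t + s) \<partial>lborel)"
    by (intro nn_integral_cong) (auto simp: G_def s(3) cis_mult add.commute indicator_def)
  also have "\<dots> = (\<integral>\<^sup>+t. G t * indicator {s..<2 * pi + s} t \<partial>lborel)"
    by (rule nn_integral_lborel_shift) simp
  \<comment> \<open>The shifted period sticks out beyond \<open>2 * pi\<close>; periodicity moves
    the overhang back to \<open>{0..<s}\<close>.\<close>
  also have "\<dots> = (\<integral>\<^sup>+t. G t * indicator {s..<2 * pi} t + G t * indicator {2 * pi..<2 * pi + s} t \<partial>lborel)"
    using s by (intro nn_integral_cong) (auto simp: indicator_def)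
  also have "\<dots> = (\<integral>\<^sup>+t. G t * indicator {s..<2 * pi} t \<partial>lborel)
      + (\<integral>\<^sup>+t. G t * indicator {2 * pi..<2 * pi + s} t \<partial>lborel)"
    by (rule nn_integral_add) auto
  also have "(\<integral>\<^sup>+t. G t * indicator {2 * pi..<2 * pi + s} t \<partial>lborel)
      = (\<integral>\<^sup>+t. G (t + 2 * pi) * indicator {2 * pi..<2 * pi + s} (t + 2 * pi) \<partial>lborel)"
    by (rule nn_integral_lborel_shift[symmetric]) simp
  also have "\<dots> = (\<integral>\<^sup>+t. G t * indicator {0..<s} t \<partial>lborel)"
    by (intro nn_integral_cong) (auto simp: per indicator_def)
  also have "(\<integral>\<^sup>+t. G t * indicator {s..<2 * pi} t \<partial>lborel) + (\<integral>\<^sup>+t. G t * indicator {0..<s} t \<partial>lborel)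
      = (\<integral>\<^sup>+t. G t * indicator {s..<2 * pi} t + G t * indicator {0..<s} t \<partial>lborel)"
    by (rule nn_integral_add[symmetric]) auto
  also have "\<dots> = (\<integral>\<^sup>+t. F (cis t) * indicator {0..<2 * pi} t \<partial>lborel)"
    using s by (intro nn_integral_cong) (auto simp: indicator_def G_def)
  finally show ?thesis by (simp add: nn_integral_circle)
qed

text \<open>Half angles turn chords into sines, since \<open>cis (2 * t)\<close> has distance
  \<open>2 * |sin t|\<close> from 1.\<close>

lemma nn_integral_circle_double_angle:
  assumes [measurable]: "F \<in> borel_measurable borel"
  shows "(\<integral>\<^sup>+z. F z \<partial>circle)
    = ennreal (1 / pi) * (\<integral>\<^sup>+t. F (cis (2 * t)) * indicator {0<..<pi} t \<partial>lborel)"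
proof -
  have "(\<integral>\<^sup>+t. F (cis t) * indicator {0..<2 * pi} t \<partial>lborel)
      = ennreal \<bar>2\<bar> * (\<integral>\<^sup>+t. F (cis (0 + 2 * t)) * indicator {0..<2 * pi} (0 + 2 * t) \<partial>lborel)"
    by (rule nn_integral_real_affine) auto
  also have "(\<integral>\<^sup>+t. F (cis (0 + 2 * t)) * indicator {0..<2 * pi} (0 + 2 * t) \<partial>lborel)
      = (\<integral>\<^sup>+t. F (cis (2 * t)) * indicator {0<..<pi} t \<partial>lborel)"
    using AE_lborel_singleton[of 0]
    by (intro nn_integral_cong_AE) (auto elim!: eventually_mono simp: indicator_def)
  finally have "(\<integral>\<^sup>+z. F z \<partial>circle) = ennreal (1 / (2 * pi)) * (ennreal 2 *
      (\<integral>\<^sup>+t. F (cis (2 * t)) * indicator {0<..<pi} t \<partial>lborel))"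
    by (simp add: nn_integral_circle)
  also have "\<dots> = ennreal (1 / (2 * pi) * 2) * (\<integral>\<^sup>+t. F (cis (2 * t)) * indicator {0<..<pi} t \<partial>lborel)"
    by (subst ennreal_mult) (auto simp: mult.assoc)
  finally show ?thesis by simp
qed

lemma ln_le_if_le_exp:
  fixes x :: real
  assumes "0 < x" "x \<le> exp M" shows "ln x \<le> M"
  using assms by (metis exp_gt_zero ln_exp ln_le_cancel_iff)

text \<open>Since \<open>|B| < |A|\<close>, the function \<open>Ln (1 - (B / A) * u ^ n)\<close> is
  holomorphic on the closed disc, and Cauchy's formula makes its mean over the circle its value 0 at
  the centre. The bound by \<open>exp M\<close> keeps the integrand nonnegative.\<close>

lemma jensen_circle_strict:
  fixes A B :: complex
  assumes "norm B < norm A" "norm A + norm B \<le> exp M" "0 < n"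
  shows "(\<integral>\<^sup>+z. ennreal (M - ln (norm (A - B * z ^ n))) \<partial>circle) = ennreal (M - ln (norm A))"
proof -
  have A: "A \<noteq> 0" using assms by auto
  define b where "b = B / A"
  have b: "norm b < 1" using assms A by (simp add: b_def norm_divide)
  have small: "norm (b * u ^ n) < 1" if "norm u \<le> 1" for u
  proof -
    have "norm (b * u ^ n) \<le> norm b * 1"
      unfolding norm_mult norm_power using that by (intro mult_left_mono power_le_one) auto
    with b show ?thesis by simp
  qed
  have dom: "1 - b * u ^ n \<notin> \<real>\<^sub>\<le>\<^sub>0" if "norm u \<le> 1" for u
  proof
    assume "1 - b * u ^ n \<in> \<real>\<^sub>\<le>\<^sub>0"
    then have "Re (b * u ^ n) \<ge> 1" by (simp add: complex_nonpos_Reals_iff)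
    then show False using small[OF that] abs_Re_le_cmod[of "b * u ^ n"] by linarith
  qed
  define h where "h = (\<lambda>u. Ln (1 - b * u ^ n) + of_real (ln (norm A)))"
  have "h holomorphic_on cball 0 1"
    unfolding h_def by (intro holomorphic_intros) (use dom in auto)
  define h0 where "h0 = h 0"
  from Cauchy_integral_circlepath_simple[OF \<open>h holomorphic_on cball 0 1\<close>, of 0]
  have "((\<lambda>u. h u / u) has_contour_integral (2 * of_real pi * \<i> * h0)) (part_circlepath 0 1 0 (2 * pi))"
    by (simp add: circlepath_def h0_def)
  then have "((\<lambda>t. h (cis t) / cis t * 1 * \<i> * cis t) has_integral (2 * of_real pi * \<i> * h0)) {0..2 * pi}"
    by (subst (asm) has_contour_integral_part_circlepath_iff) auto
  then have "((\<lambda>t. \<i> * h (cis t)) has_integral (2 * of_real pi * \<i> * h0)) {0..2 * pi}"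
    by (simp add: mult_ac)
  from has_integral_mult_right[OF this, of "- \<i>"]
  have "((\<lambda>t. h (cis t)) has_integral (2 * of_real pi * h0)) {0..2 * pi}"
    by (simp add: mult_ac)
  from has_integral_Re[OF this]
  have hI: "((\<lambda>t. Re (h (cis t))) has_integral (2 * pi * Re h0)) {0..2 * pi}"
    by simp
  have "h0 = of_real (ln (norm A))" using assms(3) by (simp add: h0_def h_def power_0_left)
  moreover have "Re (h (cis t)) = ln (norm (A - B * cis t ^ n))" for t
  proof -
    have "1 - b * cis t ^ n \<noteq> 0" using dom[of "cis t"] by auto
    moreover have "A - B * cis t ^ n = A * (1 - b * cis t ^ n)"
      using A by (simp add: b_def algebra_simps)
    ultimately show ?thesis using A by (simp add: h_def norm_mult ln_mult)
  qed
  ultimately have "((\<lambda>t. M - ln (norm (A - B * cis t ^ n))) has_integral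
      (2 * pi) * (M - ln (norm A))) {0..2 * pi}"
    using has_integral_diff[OF has_integral_const_real[of M 0 "2 * pi"] hI]
    by (simp add: algebra_simps)
  moreover have "0 \<le> M - ln (norm (A - B * cis t ^ n))" for t
  proof (cases "A - B * cis t ^ n = 0")
    case True
    have "1 - b * cis t ^ n \<noteq> 0" using dom[of "cis t"] by auto
    then show ?thesis using True A by (simp add: b_def field_simps)
  next
    case False
    have "norm (A - B * cis t ^ n) \<le> norm A + norm (B * cis t ^ n)" by (rule norm_triangle_ineq4)
    also have "\<dots> \<le> exp M" using assms by (simp add: norm_mult norm_power)
    finally have "ln (norm (A - B * cis t ^ n)) \<le> M" using False by (intro ln_le_if_le_exp) auto
    then show ?thesis by simp
  qed
  ultimately have I: "(\<integral>\<^sup>+t. ennreal (M - ln (norm (A - B * cis t ^ n))) * indicator {0..2 * pi} t \<partial>lborel)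
      = ennreal ((2 * pi) * (M - ln (norm A)))"
    by (intro nn_integral_has_integral_lebesgue') auto
  have "(\<integral>\<^sup>+t. ennreal (M - ln (norm (A - B * cis t ^ n))) * indicator {0..<2 * pi} t \<partial>lborel)
      = ennreal ((2 * pi) * (M - ln (norm A)))"
    unfolding I[symmetric] using AE_lborel_singleton[of "2 * pi"]
    by (intro nn_integral_cong_AE) (auto elim!: eventually_mono simp: indicator_def)
  then have "(\<integral>\<^sup>+z. ennreal (M - ln (norm (A - B * z ^ n))) \<partial>circle)
      = ennreal (1 / (2 * pi)) * ennreal ((2 * pi) * (M - ln (norm A)))"
    by (subst nn_integral_circle) auto
  also have "\<dots> = ennreal (1 / (2 * pi) * ((2 * pi) * (M - ln (norm A))))"
    by (rule ennreal_mult'[symmetric]) simp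
  finally show ?thesis by simp
qed

text \<open>On the boundary \<open>|B| = |A|\<close> the strict case is applied to \<open>r B\<close> with \<open>r < 1\<close>;
  \<open>|A - r B z| \<ge> |A - B z| / 2\<close> provides the domination as \<open>r\<close> tends to 1.\<close>

lemma jensen_circle_le:
  fixes A B :: complex
  assumes "norm B \<le> norm A" "A \<noteq> 0" "norm A + norm B \<le> exp M" "0 < n"
  shows "(\<integral>\<^sup>+z. ennreal (M - ln (norm (A - B * z ^ n))) \<partial>circle) = ennreal (M - ln (norm A))"
proof (cases "norm B < norm A")
  case True
  then show ?thesis using assms by (intro jensen_circle_strict)
next
  case False
  then have BA: "norm B = norm A" using assms by simp
  then have B: "B \<noteq> 0" using assms by auto
  define r where "r = (\<lambda>k::nat. 1 - 1 / real (k + 2))"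
  have r: "0 \<le> r k" "r k < 1" for k by (simp_all add: r_def)
  have r_lim: "r \<longlonglongrightarrow> 1" unfolding r_def by real_asymp
  define \<phi> where "\<phi> = (\<lambda>z. ennreal (M - ln (norm (A - B * z ^ n))))"
  define \<phi>k where "\<phi>k = (\<lambda>k z. ennreal (M - ln (norm (A - of_real (r k) * B * z ^ n))))"
  have [measurable]: "\<phi> \<in> borel_measurable borel" "\<phi>k k \<in> borel_measurable borel" for k
    unfolding \<phi>_def \<phi>k_def by measurable
  have int_k: "(\<integral>\<^sup>+z. \<phi>k k z \<partial>circle) = ennreal (M - ln (norm A))" for k
    unfolding \<phi>k_def
  proof (rule jensen_circle_strict)
    have "r k * norm B < 1 * norm B" using r[of k] B by (intro mult_strict_right_mono) auto
    then have "r k * norm B < norm A" using BA by simp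
    then show "norm (of_real (r k) * B) < norm A" using r[of k] by (simp add: norm_mult)
    have "r k * norm B \<le> 1 * norm B" using r[of k] by (intro mult_right_mono) auto
    then show "norm A + norm (of_real (r k) * B) \<le> exp M" using assms r[of k] by (simp add: norm_mult)
  qed (rule assms)
  have ne: "AE z in circle. A - B * z ^ n \<noteq> 0"
  proof -
    define P where "P = [:A:] - monom B n"
    have "coeff P n = - B" using assms(4) by (simp add: P_def coeff_pCons split: nat.split)
    then have "P \<noteq> 0" using B by auto
    then have "AE z in circle. z \<notin> {z. poly P z = 0}"
      by (intro AE_circle_notin_finite poly_roots_finite)
    then show ?thesis by eventually_elim (simp add: P_def poly_monom)
  qed
  have lim: "AE z in circle. (\<lambda>k. \<phi>k k z) \<longlonglongrightarrow> \<phi> z"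
    using ne
  proof eventually_elim
    case (elim z)
    have "(\<lambda>k. M - ln (norm (A - of_real (r k) * B * z ^ n))) \<longlonglongrightarrow> M - ln (norm (A - of_real 1 * B * z ^ n))"
      using elim by (intro tendsto_intros r_lim) auto
    then show ?case unfolding \<phi>k_def \<phi>_def by (intro tendsto_ennrealI) simp
  qed
  \<comment> \<open>Fatou's lemma first yields finiteness of the integral of \<open>\<phi>\<close>,
    which the dominating function \<open>\<phi> + ln 2\<close> requires.\<close>
  have "(\<integral>\<^sup>+z. \<phi> z \<partial>circle) = (\<integral>\<^sup>+z. liminf (\<lambda>k. \<phi>k k z) \<partial>circle)"
  proof (rule nn_integral_cong_AE)
    show "AE z in circle. \<phi> z = liminf (\<lambda>k. \<phi>k k z)"
      using lim by eventually_elim (simp add: lim_imp_Liminf)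
  qed
  also have "\<dots> \<le> liminf (\<lambda>k. \<integral>\<^sup>+z. \<phi>k k z \<partial>circle)"
    by (rule nn_integral_liminf) simp
  also have "\<dots> < \<infinity>" by (simp add: int_k Liminf_const)
  finally have fin: "(\<integral>\<^sup>+z. \<phi> z \<partial>circle) < \<infinity>" .
  have "(\<lambda>k. \<integral>\<^sup>+z. \<phi>k k z \<partial>circle) \<longlonglongrightarrow> (\<integral>\<^sup>+z. \<phi> z \<partial>circle)"
  proof (rule nn_integral_dominated_convergence[where w = "\<lambda>z. \<phi> z + ennreal (ln 2)"])
    show "(\<integral>\<^sup>+z. \<phi> z + ennreal (ln 2) \<partial>circle) < \<infinity>"
      using fin circle.emeasure_space_1 by (subst nn_integral_add) auto
    show "AE z in circle. \<phi>k k z \<le> \<phi> z + ennreal (ln 2)" for k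
      using ne AE_circle_norm
    proof eventually_elim
      case (elim z)
      define u where "u = A - of_real (r k) * B * z ^ n"
      have "norm (A - B * z ^ n) = norm (u - of_real (1 - r k) * B * z ^ n)"
        by (simp add: u_def algebra_simps)
      also have "\<dots> \<le> norm u + norm (of_real (1 - r k) * B * z ^ n)" by (rule norm_triangle_ineq4)
      \<comment> \<open>On the circle \<open>|B z ^ n| = |A|\<close>, so the error term is
        \<open>|A| - |r B z ^ n|\<close>, at most \<open>|u|\<close> by the reverse triangle
        inequality.\<close>
      also have "norm (of_real (1 - r k) * B * z ^ n) = norm A - norm (of_real (r k) * B * z ^ n)"
      proof -
        have "norm (complex_of_real (1 - r k)) = 1 - r k" unfolding norm_of_real using r[of k] by simp
        moreover have "norm (complex_of_real (r k)) = r k" unfolding norm_of_real using r[of k] by simp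
        ultimately show ?thesis using elim BA
          by (simp only: norm_mult norm_power) (simp add: algebra_simps)
      qed
      also have "\<dots> \<le> norm u" unfolding u_def by (rule norm_triangle_ineq2)
      finally have "norm (A - B * z ^ n) \<le> 2 * norm u" by simp
      moreover have "0 < norm (A - B * z ^ n)" using elim by simp
      moreover from calculation have "0 < norm u" by linarith
      ultimately have "ln (norm (A - B * z ^ n)) \<le> ln (2 * norm u)" "0 < norm u"
        by (simp_all only: ln_le_cancel_iff mult_pos_pos zero_less_numeral)
      then have *: "ln (norm (A - B * z ^ n)) \<le> ln 2 + ln (norm u)" by (simp add: ln_mult)
      have "0 \<le> M - ln (norm (A - B * z ^ n))"
      proof -
        have "norm (A - B * z ^ n) \<le> norm A + norm (B * z ^ n)" by (rule norm_triangle_ineq4)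
        also have "\<dots> \<le> exp M" using assms elim by (simp add: norm_mult norm_power)
        finally show ?thesis using elim ln_le_if_le_exp[of "norm (A - B * z ^ n)" M] by simp
      qed
      then have "ennreal (M - ln (norm (A - B * z ^ n))) + ennreal (ln 2)
          = ennreal (M - ln (norm (A - B * z ^ n)) + ln 2)"
        by (intro ennreal_plus[symmetric]) auto
      moreover have "ennreal (M - ln (norm u)) \<le> ennreal (M - ln (norm (A - B * z ^ n)) + ln 2)"
        using * by (intro ennreal_leI) simp
      ultimately show ?case unfolding \<phi>k_def \<phi>_def u_def[symmetric] by (simp only:)
    qed
  qed (use lim in auto)
  then have "(\<integral>\<^sup>+z. \<phi> z \<partial>circle) = ennreal (M - ln (norm A))"
    unfolding int_k using LIMSEQ_unique tendsto_const by blast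
  then show ?thesis by (simp add: \<phi>_def)
qed

text \<open>If \<open>X\<close> is the larger coefficient, conjugating and multiplying by
  \<open>z ^ n\<close>, of modulus 1, moves the power of \<open>z\<close> to the smaller
  one.\<close>

lemma jensen_circle:
  fixes X Y :: complex
  assumes "X \<noteq> 0 \<or> Y \<noteq> 0" "norm X + norm Y \<le> exp M" "0 < n"
  shows "(\<integral>\<^sup>+z. ennreal (M - ln (norm (z ^ n * X - Y))) \<partial>circle)
    = ennreal (M - ln (max (norm X) (norm Y)))"
proof (cases "norm X \<le> norm Y")
  case True
  then have "(\<integral>\<^sup>+z. ennreal (M - ln (norm (Y - X * z ^ n))) \<partial>circle) = ennreal (M - ln (norm Y))"
    using assms by (intro jensen_circle_le) auto
  moreover have "norm (z ^ n * X - Y) = norm (Y - X * z ^ n)" for z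
    by (simp add: norm_minus_commute mult.commute)
  ultimately show ?thesis using True by simp
next
  case False
  then have "(\<integral>\<^sup>+z. ennreal (M - ln (norm (cnj X - cnj Y * z ^ n))) \<partial>circle) = ennreal (M - ln (norm X))"
  proof -
    have "X \<noteq> 0" using False by auto
    then show ?thesis using assms False jensen_circle_le[of "cnj Y" "cnj X" M n] by simp
  qed
  moreover have "(\<integral>\<^sup>+z. ennreal (M - ln (norm (z ^ n * X - Y))) \<partial>circle)
      = (\<integral>\<^sup>+z. ennreal (M - ln (norm (cnj X - cnj Y * z ^ n))) \<partial>circle)"
  proof (rule nn_integral_cong_AE)
    show "AE z in circle. ennreal (M - ln (norm (z ^ n * X - Y)))
        = ennreal (M - ln (norm (cnj X - cnj Y * z ^ n)))"
      using AE_circle_norm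
    proof eventually_elim
      case (elim z)
      have zz: "z ^ n * cnj (z ^ n) = 1"
        unfolding complex_norm_square[symmetric] using elim by (simp add: norm_power)
      have "cnj X - cnj Y * z ^ n = z ^ n * cnj (z ^ n * X - Y)"
        using zz by (simp add: algebra_simps flip: mult.assoc)
      then have "norm (cnj X - cnj Y * z ^ n) = norm (cnj (z ^ n * X - Y))"
        using elim by (simp add: norm_mult norm_power del: complex_cnj_diff)
      then show ?case by (simp only: complex_mod_cnj)
    qed
  qed
  ultimately show ?thesis using False by simp
qed

section \<open>The torus as a product of circles\<close>

lemma measurable_vec_lambda:
  "(\<lambda>z :: 'n::finite \<Rightarrow> complex. \<chi> j. z j) \<in> borel_measurable (\<Pi>\<^sub>M j\<in>UNIV. borel)"
proof (subst borel_measurable_euclidean_space, intro ballI)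
  fix b :: "complex ^ 'n" assume "b \<in> Basis"
  then obtain j c where "b = axis j c" by (auto simp: Basis_vec_def)
  then show "(\<lambda>z. (\<chi> j. z j) \<bullet> b) \<in> borel_measurable (\<Pi>\<^sub>M j\<in>UNIV. borel)"
    by (simp add: inner_axis)
qed

text \<open>The image of normalised Lebesgue measure on the cube is compared with the product
  measure on boxes, where the integral over the cube factors along the axes.\<close>

lemma nn_integral_torus:
  fixes F :: "complex ^ 'n::finite \<Rightarrow> ennreal"
  assumes [measurable]: "F \<in> borel_measurable borel"
  shows "(\<integral>\<^sup>+\<theta>. F (\<chi> j. cis (\<theta> $ j)) * indicator (cbox 0 (\<chi> j. 2 * pi)) \<theta> \<partial>lborel)
    = ennreal ((2 * pi) ^ CARD('n)) * (\<integral>\<^sup>+z. F (\<chi> j. z j) \<partial>(\<Pi>\<^sub>M j\<in>UNIV. circle))"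
proof -
  interpret product_sigma_finite "\<lambda>_::'n. circle"
    by standard
  define c where "c = (2 * pi) ^ CARD('n)"
  define Q where "Q = cbox 0 (\<chi> j::'n. 2 * pi)"
  define P where "P = distr (density lborel (\<lambda>\<theta>::real^'n. ennreal (1 / c) * indicator Q \<theta>))
     (\<Pi>\<^sub>M j\<in>UNIV. circle) (\<lambda>\<theta> j. cis (\<theta> $ j))"
  have [measurable]: "(\<lambda>\<theta>::real^'n. (\<lambda>j. cis (\<theta> $ j))) \<in> measurable borel (\<Pi>\<^sub>M j\<in>UNIV. circle)"
    by (rule measurable_PiM_single') auto
  have [measurable]: "Q \<in> sets borel" by (simp add: Q_def)
  have P: "P = (\<Pi>\<^sub>M j\<in>UNIV. circle)"
  proof (rule PiM_eqI)
    fix A :: "'n \<Rightarrow> complex set" assume A: "\<And>i. i \<in> UNIV \<Longrightarrow> A i \<in> sets circle"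
    then have [measurable]: "A i \<in> sets borel" for i by simp
    have [measurable]: "Pi\<^sub>E UNIV A \<in> sets (\<Pi>\<^sub>M j\<in>UNIV. circle)"
      using A by (intro sets_PiM_I_finite) auto
    \<comment> \<open>The factor belonging to the basis vector \<open>b\<close>;
      \<open>axis_index\<close> recovers the coordinate from it.\<close>
    define f where "f = (\<lambda>(b::real^'n) t::real. indicator {0..2 * pi} t * indicator (A (axis_index b)) (cis t) :: ennreal)"
    have "P (Pi\<^sub>E UNIV A) = (\<integral>\<^sup>+z. indicator (Pi\<^sub>E UNIV A) z \<partial>P)"
      by (simp add: P_def)
    also have "\<dots> = (\<integral>\<^sup>+\<theta>. ennreal (1 / c) * (indicator Q \<theta> * indicator (Pi\<^sub>E UNIV A) (\<lambda>j. cis (\<theta> $ j))) \<partial>lborel)"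
      unfolding P_def
      by (subst nn_integral_distr, simp, simp)
        (subst nn_integral_density, simp, simp, simp add: mult_ac)
    also have "\<dots> = ennreal (1 / c) * (\<integral>\<^sup>+\<theta>. indicator Q \<theta> * indicator (Pi\<^sub>E UNIV A) (\<lambda>j. cis (\<theta> $ j)) \<partial>lborel)"
      by (rule nn_integral_cmult) simp
    also have "(\<lambda>\<theta>. indicator Q \<theta> * indicator (Pi\<^sub>E UNIV A) (\<lambda>j. cis (\<theta> $ j)))
        = (\<lambda>\<theta>::real^'n. \<Prod>b\<in>Basis. f b (\<theta> \<bullet> b))"
    proof
      fix \<theta> :: "real^'n"
      have B: "(Basis :: (real^'n) set) = (\<lambda>j. axis j 1) ` UNIV"
        by (auto simp: Basis_vec_def)
      have "(\<Prod>b\<in>Basis. f b (\<theta> \<bullet> b))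
          = (\<Prod>j\<in>UNIV. indicator {0..2 * pi} (\<theta> $ j) * indicator (A j) (cis (\<theta> $ j)))"
        unfolding B f_def
        by (subst prod.reindex) (auto simp: inj_on_def axis_eq_axis axis_index_axis inner_axis)
      also have "\<dots> = indicator Q \<theta> * indicator (Pi\<^sub>E UNIV A) (\<lambda>j. cis (\<theta> $ j))"
      proof (cases "\<theta> \<in> Q \<and> (\<forall>j. cis (\<theta> $ j) \<in> A j)")
        case True
        then show ?thesis by (auto simp: Q_def mem_box_cart PiE_iff)
      next
        case False
        then obtain j where "\<not> (0 \<le> \<theta> $ j \<and> \<theta> $ j \<le> 2 * pi) \<or> cis (\<theta> $ j) \<notin> A j"
          by (auto simp: Q_def mem_box_cart)
        then have "(\<Prod>j\<in>UNIV. indicator {0..2 * pi} (\<theta> $ j) * indicator (A j) (cis (\<theta> $ j))) = (0 :: ennreal)"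
          by (intro prod_zero bexI[of _ j]) auto
        moreover have "indicator Q \<theta> * indicator (Pi\<^sub>E UNIV A) (\<lambda>j. cis (\<theta> $ j)) = (0 :: ennreal)"
          using False by (auto simp: indicator_def PiE_iff)
        ultimately show ?thesis by (simp only:)
      qed
      finally show "indicator Q \<theta> * indicator (Pi\<^sub>E UNIV A) (\<lambda>j. cis (\<theta> $ j))
          = (\<Prod>b\<in>Basis. f b (\<theta> \<bullet> b))" by simp
    qed
    also have "(\<integral>\<^sup>+\<theta>. (\<Prod>b\<in>Basis. f b (\<theta> \<bullet> b)) \<partial>(lborel :: (real^'n) measure))
        = (\<Prod>b\<in>(Basis :: (real^'n) set). \<integral>\<^sup>+t. f b t \<partial>lborel)"
      unfolding f_def by (rule nn_integral_lborel_prod) measurable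
    also have "\<dots> = (\<Prod>j\<in>UNIV. ennreal (2 * pi) * emeasure circle (A j))"
    proof -
      have B: "(Basis :: (real^'n) set) = (\<lambda>j. axis j 1) ` UNIV"
        by (auto simp: Basis_vec_def)
      have "(\<integral>\<^sup>+t. indicator {0..2 * pi} t * indicator (A j) (cis t) \<partial>lborel)
          = ennreal (2 * pi) * emeasure circle (A j)" for j
      proof -
        have "(\<integral>\<^sup>+t. indicator {0..2 * pi} t * indicator (A j) (cis t) \<partial>lborel)
          = (\<integral>\<^sup>+t. indicator (A j) (cis t) * indicator {0..<2 * pi} t \<partial>lborel)"
          using AE_lborel_singleton[of "2 * pi"]
          by (intro nn_integral_cong_AE) (auto elim!: eventually_mono simp: indicator_def)
        moreover have "emeasure circle (A j) = (\<integral>\<^sup>+z. indicator (A j) z \<partial>circle)" by simp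
        ultimately have "ennreal (2 * pi) * emeasure circle (A j) = ennreal (2 * pi) * (ennreal (1 / (2 * pi)) *
            (\<integral>\<^sup>+t. indicator {0..2 * pi} t * indicator (A j) (cis t) \<partial>lborel))"
          using nn_integral_circle[of "indicator (A j)"] by simp
        also have "\<dots> = ennreal (2 * pi * (1 / (2 * pi))) *
            (\<integral>\<^sup>+t. indicator {0..2 * pi} t * indicator (A j) (cis t) \<partial>lborel)"
          by (subst ennreal_mult) (auto simp: mult.assoc)
        finally show ?thesis by simp
      qed
      then show ?thesis unfolding B f_def
        by (subst prod.reindex) (auto simp: inj_on_def axis_eq_axis axis_index_axis)
    qed
    also have "\<dots> = ennreal c * (\<Prod>j\<in>UNIV. emeasure circle (A j))"
      by (simp add: prod.distrib c_def ennreal_power)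
    also have "ennreal (1 / c) * (ennreal c * (\<Prod>j\<in>UNIV. emeasure circle (A j)))
        = ennreal (1 / c * c) * (\<Prod>j\<in>UNIV. emeasure circle (A j))"
      by (subst ennreal_mult) (auto simp: mult.assoc c_def)
    finally show "P (Pi\<^sub>E UNIV A) = (\<Prod>i\<in>UNIV. emeasure circle (A i))" by (simp add: c_def)
  qed (auto simp: P_def)
  have [measurable]: "(\<lambda>z. F (\<chi> j. z j)) \<in> borel_measurable (\<Pi>\<^sub>M j\<in>UNIV. circle)"
    using measurable_compose[OF measurable_vec_lambda assms]
    by (simp cong: measurable_cong_sets sets_PiM_cong)
  have "(\<integral>\<^sup>+z. F (\<chi> j. z j) \<partial>(\<Pi>\<^sub>M j\<in>UNIV. circle))
      = (\<integral>\<^sup>+\<theta>. ennreal (1 / c) * (F (\<chi> j. cis (\<theta> $ j)) * indicator Q \<theta>) \<partial>lborel)"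
    unfolding P[symmetric] unfolding P_def
    by (subst nn_integral_distr, simp, simp)
      (subst nn_integral_density, simp, simp, simp add: mult_ac)
  also have "\<dots> = ennreal (1 / c) * (\<integral>\<^sup>+\<theta>. F (\<chi> j. cis (\<theta> $ j)) * indicator Q \<theta> \<partial>lborel)"
    by (rule nn_integral_cmult) measurable
  finally have "ennreal c * (\<integral>\<^sup>+z. F (\<chi> j. z j) \<partial>(\<Pi>\<^sub>M j\<in>UNIV. circle))
      = ennreal (c * (1 / c)) * (\<integral>\<^sup>+\<theta>. F (\<chi> j. cis (\<theta> $ j)) * indicator Q \<theta> \<partial>lborel)"
    by (subst ennreal_mult) (auto simp: mult.assoc c_def)
  then show ?thesis by (simp add: c_def Q_def)
qed

section \<open>Reduction to a double integral over the circle\<close>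

lemma measurable_PiM_circle_upd:
  fixes g :: "('i \<Rightarrow> complex) \<Rightarrow> ennreal"
  assumes "g \<in> borel_measurable (Pi\<^sub>M (insert i I) (\<lambda>_. circle))"
  shows "(\<lambda>x. g (x(i := y))) \<in> borel_measurable (Pi\<^sub>M I (\<lambda>_. circle))"
  by (rule measurable_compose[OF measurable_fun_upd[of "insert i I" I i] assms]) auto

lemma nn_integral_PiM_circle_insert:
  fixes g :: "('i \<Rightarrow> complex) \<Rightarrow> ennreal"
  assumes "g \<in> borel_measurable (Pi\<^sub>M (insert i I) (\<lambda>_. circle))" "finite I" "i \<notin> I"
  shows "(\<integral>\<^sup>+x. g x \<partial>Pi\<^sub>M (insert i I) (\<lambda>_. circle))
    = (\<integral>\<^sup>+y. \<integral>\<^sup>+x. g (x(i := y)) \<partial>Pi\<^sub>M I (\<lambda>_. circle) \<partial>circle)"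
proof -
  interpret product_sigma_finite "\<lambda>_::'i. circle" by standard
  show ?thesis by (rule product_nn_integral_insert_rev) (use assms in auto)
qed

text \<open>The order is chosen for the reduction: \<open>z3\<close> and \<open>z6\<close> are
  innermost for the rotation and Jensen's formula, \<open>z5\<close> absorbs a further rotation, and
  nothing then depends on \<open>z4\<close>, \<open>z2\<close>, \<open>z1\<close>.\<close>

lemma nn_integral_PiM_circle_6:
  fixes g :: "(6 \<Rightarrow> complex) \<Rightarrow> ennreal"
  assumes g: "g \<in> borel_measurable (Pi\<^sub>M UNIV (\<lambda>_. circle))"
  shows "(\<integral>\<^sup>+x. g x \<partial>Pi\<^sub>M UNIV (\<lambda>_. circle)) = (\<integral>\<^sup>+z1. \<integral>\<^sup>+z2. \<integral>\<^sup>+z4. \<integral>\<^sup>+z5. \<integral>\<^sup>+z6. \<integral>\<^sup>+z3.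
    g ((\<lambda>_. undefined)(3 := z3, 6 := z6, 5 := z5, 4 := z4, 2 := z2, 1 := z1))
    \<partial>circle \<partial>circle \<partial>circle \<partial>circle \<partial>circle \<partial>circle)"
proof -
  interpret product_sigma_finite "\<lambda>_::6. circle" by standard
  have U: "(UNIV :: 6 set) = {1, 2, 4, 5, 6, 3}" by (auto simp: UNIV_6)
  note m1 = g[unfolded U]
  note m2 = measurable_PiM_circle_upd[OF m1]
  note m3 = measurable_PiM_circle_upd[OF m2]
  note m4 = measurable_PiM_circle_upd[OF m3]
  note m5 = measurable_PiM_circle_upd[OF m4]
  note m6 = measurable_PiM_circle_upd[OF m5]
  have e: "(\<integral>\<^sup>+x. h x \<partial>Pi\<^sub>M {} (\<lambda>_::6. circle)) = h (\<lambda>_. undefined)" for h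
    by (simp add: PiM_empty nn_integral_count_space_finite)
  show ?thesis unfolding U
    by (subst nn_integral_PiM_circle_insert[OF m1], simp, simp,
        subst nn_integral_PiM_circle_insert[OF m2], simp, simp,
        subst nn_integral_PiM_circle_insert[OF m3], simp, simp,
        subst nn_integral_PiM_circle_insert[OF m4], simp, simp,
        subst nn_integral_PiM_circle_insert[OF m5], simp, simp,
        subst nn_integral_PiM_circle_insert[OF m6], simp, simp) (simp only: e)
qed

lemma circle_Fubini:
  assumes "case_prod f \<in> borel_measurable (circle \<Otimes>\<^sub>M circle)"
  shows "(\<integral>\<^sup>+y. \<integral>\<^sup>+x. f x y \<partial>circle \<partial>circle) = (\<integral>\<^sup>+x. \<integral>\<^sup>+y. f x y \<partial>circle \<partial>circle)"
proof -
  interpret pair_sigma_finite circle circle by standard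
  show ?thesis by (rule Fubini'[OF assms])
qed

lemma norm_diff_le_2:
  fixes a b :: complex
  assumes "norm a = 1" "norm b = 1" shows "norm (a - b) \<le> 2"
  using norm_triangle_ineq4[of a b] assms by simp

context
  fixes p q :: nat and M :: real
begin

definition log_defect :: "complex \<Rightarrow> complex \<Rightarrow> complex \<Rightarrow> complex \<Rightarrow> complex \<Rightarrow> complex \<Rightarrow> ennreal" where
  "log_defect z1 z2 z3 z4 z5 z6 = ennreal (M - ln (norm
     ((z3 * z4 - z1 * z6) ^ q - (z2 * z6 - z3 * z5) ^ (q - p) * (z1 * z5 - z2 * z4) ^ p)))"

text \<open>What Jensen's formula leaves of \<open>log_defect\<close>, where \<open>a\<close>,
  \<open>b\<close>, \<open>c\<close> stand for the absolute values of the minors \<open>B\<close>,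
  \<open>A\<close>, \<open>C\<close>.\<close>

definition max_defect :: "real \<Rightarrow> real \<Rightarrow> real \<Rightarrow> ennreal" where
  "max_defect a b c = ennreal (M - ln (max (a ^ q) (b ^ (q - p) * c ^ p)))"

lemma measurable_log_defect [measurable]:
  assumes [measurable]: "f1 \<in> borel_measurable N" "f2 \<in> borel_measurable N" "f3 \<in> borel_measurable N"
    "f4 \<in> borel_measurable N" "f5 \<in> borel_measurable N" "f6 \<in> borel_measurable N"
  shows "(\<lambda>x. log_defect (f1 x) (f2 x) (f3 x) (f4 x) (f5 x) (f6 x)) \<in> borel_measurable N"
  unfolding log_defect_def by measurable

lemma measurable_max_defect [measurable]:
  assumes [measurable]: "f1 \<in> borel_measurable N" "f2 \<in> borel_measurable N" "f3 \<in> borel_measurable N"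
  shows "(\<lambda>x. max_defect (f1 x) (f2 x) (f3 x)) \<in> borel_measurable N"
  unfolding max_defect_def by measurable

context
  assumes pq: "0 < p" "p < q" and M: "M = real (q + 1) * ln 2"
begin

text \<open>After the rotation \<open>z3 \<mapsto> z6 z3\<close> the variable \<open>z6\<close> enters only through a power of it
  in front of one of the two terms, and Jensen's formula applies.\<close>

lemma log_defect_integral_36:
  assumes n: "norm z1 = 1" "norm z2 = 1" "norm z4 = 1" "norm z5 = 1"
  shows "(\<integral>\<^sup>+z6. \<integral>\<^sup>+z3. log_defect z1 z2 z3 z4 z5 z6 \<partial>circle \<partial>circle)
    = (\<integral>\<^sup>+z3. max_defect (norm (z3 * z4 - z1)) (norm (z2 - z3 * z5)) (norm (z1 * z5 - z2 * z4)) \<partial>circle)"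
proof -
  have "(\<integral>\<^sup>+z6. \<integral>\<^sup>+z3. log_defect z1 z2 z3 z4 z5 z6 \<partial>circle \<partial>circle)
      = (\<integral>\<^sup>+z6. \<integral>\<^sup>+z3. log_defect z1 z2 (z6 * z3) z4 z5 z6 \<partial>circle \<partial>circle)"
  proof (rule nn_integral_cong_AE)
    show "AE z6 in circle. (\<integral>\<^sup>+z3. log_defect z1 z2 z3 z4 z5 z6 \<partial>circle)
        = (\<integral>\<^sup>+z3. log_defect z1 z2 (z6 * z3) z4 z5 z6 \<partial>circle)"
      using AE_circle_norm
    proof eventually_elim
      case (elim z6)
      then show ?case
        by (intro nn_integral_circle_rotate[symmetric, of "\<lambda>z3. log_defect z1 z2 z3 z4 z5 z6"]) measurable
    qed
  qed
  also have "\<dots> = (\<integral>\<^sup>+z3. \<integral>\<^sup>+z6. log_defect z1 z2 (z6 * z3) z4 z5 z6 \<partial>circle \<partial>circle)"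
    by (rule circle_Fubini) measurable
  also have "\<dots> = (\<integral>\<^sup>+z3. max_defect (norm (z3 * z4 - z1)) (norm (z2 - z3 * z5)) (norm (z1 * z5 - z2 * z4)) \<partial>circle)"
  proof (rule nn_integral_cong_AE)
    show "AE z3 in circle. (\<integral>\<^sup>+z6. log_defect z1 z2 (z6 * z3) z4 z5 z6 \<partial>circle)
        = max_defect (norm (z3 * z4 - z1)) (norm (z2 - z3 * z5)) (norm (z1 * z5 - z2 * z4))"
      \<comment> \<open>Excluding this point keeps \<open>X\<close> nonzero, so that the two terms
        of Jensen's formula do not both vanish.\<close>
      using AE_circle_norm AE_circle_neq[of "z1 / z4"]
    proof eventually_elim
      case (elim z3)
      define X where "X = (z3 * z4 - z1) ^ q"
      define Y where "Y = (z2 - z3 * z5) ^ (q - p) * (z1 * z5 - z2 * z4) ^ p"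
      have "z4 \<noteq> 0" using n by auto
      then have "X \<noteq> 0" using elim pq by (auto simp: X_def field_simps)
      have "norm X \<le> 2 ^ q"
        unfolding X_def norm_power using n elim
        by (intro power_mono norm_diff_le_2) (auto simp: norm_mult)
      moreover have "norm Y \<le> 2 ^ (q - p) * 2 ^ p"
        unfolding Y_def norm_power norm_mult using n elim
        by (intro mult_mono power_mono norm_diff_le_2) (auto simp: norm_mult)
      moreover have "(2::real) ^ (q - p) * 2 ^ p = 2 ^ q" using pq by (simp flip: power_add)
      \<comment> \<open>Origin of \<open>M\<close>: each of the two terms is bounded by
        \<open>2 ^ q\<close>, as every minor has modulus at most 2.\<close>
      moreover have "exp M = 2 * 2 ^ q"
        by (simp add: M exp_of_nat_mult[symmetric] flip: powr_realpow)
          (simp add: powr_def exp_add distrib_right)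
      ultimately have b: "norm X + norm Y \<le> exp M" by simp
      have "(\<integral>\<^sup>+z6. log_defect z1 z2 (z6 * z3) z4 z5 z6 \<partial>circle)
          = (\<integral>\<^sup>+z6. ennreal (M - ln (norm (z6 ^ p * X - Y))) \<partial>circle)"
      proof (rule nn_integral_cong_AE)
        show "AE z6 in circle. log_defect z1 z2 (z6 * z3) z4 z5 z6
            = ennreal (M - ln (norm (z6 ^ p * X - Y)))"
          using AE_circle_norm
        proof eventually_elim
          case (elim z6)
          have "z6 * z3 * z4 - z1 * z6 = z6 * (z3 * z4 - z1)"
            "z2 * z6 - z6 * z3 * z5 = z6 * (z2 - z3 * z5)" by (simp_all add: algebra_simps)
          then have "(z6 * z3 * z4 - z1 * z6) ^ q
              - (z2 * z6 - z6 * z3 * z5) ^ (q - p) * (z1 * z5 - z2 * z4) ^ p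
            = z6 ^ q * X - z6 ^ (q - p) * Y"
            by (simp only: X_def Y_def power_mult_distrib mult.assoc)
          also have "z6 ^ q = z6 ^ (q - p) * z6 ^ p" using pq by (simp flip: power_add)
          finally have "(z6 * z3 * z4 - z1 * z6) ^ q
              - (z2 * z6 - z6 * z3 * z5) ^ (q - p) * (z1 * z5 - z2 * z4) ^ p
            = z6 ^ (q - p) * (z6 ^ p * X - Y)"
            by (simp only: right_diff_distrib mult.assoc)
          then show ?case using elim by (simp add: log_defect_def norm_mult norm_power)
        qed
      qed
      also have "\<dots> = ennreal (M - ln (max (norm X) (norm Y)))"
        using \<open>X \<noteq> 0\<close> b pq by (intro jensen_circle) auto
      finally show ?case by (simp add: max_defect_def X_def Y_def norm_mult norm_power)
    qed
  qed
  finally show ?thesis .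
qed

text \<open>Substitution of \<open>(z1 / z4) * z\<close> for \<open>z3\<close>, with the conjugate
  as reciprocal of \<open>z4\<close> on the circle.\<close>

lemma max_defect_integral_3:
  assumes n: "norm z1 = 1" "norm z2 = 1" "norm z4 = 1" "norm z5 = 1"
  shows "(\<integral>\<^sup>+z3. max_defect (norm (z3 * z4 - z1)) (norm (z2 - z3 * z5)) c \<partial>circle)
    = (\<integral>\<^sup>+z. max_defect (norm (z - 1)) (norm (z2 - z1 * cnj z4 * z5 * z)) c \<partial>circle)"
proof -
  have z4: "z4 * cnj z4 = 1" using n by (simp add: complex_norm_square[symmetric])
  have "norm (z1 * cnj z4) = 1" using n by (simp add: norm_mult)
  then have "(\<integral>\<^sup>+z3. max_defect (norm (z3 * z4 - z1)) (norm (z2 - z3 * z5)) c \<partial>circle)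
      = (\<integral>\<^sup>+z. max_defect (norm (z1 * cnj z4 * z * z4 - z1)) (norm (z2 - z1 * cnj z4 * z * z5)) c \<partial>circle)"
    by (intro nn_integral_circle_rotate[symmetric,
          of "\<lambda>z3. max_defect (norm (z3 * z4 - z1)) (norm (z2 - z3 * z5)) c"]) measurable
  also have "\<dots> = (\<integral>\<^sup>+z. max_defect (norm (z - 1)) (norm (z2 - z1 * cnj z4 * z5 * z)) c \<partial>circle)"
  proof (intro nn_integral_cong arg_cong2[where f = "\<lambda>a b. max_defect a b c"])
    fix z
    have "z1 * cnj z4 * z * z4 - z1 = z1 * ((z4 * cnj z4) * z - 1)" by (simp add: algebra_simps)
    then show "norm (z1 * cnj z4 * z * z4 - z1) = norm (z - 1)" using n by (simp add: z4 norm_mult)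
  qed (simp add: mult_ac)
  finally show ?thesis .
qed

text \<open>Substitution of \<open>(z2 * z4 / z1) * w\<close> for \<open>z5\<close>, after which
  \<open>z1\<close>, \<open>z2\<close>, \<open>z4\<close> enter only through factors of modulus
  1.\<close>

lemma max_defect_integral_5:
  assumes n: "norm z1 = 1" "norm z2 = 1" "norm z4 = 1"
  shows "(\<integral>\<^sup>+z5. \<integral>\<^sup>+z. max_defect (norm (z - 1)) (norm (z2 - z1 * cnj z4 * z5 * z))
      (norm (z1 * z5 - z2 * z4)) \<partial>circle \<partial>circle)
    = (\<integral>\<^sup>+w. \<integral>\<^sup>+z. max_defect (norm (z - 1)) (norm (1 - w * z)) (norm (w - 1)) \<partial>circle \<partial>circle)"
proof -
  have u: "z1 * cnj z1 = 1" "z4 * cnj z4 = 1"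
    using n by (simp_all add: complex_norm_square[symmetric])
  define c where "c = z2 * z4 * cnj z1"
  define H where "H = (\<lambda>z5. \<integral>\<^sup>+z. max_defect (norm (z - 1)) (norm (z2 - z1 * cnj z4 * z5 * z))
      (norm (z1 * z5 - z2 * z4)) \<partial>circle)"
  have [measurable]: "H \<in> borel_measurable borel" unfolding H_def by measurable
  have "norm c = 1" using n by (simp add: norm_mult c_def)
  then have "(\<integral>\<^sup>+z5. H z5 \<partial>circle) = (\<integral>\<^sup>+w. H (c * w) \<partial>circle)"
    by (intro nn_integral_circle_rotate[symmetric]) measurable
  also have "\<dots> = (\<integral>\<^sup>+w. \<integral>\<^sup>+z. max_defect (norm (z - 1)) (norm (1 - w * z)) (norm (w - 1)) \<partial>circle \<partial>circle)"
    unfolding H_def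
  proof (intro nn_integral_cong arg_cong2[where f = "max_defect _"])
    fix w z
    have "z2 - z1 * cnj z4 * (c * w) * z = z2 * (1 - (z1 * cnj z1) * (z4 * cnj z4) * w * z)"
      by (simp add: c_def algebra_simps)
    then show "norm (z2 - z1 * cnj z4 * (c * w) * z) = norm (1 - w * z)"
      using n by (simp add: u norm_mult)
    have "z1 * (c * w) - z2 * z4 = z2 * z4 * ((z1 * cnj z1) * w - 1)"
      by (simp add: c_def algebra_simps)
    then show "norm (z1 * (c * w) - z2 * z4) = norm (w - 1)"
      using n by (simp add: u norm_mult)
  qed
  finally show ?thesis by (simp add: H_def)
qed

lemma log_defect_integral:
  "(\<integral>\<^sup>+z1. \<integral>\<^sup>+z2. \<integral>\<^sup>+z4. \<integral>\<^sup>+z5. \<integral>\<^sup>+z6. \<integral>\<^sup>+z3. log_defect z1 z2 z3 z4 z5 z6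
      \<partial>circle \<partial>circle \<partial>circle \<partial>circle \<partial>circle \<partial>circle)
    = (\<integral>\<^sup>+w. \<integral>\<^sup>+z. max_defect (norm (z - 1)) (norm (1 - w * z)) (norm (w - 1)) \<partial>circle \<partial>circle)"
    (is "_ = ?R")
proof -
  have i4: "(\<integral>\<^sup>+z5. \<integral>\<^sup>+z6. \<integral>\<^sup>+z3. log_defect z1 z2 z3 z4 z5 z6 \<partial>circle \<partial>circle \<partial>circle) = ?R"
    if n: "norm z1 = 1" "norm z2 = 1" "norm z4 = 1" for z1 z2 z4
  proof -
    have "(\<integral>\<^sup>+z5. \<integral>\<^sup>+z6. \<integral>\<^sup>+z3. log_defect z1 z2 z3 z4 z5 z6 \<partial>circle \<partial>circle \<partial>circle)
      = (\<integral>\<^sup>+z5. \<integral>\<^sup>+z. max_defect (norm (z - 1)) (norm (z2 - z1 * cnj z4 * z5 * z))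
        (norm (z1 * z5 - z2 * z4)) \<partial>circle \<partial>circle)"
      by (rule nn_integral_cong_AE, rule eventually_mono[OF AE_circle_norm])
        (use n in \<open>simp add: log_defect_integral_36 max_defect_integral_3\<close>)
    also have "\<dots> = ?R" by (rule max_defect_integral_5[OF n])
    finally show ?thesis .
  qed
  have const: "(\<integral>\<^sup>+z. F z \<partial>circle) = c" if "\<And>z. norm z = 1 \<Longrightarrow> F z = c" for F c
  proof -
    have "(\<integral>\<^sup>+z. F z \<partial>circle) = (\<integral>\<^sup>+z. c \<partial>circle)"
      by (intro nn_integral_cong_AE eventually_mono[OF AE_circle_norm]) (simp add: that)
    then show ?thesis using circle.emeasure_space_1 by simp
  qed
  show ?thesis by (intro const i4)
qed

lemma nn_integral_trinomial_resultant:
  "(\<integral>\<^sup>+z. ennreal (M - ln (norm (trinomial_resultant p q z))) \<partial>(\<Pi>\<^sub>M j\<in>UNIV. circle))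
    = (\<integral>\<^sup>+w. \<integral>\<^sup>+z. max_defect (norm (z - 1)) (norm (1 - w * z)) (norm (w - 1)) \<partial>circle \<partial>circle)"
proof -
  have "(\<lambda>z. ennreal (M - ln (norm (trinomial_resultant p q z))))
      \<in> borel_measurable (\<Pi>\<^sub>M j\<in>UNIV. circle)"
    unfolding trinomial_resultant_def by measurable
  then show ?thesis
    by (subst nn_integral_PiM_circle_6)
      (auto simp: log_defect_integral[symmetric] log_defect_def trinomial_resultant_def)
qed

end

end

section \<open>The angular integrals\<close>

text \<open>Substitution on compact intervals \<open>{- n..n}\<close>, followed by monotone
  convergence on both sides.\<close>

lemma nn_integral_arctan_substitution:
  fixes f :: "real \<Rightarrow> real"
  assumes [measurable]: "f \<in> borel_measurable borel"
  shows "(\<integral>\<^sup>+x. ennreal (f x) * indicator {- pi / 2<..<pi / 2} x \<partial>lborel)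
    = (\<integral>\<^sup>+y. ennreal (f (arctan y) / (1 + y\<^sup>2)) \<partial>lborel)"
proof -
  have step: "(\<integral>\<^sup>+x. ennreal (f x) * indicator {arctan (- real n)..arctan (real n)} x \<partial>lborel)
      = (\<integral>\<^sup>+y. ennreal (f (arctan y) / (1 + y\<^sup>2)) * indicator {- real n..real n} y \<partial>lborel)" for n
  proof -
    have i: "ennreal r * indicator A x = ennreal (r * indicator A x)" for r and A :: "real set" and x
      by (auto simp: indicator_def)
    have c: "continuous_on {- real n..real n} (\<lambda>y. 1 / (1 + y\<^sup>2))"
      by (intro continuous_intros) (auto simp: add_nonneg_eq_0_iff)
    have d: "(arctan has_real_derivative 1 / (1 + x\<^sup>2)) (at x)" for x
      using DERIV_arctan[of x] by (simp add: divide_inverse)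
    have m: "set_borel_measurable borel {arctan (- real n)..arctan (real n)} f"
      by (simp add: set_borel_measurable_def)
    show ?thesis unfolding i
      using nn_integral_substitution[OF m d c] by simp
  qed
  have a: "arctan (- real n) \<le> arctan (- real m)" "arctan (real m) \<le> arctan (real n)" if "m \<le> n" for m n
    using that by (auto intro: arctan_monotone')
  have 1: "(\<integral>\<^sup>+x. ennreal (f x) * indicator {- pi / 2<..<pi / 2} x \<partial>lborel)
      = (SUP n. \<integral>\<^sup>+x. ennreal (f x) * indicator {arctan (- real n)..arctan (real n)} x \<partial>lborel)"
  proof (subst nn_integral_monotone_convergence_SUP[symmetric])
    show "incseq (\<lambda>n x. ennreal (f x) * indicator {arctan (- real n)..arctan (real n)} x)"
    proof (intro incseq_def[THEN iffD2] allI impI le_funI mult_left_mono)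
      fix m n :: nat and x assume "m \<le> n"
      have "{arctan (- real m)..arctan (real m)} \<subseteq> {arctan (- real n)..arctan (real n)}"
        using a[OF \<open>m \<le> n\<close>] by simp
      then show "indicator {arctan (- real m)..arctan (real m)} x
          \<le> (indicator {arctan (- real n)..arctan (real n)} x :: ennreal)"
        by (auto simp: indicator_def)
    qed simp
    show "(\<integral>\<^sup>+x. ennreal (f x) * indicator {- pi / 2<..<pi / 2} x \<partial>lborel)
      = (\<integral>\<^sup>+x. (SUP n. ennreal (f x) * indicator {arctan (- real n)..arctan (real n)} x) \<partial>lborel)"
    proof (rule nn_integral_cong)
      fix x
      show "ennreal (f x) * indicator {- pi / 2<..<pi / 2} x
        = (SUP n. ennreal (f x) * indicator {arctan (- real n)..arctan (real n)} x)"
      proof (cases "x \<in> {- pi / 2<..<pi / 2}")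
        case True
        obtain n :: nat where n: "\<bar>tan x\<bar> \<le> real n" using real_arch_simple by blast
        have "arctan (tan x) = x" using True by (intro arctan_tan) auto
        moreover have "arctan (- real n) \<le> arctan (tan x)" "arctan (tan x) \<le> arctan (real n)"
          using n by (auto intro!: arctan_monotone')
        ultimately have "x \<in> {arctan (- real n)..arctan (real n)}" by simp
        then have "ennreal (f x) \<le> (SUP n. ennreal (f x) * indicator {arctan (- real n)..arctan (real n)} x)"
          by (intro SUP_upper2[of n]) auto
        moreover have "(SUP n. ennreal (f x) * indicator {arctan (- real n)..arctan (real n)} x) \<le> ennreal (f x)"
          by (intro SUP_least) (auto simp: indicator_def)
        ultimately show ?thesis using True by simp
      next
        case False
        have "x \<notin> {arctan (- real n)..arctan (real n)}" for n
        proof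
          assume "x \<in> {arctan (- real n)..arctan (real n)}"
          then have "- (pi / 2) < x" "x < pi / 2"
            using arctan_lbound[of "- real n"] arctan_ubound[of "real n"]
            by (simp_all only: atLeastAtMost_iff) linarith+
          with False show False by simp
        qed
        then have "indicator {arctan (- real n)..arctan (real n)} x = (0::ennreal)" for n by simp
        then show ?thesis using False by simp
      qed
    qed
  qed simp
  have 2: "(\<integral>\<^sup>+y. ennreal (f (arctan y) / (1 + y\<^sup>2)) \<partial>lborel)
      = (SUP n. \<integral>\<^sup>+y. ennreal (f (arctan y) / (1 + y\<^sup>2)) * indicator {- real n..real n} y \<partial>lborel)"
  proof (subst nn_integral_monotone_convergence_SUP[symmetric])
    show "incseq (\<lambda>n y. ennreal (f (arctan y) / (1 + y\<^sup>2)) * indicator {- real n..real n} y)"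
      by (auto simp: incseq_def le_fun_def indicator_def)
    show "(\<integral>\<^sup>+y. ennreal (f (arctan y) / (1 + y\<^sup>2)) \<partial>lborel)
      = (\<integral>\<^sup>+y. (SUP n. ennreal (f (arctan y) / (1 + y\<^sup>2)) * indicator {- real n..real n} y) \<partial>lborel)"
    proof (rule nn_integral_cong)
      fix y :: real
      obtain n :: nat where n: "\<bar>y\<bar> \<le> real n" using real_arch_simple by blast
      show "ennreal (f (arctan y) / (1 + y\<^sup>2))
        = (SUP n. ennreal (f (arctan y) / (1 + y\<^sup>2)) * indicator {- real n..real n} y)"
      proof (rule antisym)
        show "ennreal (f (arctan y) / (1 + y\<^sup>2))
          \<le> (SUP n. ennreal (f (arctan y) / (1 + y\<^sup>2)) * indicator {- real n..real n} y)"
          using n by (intro SUP_upper2[of n]) (auto simp: indicator_def abs_le_iff)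
      qed (auto intro!: SUP_least simp: indicator_def)
    qed
  qed simp
  show ?thesis unfolding 1 2 step ..
qed

text \<open>The new variable is \<open>X = c + s * cot x\<close>. For
  \<open>c = cos \<gamma>\<close> and \<open>s = sin \<gamma>\<close> this is
  \<open>sin (\<gamma> + x) / sin x\<close>, by the law of sines a ratio of sides of an inscribed
  triangle.\<close>

lemma nn_integral_cot_substitution:
  fixes f :: "real \<Rightarrow> real"
  assumes [measurable]: "f \<in> borel_measurable borel" and s: "0 < s"
  shows "(\<integral>\<^sup>+x. ennreal (f x) * indicator {0<..<pi} x \<partial>lborel)
    = (\<integral>\<^sup>+X. ennreal (f (pi / 2 - arctan ((X - c) / s)) * (s / (s\<^sup>2 + (X - c)\<^sup>2))) \<partial>lborel)"
proof -
  have "(\<integral>\<^sup>+x. ennreal (f x) * indicator {0<..<pi} x \<partial>lborel)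
      = ennreal \<bar>- 1\<bar> * (\<integral>\<^sup>+x. ennreal (f (pi / 2 + - 1 * x)) * indicator {0<..<pi} (pi / 2 + - 1 * x) \<partial>lborel)"
    by (rule nn_integral_real_affine) auto
  also have "\<dots> = (\<integral>\<^sup>+x. ennreal (f (pi / 2 - x)) * indicator {- pi / 2<..<pi / 2} x \<partial>lborel)"
    by (simp, intro nn_integral_cong) (auto simp: indicator_def)
  also have "\<dots> = (\<integral>\<^sup>+y. ennreal (f (pi / 2 - arctan y) / (1 + y\<^sup>2)) \<partial>lborel)"
    by (rule nn_integral_arctan_substitution) simp
  also have "\<dots> = ennreal \<bar>1 / s\<bar> * (\<integral>\<^sup>+X. ennreal (f (pi / 2 - arctan (- c / s + 1 / s * X))
      / (1 + (- c / s + 1 / s * X)\<^sup>2)) \<partial>lborel)"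
    by (rule nn_integral_real_affine) (use s in auto)
  also have "\<dots> = (\<integral>\<^sup>+X. ennreal (1 / s) * ennreal (f (pi / 2 - arctan (- c / s + 1 / s * X))
      / (1 + (- c / s + 1 / s * X)\<^sup>2)) \<partial>lborel)"
    using s by (subst nn_integral_cmult) auto
  also have "\<dots> = (\<integral>\<^sup>+X. ennreal (f (pi / 2 - arctan ((X - c) / s)) * (s / (s\<^sup>2 + (X - c)\<^sup>2))) \<partial>lborel)"
  proof (rule nn_integral_cong)
    fix X
    have y: "- c / s + 1 / s * X = (X - c) / s" by (simp add: diff_divide_distrib)
    have "1 / s * (r / (1 + ((X - c) / s)\<^sup>2)) = r * (s / (s\<^sup>2 + (X - c)\<^sup>2))" for r
    proof -
      have "1 + ((X - c) / s)\<^sup>2 = (s\<^sup>2 + (X - c)\<^sup>2) / s\<^sup>2"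
        using s by (simp add: power_divide add_divide_distrib)
      then show ?thesis using s by (simp add: power2_eq_square)
    qed
    then show "ennreal (1 / s) * ennreal (f (pi / 2 - arctan (- c / s + 1 / s * X))
          / (1 + (- c / s + 1 / s * X)\<^sup>2))
        = ennreal (f (pi / 2 - arctan ((X - c) / s)) * (s / (s\<^sup>2 + (X - c)\<^sup>2)))"
      unfolding y using s by (simp add: ennreal_mult'[symmetric])
  qed
  finally show ?thesis .
qed

lemma norm_cis_double_minus_1: "norm (cis (2 * t) - 1) = 2 * \<bar>sin t\<bar>"
proof -
  have "norm (cis (2 * t) - 1) ^ 2 = (cos (2 * t) - 1) ^ 2 + sin (2 * t) ^ 2"
    by (simp add: cmod_power2)
  also have "\<dots> = 2 - 2 * cos (2 * t)"
    using sin_cos_squared_add[of "2 * t"] by (simp add: power2_eq_square algebra_simps)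
  also have "\<dots> = (2 * \<bar>sin t\<bar>) ^ 2" by (simp add: cos_double_sin power_mult_distrib)
  finally show ?thesis by (rule power2_eq_imp_eq) auto
qed

text \<open>The squared positive part is differentiable even at 0, so a single primitive works
  across the sign change of the logarithmic expression.\<close>

lemma DERIV_positive_part_square:
  "((\<lambda>x. (max 0 x)\<^sup>2) has_real_derivative 2 * max 0 x) (at (x::real))"
proof -
  consider "x > 0" | "x < 0" | "x = 0" by linarith
  then show ?thesis
  proof cases
    case 1
    have "eventually (\<lambda>y. y \<in> {0<..}) (nhds x)" using 1 by (intro eventually_nhds_in_open) auto
    then have "eventually (\<lambda>y. (max 0 y)\<^sup>2 = y\<^sup>2) (nhds x)" by eventually_elim auto
    moreover have "((\<lambda>x. x\<^sup>2) has_real_derivative 2 * max 0 x) (at x)"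
      using 1 by (auto intro!: derivative_eq_intros)
    ultimately show ?thesis by (subst DERIV_cong_ev[OF refl _ refl])
  next
    case 2
    have "eventually (\<lambda>y. y \<in> {..<0}) (nhds x)" using 2 by (intro eventually_nhds_in_open) auto
    then have "eventually (\<lambda>y. (max 0 y)\<^sup>2 = 0) (nhds x)" by eventually_elim auto
    moreover have "((\<lambda>x. 0) has_real_derivative 2 * max 0 x) (at x)" using 2 by simp
    ultimately show ?thesis by (subst DERIV_cong_ev[OF refl _ refl])
  next
    case 3
    have "((\<lambda>h. (max 0 h)\<^sup>2 / h) \<longlongrightarrow> (0::real)) (at 0)"
    proof (rule Lim_null_comparison)
      show "((\<lambda>h::real. \<bar>h\<bar>) \<longlongrightarrow> 0) (at 0)" by (intro tendsto_eq_intros) auto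
      show "eventually (\<lambda>h. norm ((max 0 h)\<^sup>2 / h) \<le> \<bar>h\<bar>) (at (0::real))"
        by (intro always_eventually) (auto simp: max_def power2_eq_square)
    qed
    then show ?thesis using 3 by (simp add: has_field_derivative_iff)
  qed
qed

section \<open>From points on the circle to ratios of side lengths\<close>

context
  fixes a p :: real
begin

text \<open>For \<open>a = q - p\<close> this is \<open>ln (max A B) - ln A\<close>, where
  \<open>A\<close> and \<open>B\<close> are the two terms compared in
  \<open>max_defect\<close>.\<close>

definition "excess w z = max 0 (a * ln (norm (1 - w * z)) + p * ln (norm (w - 1))
  - (a + p) * ln (norm (z - 1)))" for w z :: complex

text \<open>The law of cosines: the squared side opposite the angle \<open>\<gamma>\<close> in a
  triangle with adjacent sides 1 and \<open>X\<close>.\<close>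

definition "quad \<gamma> X = 1 - 2 * X * cos \<gamma> + X\<^sup>2" for \<gamma> X :: real

text \<open>The factor \<open>sin \<gamma> / quad \<gamma> X\<close> is the Jacobian of the
  cotangent substitution. \<open>X\<close> is a signed ratio, negative once the two half angles add
  up to more than pi, hence the absolute value.\<close>

definition "angle_kernel \<gamma> X = max 0 (a * ln \<bar>X\<bar> + p / 2 * ln (quad \<gamma> X)) * (sin \<gamma> / quad \<gamma> X)"
  for \<gamma> X :: real

text \<open>The boundary terms of the integration over the angle: at pi and at 0 the third side
  takes its extreme lengths \<open>|X + 1|\<close> and \<open>|X - 1|\<close>.\<close>

definition "profile X = ((max 0 (a * ln \<bar>X\<bar> + p * ln \<bar>X + 1\<bar>))\<^sup>2
  - (max 0 (a * ln \<bar>X\<bar> + p * ln \<bar>X - 1\<bar>))\<^sup>2) / (2 * p * X)" for X :: real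

lemma measurable_excess [measurable]:
  assumes [measurable]: "f \<in> borel_measurable N" "g \<in> borel_measurable N"
  shows "(\<lambda>x. excess (f x) (g x)) \<in> borel_measurable N"
  unfolding excess_def by measurable

lemma measurable_angle_kernel [measurable]:
  assumes [measurable]: "f \<in> borel_measurable N" "g \<in> borel_measurable N"
  shows "(\<lambda>x. angle_kernel (f x) (g x)) \<in> borel_measurable N"
  unfolding angle_kernel_def quad_def by measurable

lemma measurable_profile [measurable]: "profile \<in> borel_measurable borel"
  unfolding profile_def[abs_def] by measurable

lemma quad_altdef: "quad \<gamma> X = (sin \<gamma>)\<^sup>2 + (X - cos \<gamma>)\<^sup>2"
  using sin_cos_squared_add[of \<gamma>] by (simp add: quad_def power2_eq_square algebra_simps)

lemma quad_pos: "sin \<gamma> \<noteq> 0 \<Longrightarrow> 0 < quad \<gamma> X"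
  unfolding quad_altdef by (simp add: add_pos_nonneg)

context
  assumes a: "0 < a" and p: "0 < p"
begin

text \<open>In the new variable the chord ratios are \<open>|X|\<close> and the square root of
  \<open>quad \<gamma> X\<close>. The common terms \<open>ln 2\<close> and
  \<open>ln (sin \<sigma>)\<close> combine because the coefficients \<open>a\<close>,
  \<open>p\<close>, \<open>- (a + p)\<close> sum to zero.\<close>

lemma excess_angle_integral:
  assumes g: "0 < \<gamma>" "\<gamma> < pi"
  shows "(\<integral>\<^sup>+\<sigma>. ennreal (excess (cis (2 * \<gamma>)) (cis (2 * \<sigma>))) * indicator {0<..<pi} \<sigma> \<partial>lborel)
    = (\<integral>\<^sup>+X. ennreal (angle_kernel \<gamma> X) \<partial>lborel)"
proof -
  define s where "s = sin \<gamma>"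
  have s: "0 < s" using g by (simp add: s_def sin_gt_zero)
  have "(\<integral>\<^sup>+\<sigma>. ennreal (excess (cis (2 * \<gamma>)) (cis (2 * \<sigma>))) * indicator {0<..<pi} \<sigma> \<partial>lborel)
      = (\<integral>\<^sup>+X. ennreal (excess (cis (2 * \<gamma>)) (cis (2 * (pi / 2 - arctan ((X - cos \<gamma>) / s))))
          * (s / (s\<^sup>2 + (X - cos \<gamma>)\<^sup>2))) \<partial>lborel)"
    by (rule nn_integral_cot_substitution) (use s in auto)
  also have "\<dots> = (\<integral>\<^sup>+X. ennreal (angle_kernel \<gamma> X) \<partial>lborel)"
  proof (rule nn_integral_cong_AE)
    show "AE X in lborel. ennreal (excess (cis (2 * \<gamma>)) (cis (2 * (pi / 2 - arctan ((X - cos \<gamma>) / s))))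
          * (s / (s\<^sup>2 + (X - cos \<gamma>)\<^sup>2))) = ennreal (angle_kernel \<gamma> X)"
      using AE_lborel_singleton[of 0]
    proof eventually_elim
      case (elim X)
      define y where "y = (X - cos \<gamma>) / s"
      define \<sigma> where "\<sigma> = pi / 2 - arctan y"
      define W where "W = quad \<gamma> X"
      have W: "0 < W" using s by (simp add: W_def s_def quad_pos)
      have W': "W = s\<^sup>2 + (X - cos \<gamma>)\<^sup>2" by (simp add: W_def s_def quad_altdef)
      have sin\<sigma>: "sin \<sigma> = cos (arctan y)" by (simp add: \<sigma>_def sin_diff)
      have cos\<sigma>: "cos \<sigma> = y * sin \<sigma>"
        by (simp add: \<sigma>_def cos_diff sin_diff sin_arctan cos_arctan)
      have pos: "0 < sin \<sigma>" unfolding sin\<sigma> by (simp add: cos_arctan add_pos_nonneg)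
      have "1 + y\<^sup>2 = W / s\<^sup>2"
        using s by (simp add: W' y_def power_divide add_divide_distrib)
      then have sq: "(sin \<sigma>)\<^sup>2 = s\<^sup>2 / W"
        unfolding sin\<sigma> cos_arctan using W s by (simp add: power_divide)
      have "sin (\<gamma> + \<sigma>) = sin \<sigma> * (cos \<gamma> + s * y)"
        by (simp add: sin_add cos\<sigma> s_def algebra_simps)
      also have "cos \<gamma> + s * y = X" using s by (simp add: y_def)
      finally have sX: "sin (\<gamma> + \<sigma>) = sin \<sigma> * X" .
      have "cis (2 * \<gamma>) * cis (2 * \<sigma>) = cis (2 * (\<gamma> + \<sigma>))" by (simp add: cis_mult algebra_simps)
      then have n1: "norm (1 - cis (2 * \<gamma>) * cis (2 * \<sigma>)) = 2 * (sin \<sigma> * \<bar>X\<bar>)"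
        using norm_cis_double_minus_1[of "\<gamma> + \<sigma>"] pos
        by (simp add: norm_minus_commute sX abs_mult)
      have "ln ((sin \<sigma>)\<^sup>2) = ln (s\<^sup>2 / W)" by (simp only: sq)
      then have lns: "2 * ln (sin \<sigma>) = 2 * ln s - ln W"
        using s W pos by (simp add: ln_div ln_realpow)
      have "a * ln (norm (1 - cis (2 * \<gamma>) * cis (2 * \<sigma>))) + p * ln (norm (cis (2 * \<gamma>) - 1))
          - (a + p) * ln (norm (cis (2 * \<sigma>) - 1))
        = a * (ln 2 + (ln (sin \<sigma>) + ln \<bar>X\<bar>)) + p * (ln 2 + ln s) - (a + p) * (ln 2 + ln (sin \<sigma>))"
        unfolding n1 norm_cis_double_minus_1 using pos s elim
        by (simp add: ln_mult s_def[symmetric])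
      also have "\<dots> = a * ln \<bar>X\<bar> + p / 2 * (2 * ln s - 2 * ln (sin \<sigma>))" by (simp add: algebra_simps)
      also have "\<dots> = a * ln \<bar>X\<bar> + p / 2 * ln W" unfolding lns by simp
      finally have "excess (cis (2 * \<gamma>)) (cis (2 * \<sigma>)) = max 0 (a * ln \<bar>X\<bar> + p / 2 * ln W)"
        unfolding excess_def by simp
      then show ?case
        unfolding angle_kernel_def W_def[symmetric] s_def[symmetric] W'[symmetric] y_def[symmetric] \<sigma>_def[symmetric]
        by simp
    qed
  qed
  finally show ?thesis .
qed

text \<open>For fixed \<open>X\<close> the logarithmic expression has
  \<open>\<gamma>\<close>-derivative \<open>p * X * sin \<gamma> / quad \<gamma> X\<close>, so the
  kernel is the derivative of its squared positive part divided by \<open>2 * p * X\<close>. The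
  excluded \<open>X\<close> are those where this division or a logarithm at an end breaks
  down.\<close>

lemma angle_kernel_integral:
  assumes X: "X \<noteq> 0" "X \<noteq> 1" "X \<noteq> - 1"
  shows "(\<integral>\<^sup>+\<gamma>. ennreal (angle_kernel \<gamma> X) * indicator {0<..<pi} \<gamma> \<partial>lborel) = ennreal (profile X)"
proof -
  have W: "0 < quad \<gamma> X" for \<gamma>
  proof (cases "sin \<gamma> = 0")
    case True
    then have "(cos \<gamma>)\<^sup>2 = 1" using sin_cos_squared_add[of \<gamma>] by simp
    then have "cos \<gamma> = 1 \<or> cos \<gamma> = - 1" by (simp add: power2_eq_1_iff)
    then show ?thesis using X True unfolding quad_altdef by auto
  qed (rule quad_pos)
  define m where "m = (\<lambda>\<gamma>. a * ln \<bar>X\<bar> + p / 2 * ln (quad \<gamma> X))"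
  define F where "F = (\<lambda>\<gamma>. (max 0 (m \<gamma>))\<^sup>2 / (2 * p * X))"
  have dm: "(m has_real_derivative p / 2 * (2 * X * sin \<gamma> / quad \<gamma> X)) (at \<gamma>)" for \<gamma>
  proof -
    have "((\<lambda>\<gamma>. quad \<gamma> X) has_real_derivative 2 * X * sin \<gamma>) (at \<gamma>)"
      unfolding quad_def by (auto intro!: derivative_eq_intros)
    from DERIV_chain2[OF DERIV_ln_divide[OF W] this]
    have "((\<lambda>\<gamma>. ln (quad \<gamma> X)) has_real_derivative 2 * X * sin \<gamma> / quad \<gamma> X) (at \<gamma>)" by simp
    from DERIV_add[OF DERIV_const DERIV_cmult[OF this, of "p / 2"], of "a * ln \<bar>X\<bar>"]
    show ?thesis by (simp add: m_def)
  qed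
  have dF: "(F has_real_derivative angle_kernel \<gamma> X) (at \<gamma>)" for \<gamma>
  proof -
    have "(F has_real_derivative 2 * max 0 (m \<gamma>) * (p / 2 * (2 * X * sin \<gamma> / quad \<gamma> X)) / (2 * p * X)) (at \<gamma>)"
      unfolding F_def
      by (rule DERIV_cdivide[OF DERIV_chain2[OF DERIV_positive_part_square dm]])
    then show ?thesis using X p by (simp add: angle_kernel_def m_def)
  qed
  have "(\<integral>\<^sup>+\<gamma>. ennreal (angle_kernel \<gamma> X) * indicator {0<..<pi} \<gamma> \<partial>lborel)
      = (\<integral>\<^sup>+\<gamma>. ennreal (angle_kernel \<gamma> X) * indicator {0..pi} \<gamma> \<partial>lborel)"
    using AE_lborel_singleton[of 0] AE_lborel_singleton[of pi]
    by (intro nn_integral_cong_AE) (auto elim!: eventually_elim2 simp: indicator_def)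
  also have "\<dots> = ennreal (F pi - F 0)"
  proof (rule nn_integral_FTC_Icc)
    show "0 \<le> angle_kernel x X" if "x \<in> {0..pi}" for x
      using W[of x] sin_ge_zero[of x] that unfolding angle_kernel_def by simp
  qed (use dF in auto)
  also have "F pi - F 0 = profile X"
  proof -
    have q: "quad pi X = \<bar>X + 1\<bar>\<^sup>2" "quad 0 X = \<bar>X - 1\<bar>\<^sup>2"
      by (simp_all add: quad_def power2_eq_square algebra_simps)
    have "ln (\<bar>X + 1\<bar>\<^sup>2) = 2 * ln \<bar>X + 1\<bar>" "ln (\<bar>X - 1\<bar>\<^sup>2) = 2 * ln \<bar>X - 1\<bar>"
      using X ln_realpow[of "\<bar>X + 1\<bar>" 2] ln_realpow[of "\<bar>X - 1\<bar>" 2] by simp_all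
    then have "m pi = a * ln \<bar>X\<bar> + p * ln \<bar>X + 1\<bar>" "m 0 = a * ln \<bar>X\<bar> + p * ln \<bar>X - 1\<bar>"
      unfolding m_def q by simp_all
    then show ?thesis by (simp add: F_def profile_def diff_divide_distrib)
  qed
  finally show ?thesis .
qed

lemma profile_minus: "profile (- X) = profile X"
proof -
  have "\<bar>- X + 1\<bar> = \<bar>X - 1\<bar>" "\<bar>- X - 1\<bar> = \<bar>X + 1\<bar>" by auto
  then show ?thesis unfolding profile_def abs_minus_cancel by (simp add: minus_divide_right[symmetric] diff_divide_distrib)
qed

text \<open>Each of the two half-angle substitutions contributes \<open>1 / pi\<close>, and folding
  the negative \<open>X\<close> onto the positive ones contributes the 2.\<close>

lemma excess_integral:
  "(\<integral>\<^sup>+w. \<integral>\<^sup>+z. ennreal (excess w z) \<partial>circle \<partial>circle)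
    = ennreal (2 / pi\<^sup>2) * (\<integral>\<^sup>+X. ennreal (profile X) * indicator {0<..} X \<partial>lborel)"
proof -

  have "(\<integral>\<^sup>+w. \<integral>\<^sup>+z. ennreal (excess w z) \<partial>circle \<partial>circle)
      = ennreal (1 / pi) * (\<integral>\<^sup>+\<gamma>. (\<integral>\<^sup>+z. ennreal (excess (cis (2 * \<gamma>)) z) \<partial>circle)
          * indicator {0<..<pi} \<gamma> \<partial>lborel)"
    by (rule nn_integral_circle_double_angle) measurable
  also have "(\<integral>\<^sup>+\<gamma>. (\<integral>\<^sup>+z. ennreal (excess (cis (2 * \<gamma>)) z) \<partial>circle) * indicator {0<..<pi} \<gamma> \<partial>lborel)
      = (\<integral>\<^sup>+\<gamma>. ennreal (1 / pi) * (\<integral>\<^sup>+X. ennreal (angle_kernel \<gamma> X) * indicator {0<..<pi} \<gamma> \<partial>lborel) \<partial>lborel)"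
  proof (rule nn_integral_cong)
    fix \<gamma> :: real
    show "(\<integral>\<^sup>+z. ennreal (excess (cis (2 * \<gamma>)) z) \<partial>circle) * indicator {0<..<pi} \<gamma>
      = ennreal (1 / pi) * (\<integral>\<^sup>+X. ennreal (angle_kernel \<gamma> X) * indicator {0<..<pi} \<gamma> \<partial>lborel)"
    proof (cases "\<gamma> \<in> {0<..<pi}")
      case True
      then have "(\<integral>\<^sup>+z. ennreal (excess (cis (2 * \<gamma>)) z) \<partial>circle)
          = ennreal (1 / pi) * (\<integral>\<^sup>+X. ennreal (angle_kernel \<gamma> X) \<partial>lborel)"
        by (subst nn_integral_circle_double_angle) (auto simp: excess_angle_integral)
      then show ?thesis using True by simp
    qed simp
  qed
  also have "\<dots> = ennreal (1 / pi) * (\<integral>\<^sup>+\<gamma>. \<integral>\<^sup>+X. ennreal (angle_kernel \<gamma> X) * indicator {0<..<pi} \<gamma> \<partial>lborel \<partial>lborel)"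
    by (rule nn_integral_cmult) measurable
  also have "(\<integral>\<^sup>+\<gamma>. \<integral>\<^sup>+X. ennreal (angle_kernel \<gamma> X) * indicator {0<..<pi} \<gamma> \<partial>lborel \<partial>lborel)
      = (\<integral>\<^sup>+X. \<integral>\<^sup>+\<gamma>. ennreal (angle_kernel \<gamma> X) * indicator {0<..<pi} \<gamma> \<partial>lborel \<partial>lborel)"
    by (rule lborel_pair.Fubini') measurable
  also have "\<dots> = (\<integral>\<^sup>+X. ennreal (profile X) \<partial>lborel)"
  proof (rule nn_integral_cong_AE)
    show "AE X in lborel. (\<integral>\<^sup>+\<gamma>. ennreal (angle_kernel \<gamma> X) * indicator {0<..<pi} \<gamma> \<partial>lborel) = ennreal (profile X)"
      using AE_lborel_singleton[of 0] AE_lborel_singleton[of 1] AE_lborel_singleton[of "- 1"]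
      by eventually_elim (rule angle_kernel_integral)
  qed
  also have "\<dots> = (\<integral>\<^sup>+X. ennreal (profile X) * indicator {0<..} X + ennreal (profile X) * indicator {..<0} X \<partial>lborel)"
    using AE_lborel_singleton[of 0]
    by (intro nn_integral_cong_AE) (auto elim!: eventually_mono simp: indicator_def)
  also have "\<dots> = (\<integral>\<^sup>+X. ennreal (profile X) * indicator {0<..} X \<partial>lborel)
      + (\<integral>\<^sup>+X. ennreal (profile X) * indicator {..<0} X \<partial>lborel)"
    by (rule nn_integral_add) measurable
  also have "(\<integral>\<^sup>+X. ennreal (profile X) * indicator {..<0} X \<partial>lborel)
      = ennreal \<bar>- 1\<bar> * (\<integral>\<^sup>+X. ennreal (profile (0 + - 1 * X)) * indicator {..<0} (0 + - 1 * X) \<partial>lborel)"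
    by (rule nn_integral_real_affine) auto
  also have "\<dots> = (\<integral>\<^sup>+X. ennreal (profile X) * indicator {0<..} X \<partial>lborel)"
    by (simp add: profile_minus, intro nn_integral_cong) (auto simp: indicator_def)
  finally have "(\<integral>\<^sup>+w. \<integral>\<^sup>+z. ennreal (excess w z) \<partial>circle \<partial>circle)
    = ennreal (1 / pi) * (ennreal (1 / pi) * (ennreal 2 *
        (\<integral>\<^sup>+X. ennreal (profile X) * indicator {0<..} X \<partial>lborel)))"
    by (simp add: mult_2)
  also have "\<dots> = ennreal (1 / pi * (1 / pi * 2)) * (\<integral>\<^sup>+X. ennreal (profile X) * indicator {0<..} X \<partial>lborel)"
  proof -
    have "ennreal (1 / pi * (1 / pi * 2)) = ennreal (1 / pi) * (ennreal (1 / pi) * ennreal 2)"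
      by (subst ennreal_mult, simp, simp, subst ennreal_mult, simp, simp, rule refl)
    then show ?thesis by (simp only: mult.assoc)
  qed
  finally show ?thesis by (simp add: power2_eq_square)
qed

end

end

section \<open>The Mahler measure\<close>

text \<open>An additive form replaces subtraction in \<open>ennreal\<close>:
  \<open>M - ln (max A B)\<close> and \<open>ln (max A B) - ln A\<close> are both nonnegative and
  sum to \<open>M - ln A\<close>.\<close>

lemma max_defect_add_excess:
  fixes w z :: complex
  assumes pq: "0 < p" "p < q" and M: "M = real (q + 1) * ln 2"
    and n: "norm w = 1" "norm z = 1" and ne: "w \<noteq> 1" "z \<noteq> 1" "w * z \<noteq> 1"
  shows "max_defect p q M (norm (z - 1)) (norm (1 - w * z)) (norm (w - 1))
    + ennreal (excess (real (q - p)) (real p) w z) = ennreal (M - real q * ln (norm (z - 1)))"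
proof -
  define A where "A = norm (z - 1) ^ q"
  define B where "B = norm (1 - w * z) ^ (q - p) * norm (w - 1) ^ p"
  have pos: "0 < norm (z - 1)" "0 < norm (1 - w * z)" "0 < norm (w - 1)" using ne by auto
  then have "0 < A" "0 < B" by (auto simp: A_def B_def)
  have lA: "ln A = real q * ln (norm (z - 1))" using pos by (simp add: A_def ln_realpow)
  have lB: "ln B = real (q - p) * ln (norm (1 - w * z)) + real p * ln (norm (w - 1))"
    using pos by (simp add: B_def ln_mult ln_realpow)
  have sum: "real (q - p) + real p = real q" using pq by simp
  have "ln (max A B) = max (ln A) (ln B)"
    using \<open>0 < A\<close> \<open>0 < B\<close> by (auto simp: max_def)
  also have "\<dots> = ln A + excess (real (q - p)) (real p) w z"
    unfolding excess_def sum lA lB by (simp add: max_def)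
  finally have ln_max: "ln (max A B) = ln A + excess (real (q - p)) (real p) w z" .
  have "A \<le> 2 ^ q" unfolding A_def using n by (intro power_mono norm_diff_le_2) auto
  moreover have "B \<le> 2 ^ (q - p) * 2 ^ p" unfolding B_def
    using n by (intro mult_mono power_mono norm_diff_le_2) (auto simp: norm_mult)
  moreover have "(2::real) ^ (q - p) * 2 ^ p = 2 ^ q" using pq by (simp flip: power_add)
  ultimately have "max A B \<le> 2 ^ q" by simp
  also have "(2::real) ^ q \<le> 2 ^ (q + 1)" by simp
  finally have "ln (max A B) \<le> ln (2 ^ (q + 1))" using \<open>0 < A\<close> by simp
  also have "\<dots> = M" unfolding M by (rule ln_realpow)
  finally have nonneg: "0 \<le> M - ln (max A B)" by simp
  have "ennreal (M - ln (max A B)) + ennreal (excess (real (q - p)) (real p) w z)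
      = ennreal (M - ln (max A B) + excess (real (q - p)) (real p) w z)"
    using nonneg by (intro ennreal_plus[symmetric]) (auto simp: excess_def)
  then show ?thesis unfolding ln_max by (simp add: max_defect_def A_def[symmetric] B_def[symmetric] ln_max lA)
qed

text \<open>The logarithm of \<open>|z - 1|\<close> has mean 0 on the circle by the boundary case of
  Jensen's formula, so the sum of the two integrals is \<open>M\<close>.\<close>

lemma max_defect_integral:
  assumes pq: "0 < p" "p < q" and M: "M = real (q + 1) * ln 2"
    and E: "(\<integral>\<^sup>+w. \<integral>\<^sup>+z. ennreal (excess (real (q - p)) (real p) w z) \<partial>circle \<partial>circle) = ennreal e"
    and e: "0 \<le> e"
  shows "(\<integral>\<^sup>+w. \<integral>\<^sup>+z. max_defect p q M (norm (z - 1)) (norm (1 - w * z)) (norm (w - 1)) \<partial>circle \<partial>circle)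
    = ennreal (M - e)" "e \<le> M"
proof -
  let ?N = "\<integral>\<^sup>+w. \<integral>\<^sup>+z. max_defect p q M (norm (z - 1)) (norm (1 - w * z)) (norm (w - 1)) \<partial>circle \<partial>circle"

  have q0: "0 < real q" using pq by simp
  have "0 \<le> M" by (simp add: M)
  have z_int: "(\<integral>\<^sup>+z. ennreal (M - real q * ln (norm (z - 1))) \<partial>circle) = ennreal M"
  proof -
    \<comment> \<open>Jensen's formula is applied with the bound \<open>M / q\<close>, at least
      \<open>ln 2\<close>, and scaled by \<open>q\<close> afterwards.\<close>
    have "norm (1::complex) + norm (1::complex) \<le> exp (M / real q)"
    proof -
      have "ln 2 \<le> M / real q" using q0 by (simp add: M field_simps)
      then have "exp (ln 2) \<le> exp (M / real q)" by (simp only: exp_le_cancel_iff)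
      then show ?thesis by simp
    qed
    then have J: "(\<integral>\<^sup>+z. ennreal (M / real q - ln (norm (z - 1))) \<partial>circle) = ennreal (M / real q)"
      using jensen_circle[of 1 1 "M / real q" 1] by simp
    have "(\<integral>\<^sup>+z. ennreal (M - real q * ln (norm (z - 1))) \<partial>circle)
        = (\<integral>\<^sup>+z. ennreal (real q) * ennreal (M / real q - ln (norm (z - 1))) \<partial>circle)"
      using q0 by (intro nn_integral_cong) (simp add: ennreal_mult'[symmetric] right_diff_distrib)
    also have "\<dots> = ennreal (real q) * ennreal (M / real q)"
      unfolding J[symmetric] by (rule nn_integral_cmult) measurable
    also have "\<dots> = ennreal M" using q0 by (simp add: ennreal_mult'[symmetric])
    finally show ?thesis .
  qed
  have "?N + ennreal e = (\<integral>\<^sup>+w. (\<integral>\<^sup>+z. max_defect p q M (norm (z - 1)) (norm (1 - w * z)) (norm (w - 1)) \<partial>circle)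
      + (\<integral>\<^sup>+z. ennreal (excess (real (q - p)) (real p) w z) \<partial>circle) \<partial>circle)"
    unfolding E[symmetric] by (rule nn_integral_add[symmetric]) measurable
  also have "\<dots> = (\<integral>\<^sup>+w. ennreal M \<partial>circle)"
  proof (rule nn_integral_cong_AE)
    show "AE w in circle. (\<integral>\<^sup>+z. max_defect p q M (norm (z - 1)) (norm (1 - w * z)) (norm (w - 1)) \<partial>circle)
      + (\<integral>\<^sup>+z. ennreal (excess (real (q - p)) (real p) w z) \<partial>circle) = ennreal M"
      using AE_circle_norm AE_circle_neq[of 1]
    proof eventually_elim
      case w: (elim w)
      have "(\<integral>\<^sup>+z. max_defect p q M (norm (z - 1)) (norm (1 - w * z)) (norm (w - 1)) \<partial>circle)
          + (\<integral>\<^sup>+z. ennreal (excess (real (q - p)) (real p) w z) \<partial>circle)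
        = (\<integral>\<^sup>+z. max_defect p q M (norm (z - 1)) (norm (1 - w * z)) (norm (w - 1))
          + ennreal (excess (real (q - p)) (real p) w z) \<partial>circle)"
        by (rule nn_integral_add[symmetric]) measurable
      also have "\<dots> = (\<integral>\<^sup>+z. ennreal (M - real q * ln (norm (z - 1))) \<partial>circle)"
      proof (rule nn_integral_cong_AE)
        show "AE z in circle. max_defect p q M (norm (z - 1)) (norm (1 - w * z)) (norm (w - 1))
          + ennreal (excess (real (q - p)) (real p) w z) = ennreal (M - real q * ln (norm (z - 1)))"
          using AE_circle_norm AE_circle_neq[of 1] AE_circle_neq[of "1 / w"]
        proof eventually_elim
          case (elim z)
          have "w \<noteq> 0" using w by auto
          then have "w * z \<noteq> 1" using elim(3) by (metis nonzero_mult_div_cancel_left)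
          then show ?case using w elim by (intro max_defect_add_excess pq M)
        qed
      qed
      finally show ?case using z_int by simp
    qed
  qed
  also have "\<dots> = ennreal M" using circle.emeasure_space_1 by simp
  finally have *: "?N + ennreal e = ennreal M" .
  then have "?N \<noteq> \<infinity>" by auto
  then obtain r where r: "?N = ennreal r" "0 \<le> r" by (cases ?N) auto
  then have "ennreal (r + e) = ennreal M" using * e by (simp add: ennreal_plus)
  then have "r + e = M" using r e \<open>0 \<le> M\<close> by (subst (asm) ennreal_inj) auto
  then show "?N = ennreal (M - e)" "e \<le> M" using r by auto
qed

text \<open>The signed Lebesgue integral is recovered as the integral of the constant
  \<open>M\<close> minus that of the nonnegative \<open>M - L\<close>, both known to be
  finite.\<close>

lemma mahler_measure_if_norm_eq_trinomial_resultant: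
  fixes g :: "(6, complex) mvpoly"
  assumes pq: "0 < p" "p < q"
    and g: "\<And>x. norm (mv_eval g x) = norm (trinomial_resultant p q (\<lambda>i. x $ i))"
    and E: "(\<integral>\<^sup>+w. \<integral>\<^sup>+z. ennreal (excess (real (q - p)) (real p) w z) \<partial>circle \<partial>circle) = ennreal e"
    and e: "0 \<le> e"
  shows "mahler_measure g = e"
proof -
  define M where "M = real (q + 1) * ln 2"
  note D = max_defect_integral[OF pq M_def E e]
  define Q :: "(real ^ 6) set" where "Q = cbox 0 (\<chi> j. 2 * pi)"
  define c where "c = (2 * pi) ^ 6"
  have c: "0 < c" by (simp add: c_def)
  define L where "L = (\<lambda>\<theta> :: real ^ 6. ln (norm (trinomial_resultant p q (\<lambda>j. cis (\<theta> $ j)))))"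
  have [measurable]: "Q \<in> sets borel" by (simp add: Q_def)
  have [measurable]: "L \<in> borel_measurable borel"
    unfolding L_def trinomial_resultant_def by measurable
  have L_le: "L \<theta> \<le> M" for \<theta>
  proof -
    define v where "v = (\<lambda>j. cis (\<theta> $ j))"
    have v: "norm (v i * v j) = 1" for i j by (simp add: v_def norm_mult)
    have "norm (trinomial_resultant p q v) \<le> norm ((v 3 * v 4 - v 1 * v 6) ^ q)
        + norm ((v 2 * v 6 - v 3 * v 5) ^ (q - p) * (v 1 * v 5 - v 2 * v 4) ^ p)"
      unfolding trinomial_resultant_def by (rule norm_triangle_ineq4)
    also have "\<dots> \<le> 2 ^ q + 2 ^ (q - p) * 2 ^ p"
      unfolding norm_mult norm_power using v
      by (intro add_mono mult_mono power_mono norm_diff_le_2) auto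
    also have "\<dots> = 2 ^ (q + 1)" using pq by (simp flip: power_add)
    finally have le: "norm (trinomial_resultant p q v) \<le> 2 ^ (q + 1)" .
    have M2: "ln (2 ^ (q + 1) :: real) = M" unfolding M_def by (rule ln_realpow)
    show ?thesis
    proof (cases "trinomial_resultant p q v = 0")
      \<comment> \<open>By the convention \<open>ln 0 = 0\<close> this only says that
        \<open>M\<close> is nonnegative.\<close>
      case True
      then show ?thesis by (simp add: L_def v_def M_def)
    next
      case False
      then have "ln (norm (trinomial_resultant p q v)) \<le> ln (2 ^ (q + 1))"
        using le by (subst ln_le_cancel_iff) auto
      then show ?thesis unfolding M2 by (simp add: L_def v_def)
    qed
  qed
  have bochner: "has_bochner_integral lborel (\<lambda>\<theta>. indicator Q \<theta> * h \<theta>) (c * r)"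
    if "h \<in> borel_measurable borel" "\<And>\<theta>. 0 \<le> h \<theta>" "0 \<le> r"
      "(\<integral>\<^sup>+\<theta>. ennreal (h \<theta>) * indicator Q \<theta> \<partial>lborel) = ennreal c * ennreal r" for h r
  proof -
    have "(\<integral>\<^sup>+\<theta>. ennreal (indicator Q \<theta> * h \<theta>) \<partial>lborel)
        = (\<integral>\<^sup>+\<theta>. ennreal (h \<theta>) * indicator Q \<theta> \<partial>lborel)"
      by (intro nn_integral_cong) (auto simp: indicator_def)
    also have "\<dots> = ennreal (c * r)" using that c by (simp add: ennreal_mult)
    finally show ?thesis using that c
      by (intro has_bochner_integral_nn_integral) auto
  qed
  have 1: "has_bochner_integral lborel (\<lambda>\<theta>. indicator Q \<theta> * M) (c * M)"
  proof (rule bochner)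
    show "(\<integral>\<^sup>+\<theta>. ennreal M * indicator Q \<theta> \<partial>lborel) = ennreal c * ennreal M"
    proof -
      interpret P: prob_space "\<Pi>\<^sub>M j\<in>(UNIV :: 6 set). circle"
        by (rule prob_space_PiM) (rule circle.prob_space_axioms)
      have "(\<integral>\<^sup>+\<theta>. ennreal M * indicator Q \<theta> \<partial>lborel)
          = ennreal c * (\<integral>\<^sup>+z. ennreal M \<partial>(\<Pi>\<^sub>M j\<in>(UNIV :: 6 set). circle))"
        using nn_integral_torus[of "\<lambda>_ :: complex ^ 6. ennreal M"] by (simp add: Q_def c_def)
      then show ?thesis using P.emeasure_space_1 by simp
    qed
  qed (auto simp: M_def)
  have 2: "has_bochner_integral lborel (\<lambda>\<theta>. indicator Q \<theta> * (M - L \<theta>)) (c * (M - e))"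
  proof (rule bochner)
    define F where "F = (\<lambda>x :: complex ^ 6. ennreal (M - ln (norm (trinomial_resultant p q (\<lambda>i. x $ i)))))"
    have [measurable]: "(\<lambda>x :: complex ^ 6. x $ i) \<in> borel_measurable borel" for i
      by (intro borel_measurable_continuous_onI continuous_intros)
    have "F \<in> borel_measurable borel"
      unfolding F_def trinomial_resultant_def by measurable
    from nn_integral_torus[OF this]
    have "(\<integral>\<^sup>+\<theta>. ennreal (M - L \<theta>) * indicator Q \<theta> \<partial>lborel) = ennreal c *
        (\<integral>\<^sup>+z. ennreal (M - ln (norm (trinomial_resultant p q z))) \<partial>(\<Pi>\<^sub>M j\<in>UNIV. circle))"
      by (simp add: vec_lambda_inverse F_def L_def Q_def c_def)
    then show "(\<integral>\<^sup>+\<theta>. ennreal (M - L \<theta>) * indicator Q \<theta> \<partial>lborel) = ennreal c * ennreal (M - e)"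
      unfolding nn_integral_trinomial_resultant[OF pq M_def] D(1) .
  qed (use L_le D(2) in auto)
  have "has_bochner_integral lborel (\<lambda>\<theta>. indicator Q \<theta> * M - indicator Q \<theta> * (M - L \<theta>)) (c * M - c * (M - e))"
    by (rule has_bochner_integral_diff[OF 1 2])
  then have "has_bochner_integral lborel (\<lambda>\<theta>. indicator Q \<theta> * L \<theta>) (c * e)"
    by (simp add: right_diff_distrib)
  then have "(LINT \<theta> : Q | lborel. L \<theta>) = c * e"
    by (simp add: set_lebesgue_integral_def has_bochner_integral_integral_eq)
  moreover have "L = (\<lambda>\<theta>. ln (norm (mv_eval g (\<chi> j. cis (\<theta> $ j)))))"
    by (simp add: L_def g)
  ultimately show ?thesis using c by (simp add: mahler_measure_def Q_def c_def)
qed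

theorem theorem5:
  fixes p q :: nat
    and \<phi> \<Phi> :: real
    and R :: "(6, int) mvpoly"
  assumes "0 < p" and "p < q" and "coprime p q"
    and "\<phi> ^ q + \<phi> ^ (q - p) - 1 = 0" and "0 \<le> \<phi>" and "\<phi> \<le> 1"
    and "\<Phi> ^ q - \<Phi> ^ (q - p) - 1 = 0" and "1 \<le> \<Phi>"
    and "is_sparse_resultant p q R"
  shows "mahler_measure (complexify R) =
    2 / pi\<^sup>2 *
      (- real p * P3 (of_real (\<phi> ^ q)) - real q * P3 (of_real (- (\<phi> ^ p)))
       + real p * P3 (of_real (\<Phi> ^ q)) + real q * P3 (of_real (\<Phi> ^ p)))"
proof -
  note pq = assms(1,2)
  define a where "a = real (q - p)"
  have a: "0 < a" "0 < real p" and aq: "a + real p = real q" using pq by (auto simp: a_def)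
  have "\<phi> \<noteq> 0" using assms(4) pq by (auto simp: power_0_left)
  moreover have "\<phi> \<noteq> 1" using assms(4) by auto
  ultimately have \<phi>: "0 < \<phi>" "\<phi> < 1" using assms(5,6) by auto
  have "\<Phi> \<noteq> 1" using assms(7) by auto
  then have \<Phi>: "1 < \<Phi>" using assms(8) by auto
  have \<phi>q: "\<phi> ^ (q - p) * \<phi> ^ p = \<phi> ^ q" and \<Phi>q: "\<Phi> ^ (q - p) * \<Phi> ^ p = \<Phi> ^ q"
    using pq by (simp_all flip: power_add)
  define X0 where "X0 = \<phi> ^ p"
  define X1 where "X1 = \<Phi> ^ p"
  have X0: "0 < X0" "X0 < 1" using \<phi> pq by (auto simp: X0_def power_less_one_iff)
  have X1: "1 < X1" using \<Phi> pq by (auto simp: X1_def)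
  have r0: "\<phi> ^ (q - p) * (1 + X0) = 1"
    using assms(4) \<phi>q by (simp add: X0_def distrib_left)
  have r1: "\<Phi> ^ (q - p) * (X1 - 1) = 1"
    using assms(7) \<Phi>q by (simp add: X1_def right_diff_distrib)
  \<comment> \<open>Taking logarithms in \<open>r0\<close> and scaling by \<open>p\<close> shows
    that \<open>X0\<close> is the lower end of the integration range; \<open>l1\<close> does the
    same for \<open>X1\<close> from \<open>r1\<close>.\<close>
  have l0: "a * ln X0 + real p * ln (1 + X0) = 0"
  proof -
    have "ln (\<phi> ^ (q - p) * (1 + X0)) = a * ln \<phi> + ln (1 + X0)"
      using \<phi> X0 by (simp add: ln_mult ln_realpow a_def)
    then have "ln (1 + X0) = - (a * ln \<phi>)" unfolding r0 by simp
    moreover have "ln X0 = real p * ln \<phi>" using \<phi> by (simp add: X0_def ln_realpow)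
    ultimately show ?thesis by simp
  qed
  have l1: "a * ln X1 + real p * ln (X1 - 1) = 0"
  proof -
    have "ln (\<Phi> ^ (q - p) * (X1 - 1)) = a * ln \<Phi> + ln (X1 - 1)"
      using \<Phi> X1 by (simp add: ln_mult ln_realpow a_def)
    then have "ln (X1 - 1) = - (a * ln \<Phi>)" unfolding r1 by simp
    moreover have "ln X1 = real p * ln \<Phi>" using \<Phi> by (simp add: X1_def ln_realpow)
    ultimately show ?thesis by simp
  qed
  define K where "K = (a + real p) * P3r (1 / X1) + real p * P3r (1 - 1 / X1)
    - (a + real p) * P3r (- X0) - real p * P3r (X0 / (1 + X0))"
  have K: "(\<integral>\<^sup>+X. ennreal (profile a (real p) X) * indicator {0<..} X \<partial>lborel) = ennreal K" "0 \<le> K"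
  proof -
    have "(\<integral>\<^sup>+X. ennreal (profile a (real p) X) * indicator {0<..} X \<partial>lborel)
      = (\<integral>\<^sup>+X. ennreal (((max 0 (a * ln X + real p * ln (1 + X))) ^ 2
        - (max 0 (a * ln X + real p * ln \<bar>X - 1\<bar>)) ^ 2) / (2 * real p * X)) * indicator {0<..} X \<partial>lborel)"
      by (intro nn_integral_cong) (auto simp: profile_def indicator_def add.commute)
    then show "(\<integral>\<^sup>+X. ennreal (profile a (real p) X) * indicator {0<..} X \<partial>lborel) = ennreal K"
      using nn_integral_profile(1)[OF a X0 l0 X1 l1] by (simp only: K_def)
    show "0 \<le> K" unfolding K_def by (rule nn_integral_profile(2)[OF a X0 l0 X1 l1])
  qed
  have "(\<integral>\<^sup>+w. \<integral>\<^sup>+z. ennreal (excess a (real p) w z) \<partial>circle \<partial>circle) = ennreal (2 / pi\<^sup>2 * K)"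
    unfolding excess_integral[OF a] K(1) using K(2) by (intro ennreal_mult[symmetric]) auto
  then have "mahler_measure (complexify R) = 2 / pi\<^sup>2 * K"
    using K(2) norm_sparse_resultant[OF assms(1-3,9)]
    by (intro mahler_measure_if_norm_eq_trinomial_resultant[OF pq]) (auto simp: a_def)
  also have "K = - real p * P3 (of_real (\<phi> ^ q)) - real q * P3 (of_real (- (\<phi> ^ p)))
       + real p * P3 (of_real (\<Phi> ^ q)) + real q * P3 (of_real (\<Phi> ^ p))"
  proof -
    have "P3 (of_real (\<phi> ^ q)) = P3r (X0 / (1 + X0))"
    proof -
      have "1 / (1 + X0) = \<phi> ^ (q - p)" using r0 X0 by (simp add: field_simps)
      then have "X0 / (1 + X0) = \<phi> ^ q" using \<phi>q by (metis X0_def divide_inverse inverse_eq_divide mult.commute)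
      then show ?thesis using \<phi> pq by (subst P3_of_real_less_1) (auto simp: power_less_one_iff)
    qed
    moreover have "P3 (of_real (- (\<phi> ^ p))) = P3r (- X0)"
      unfolding X0_def[symmetric] using X0 by (intro P3_of_real_less_1) auto
    \<comment> \<open>The equation for \<open>\<Phi>\<close> turns \<open>1 - 1 / X1\<close> into
      the reciprocal of \<open>\<Phi> ^ q\<close>, at which \<open>P3\<close> has the same value as
      at \<open>\<Phi> ^ q\<close>.\<close>
    moreover have "P3 (of_real (\<Phi> ^ q)) = P3r (1 - 1 / X1)"
    proof -
      have "X1 - 1 = 1 / \<Phi> ^ (q - p)" using r1 \<Phi> by (simp add: field_simps)
      moreover have "1 - 1 / X1 = (X1 - 1) / X1" using X1 by (simp add: field_simps)
      ultimately have "1 - 1 / X1 = 1 / \<Phi> ^ q" using \<Phi>q by (simp add: X1_def)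
      then show ?thesis using \<Phi> pq by (subst P3_of_real_greater_1) auto
    qed
    moreover have "P3 (of_real (\<Phi> ^ p)) = P3r (1 / X1)"
      unfolding X1_def[symmetric] by (rule P3_of_real_greater_1[OF X1])
    ultimately show ?thesis unfolding K_def aq by simp
  qed
  finally show ?thesis .
qed

end
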